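(* Let $F$ be a field of characteristic zero and let $C=F(e_{11}+e_{22})\oplus Fe_{12}$, a subalgebra of the algebra of $2\times 2$ matrices over $F$ ($e_{ij}$ are the matrix units). Let $\varepsilon$ be the derivation of $C$ given by $\varepsilon(\alpha(e_{11}+e_{22})+\beta e_{12})=\beta e_{12}$ for all $\alpha,\beta\in F$, let $L=F\varepsilon$ be the one-dimensional Lie algebra of derivations of $C$ spanned by $\varepsilon$ (this is the Lie algebra of all derivations of $C$), and let $C^{\varepsilon}$ denote $C$ regarded as an $L$-algebra. Then: (1) $\mathrm{Id}^L(C^\varepsilon)=\langle [x,y],\ x^\varepsilon y^\varepsilon,\ x^{\varepsilon^2}-x^\varepsilon\rangle_{T_L}$; (2) $c_n^L(C^\varepsilon)=n+1$ for all $n\ge 1$; (3) $\chi_n^L(C^\varepsilon)=2\chi_{(n)}+\chi_{(n-1,1)}$ for all $n\geq 1$, where the term $\chi_{(n-1,1)}$ is omitted if $n=1$.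
   Context: An $L$-algebra is an associative algebra $A$ over $F$ on which a Lie algebra $L$ acts by derivations; the action extends to the universal enveloping algebra $U(L)$, products acting by composition, i.e. $(gh)(a)=g(h(a))$. Fix a basis $\mathcal B\ni 1$ of $U(L)$. $F\langle X|L\rangle$ is the free associative algebra (without constant terms) on the free generators $x_j^{h}$, $h\in\mathcal B$, $j\in\mathbb N$; one writes $x_j=x_j^1$ and extends $x_j^h$ linearly to all $h\in U(L)$. $U(L)$ acts on it with each $\gamma\in L$ acting as the derivation with $\gamma(x_j^h)=x_j^{\gamma h}$; for a polynomial $f$ and $h\in U(L)$, $f^h=h(f)$. Elements are differential polynomials; $f(x_1,\dots,x_n)$ is a differential identity of $A$ if it vanishes under all substitutions $x_i\mapsto a_i\in A$ (with $x_i^h\mapsto h(a_i)$). $\mathrm{Id}^L(A)$ is the set of differential identities of $A$. A $T_L$-ideal is a two-sided ideal of $F\langle X|L\rangle$ stable under the $U(L)$-action and under all substitutions $x_j\mapsto g_j\in F\langle X|L\rangle$ (with $x_j^h\mapsto h(g_j)$); $\langle S\rangle_{T_L}$ is the $T_L$-ideal generated by $S$. Letters $x,y$ denote distinct variables of $X=\{x_1,x_2,\dots\}$, and $[x,y]=xy-yx$. $P_n^L=\mathrm{span}_F\{x_{\sigma(1)}^{h_1}\cdots x_{\sigma(n)}^{h_n}\mid \sigma\in S_n,\ h_i\in\mathcal B\}$ is the space of multilinear differential polynomials in $x_1,\dots,x_n$, with $S_n$ acting by $\sigma(x_i^h)=x_{\sigma(i)}^h$. The $n$th differential codimension is $c_n^L(A)=\dim_F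 P_n^L/(P_n^L\cap \mathrm{Id}^L(A))$ and the $n$th differential cocharacter $\chi_n^L(A)$ is the $S_n$-character of this quotient. For $\lambda\vdash n$, $\chi_\lambda$ is the irreducible $S_n$-character associated to $\lambda$. *)

theory Defs
  imports
    "HOL-Analysis.Finite_Cartesian_Product"
    "HOL-Analysis.Cartesian_Space"
    "HOL-Combinatorics.Permutations"
    "HOL-Library.Poly_Mapping"
    "HOL-Library.Function_Algebras"
begin

section \<open>Quotients of vector spaces\<close>

locale quot_space = vector_space scale for scale :: "'a::field \<Rightarrow> 'b::ab_group_add \<Rightarrow> 'b"
begin

text \<open>
  \<open>S\<close> is a set of representatives of a basis of \<open>V / W\<close>, where \<open>W\<close> is a subspace of \<open>V\<close>.
\<close>

definition basis_mod :: "'b set \<Rightarrow> 'b set \<Rightarrow> 'b set \<Rightarrow> bool" where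
  "basis_mod V W S \<longleftrightarrow> S \<subseteq> V \<and>
     (\<forall>v\<in>V. \<exists>!c. finite {b. c b \<noteq> 0} \<and> {b. c b \<noteq> 0} \<subseteq> S \<and>
        v - (\<Sum>b | c b \<noteq> 0. scale (c b) b) \<in> W)"

definition coords_mod :: "'b set \<Rightarrow> 'b set \<Rightarrow> 'b \<Rightarrow> 'b \<Rightarrow> 'a" where
  "coords_mod W S v = (THE c. finite {b. c b \<noteq> 0} \<and> {b. c b \<noteq> 0} \<subseteq> S \<and>
     v - (\<Sum>b | c b \<noteq> 0. scale (c b) b) \<in> W)"

text \<open>Meaningful for finite-dimensional \<open>V / W\<close>; the value is \<open>0\<close> in infinite dimension.\<close>

definition quot_dim :: "'b set \<Rightarrow> 'b set \<Rightarrow> nat" where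
  "quot_dim V W = card (SOME S. basis_mod V W S)"

text \<open>
  The trace of the endomorphism of the finite-dimensional space \<open>V / W\<close> induced by a linear
  map \<open>f\<close> that preserves \<open>V\<close> and \<open>W\<close>.
\<close>

definition quot_trace :: "'b set \<Rightarrow> 'b set \<Rightarrow> ('b \<Rightarrow> 'b) \<Rightarrow> 'a" where
  "quot_trace V W f =
     (let S = (SOME S. basis_mod V W S) in \<Sum>b\<in>S. coords_mod W S (f b) b)"

lemma basis_mod_exists:
  assumes V: "subspace V" and W: "subspace W" "W \<subseteq> V" and x: "x \<in> V" "x \<notin> W"
  shows "\<exists>S. basis_mod V W S \<and> x \<in> S"
proof -
  obtain D where D: "D \<subseteq> W" "independent D" "W \<subseteq> span D"
    by (rule basis_exists[of W])
  have span_D: "span D = W"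
    using span_minimal[OF D(1) W(1)] D(3) by (rule subset_antisym)
  have "x \<notin> span D"
    using x by (simp only: span_D not_False_eq_True)
  then have "independent (insert x D)"
    by (rule independent_insertI) (rule D(2))
  moreover have "insert x D \<subseteq> V"
    using D(1) W(2) x(1) by blast
  ultimately obtain E where E: "insert x D \<subseteq> E" "E \<subseteq> V" "independent E" "V \<subseteq> span E"
    using maximal_independent_subset_extend[of "insert x D" V] by metis
  have D_E: "D \<subseteq> E"
    using E(1) by blast
  define comb where "comb c = (\<Sum>b | c b \<noteq> 0. scale (c b) b)" for c
  define coord where "coord c v \<longleftrightarrow> finite {b. c b \<noteq> 0} \<and> {b. c b \<noteq> 0} \<subseteq> E - D \<and> v - comb c \<in> W"
    for c v
  have rep_comb: "representation E (comb c) = c \<and> comb c \<in> span E"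
    if "finite {b. c b \<noteq> 0}" "{b. c b \<noteq> 0} \<subseteq> E" for c
  proof -
    have "comb c \<in> span E"
      unfolding comb_def using that(2) by (intro span_sum span_scale span_base) blast
    moreover have "representation E (comb c) = c"
      by (rule representation_eqI[OF E(3) calculation _ that(1)]) (use that(2) in \<open>auto simp: comb_def\<close>)
    ultimately show ?thesis by blast
  qed
  have "\<exists>!c. coord c v" if v: "v \<in> V" for v
  proof -
    define r where "r = representation E v"
    define c' where "c' b = (if b \<in> D then 0 else r b)" for b
    have vE: "v \<in> span E"
      using E(4) v by blast
    have fin: "finite {b. r b \<noteq> 0}"
      unfolding r_def by (rule finite_representation)
    have sub: "{b. r b \<noteq> 0} \<subseteq> E"
      unfolding r_def by (rule subsetI, rule representation_ne_zero[of E v]) (rule CollectD)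
    have c'_sub: "{b. c' b \<noteq> 0} = {b. r b \<noteq> 0} - D"
      by (auto simp: c'_def)
    have "v = (\<Sum>b | r b \<noteq> 0. scale (r b) b)"
      unfolding r_def by (rule sum_nonzero_representation_eq[OF E(3) vE, symmetric])
    also have "\<dots> = (\<Sum>b\<in>{b. r b \<noteq> 0} - D. scale (r b) b) + (\<Sum>b\<in>{b. r b \<noteq> 0} \<inter> D. scale (r b) b)"
      using sum.Int_Diff[OF fin, of _ D] by (simp add: add.commute)
    also have "(\<Sum>b\<in>{b. r b \<noteq> 0} - D. scale (r b) b) = comb c'"
      unfolding comb_def c'_sub by (rule sum.cong) (auto simp: c'_def)
    finally have "v - comb c' = (\<Sum>b\<in>{b. r b \<noteq> 0} \<inter> D. scale (r b) b)"
      by (simp only: add_diff_cancel_left')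
    also have "\<dots> \<in> W"
      using D(1) by (intro subspace_sum[OF W(1)] subspace_scale[OF W(1)]) blast
    finally have c': "coord c' v"
      unfolding coord_def c'_sub using fin sub by blast
    have "c = c'" if c: "coord c v" for c
    proof -
      have c_E: "finite {b. c b \<noteq> 0}" "{b. c b \<noteq> 0} \<subseteq> E - D" "v - comb c \<in> span D"
        using c unfolding coord_def span_D by blast+
      then have rep: "representation E (comb c) = c" "comb c \<in> span E"
        using rep_comb[of c] by blast+
      have "representation E (v - comb c) = (\<lambda>b. r b - c b)"
        using representation_diff[OF E(3) rep(2) vE] unfolding rep r_def .
      then have eq: "representation D (v - comb c) = (\<lambda>b. r b - c b)"
        using representation_extend[OF E(3) c_E(3) D_E] by simp
      show ?thesis
      proof
        fix b
        show "c b = c' b"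
        proof (cases "b \<in> D")
          case True
          then show ?thesis using c_E(2) by (auto simp: c'_def)
        next
          case False
          then have "representation D (v - comb c) b = 0"
            using representation_ne_zero[of D "v - comb c" b] by blast
          then show ?thesis using False by (simp add: eq c'_def)
        qed
      qed
    qed
    with c' show ?thesis by (rule ex1I)
  qed
  then have "\<forall>v\<in>V. \<exists>!c. coord c v"
    by (rule ballI)
  moreover have "E - D \<subseteq> V"
    using E(2) by blast
  ultimately have "basis_mod V W (E - D)"
    unfolding basis_mod_def coord_def comb_def by (intro conjI)
  moreover have "x \<in> E - D"
    using E(1) D(1) x(2) by blast
  ultimately show ?thesis by blast
qed

end


section \<open>Free associative algebras\<close>

text \<open>
  With concatenation of words as addition, the convolution product of \<open>'g list \<Rightarrow>\<^sub>0 'a\<close> makes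
  this type the free associative unital algebra on \<open>'g\<close>.
\<close>

instantiation list :: (type) monoid_add
begin

definition zero_list :: "'a list" where "zero_list = []"

definition plus_list :: "'a list \<Rightarrow> 'a list \<Rightarrow> 'a list" where "plus_list = (@)"

instance
  by standard (simp_all add: zero_list_def plus_list_def)

end

definition fscale :: "'a::field \<Rightarrow> ('k \<Rightarrow>\<^sub>0 'a) \<Rightarrow> ('k \<Rightarrow>\<^sub>0 'a)" where
  "fscale c = Poly_Mapping.map ((*) c)"

lemma lookup_fscale [simp]: "Poly_Mapping.lookup (fscale c f) k = c * Poly_Mapping.lookup f k"
  by (auto simp: fscale_def Poly_Mapping.map.rep_eq when_def)

global_interpretation FV: quot_space "fscale :: 'a::field \<Rightarrow> ('k \<Rightarrow>\<^sub>0 'a) \<Rightarrow> ('k \<Rightarrow>\<^sub>0 'a)"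
  by standard (auto intro!: poly_mapping_eqI simp: lookup_add algebra_simps)

definition lin_ext :: "('a::field \<Rightarrow> 'v \<Rightarrow> 'v) \<Rightarrow> ('k \<Rightarrow> 'v) \<Rightarrow> ('k \<Rightarrow>\<^sub>0 'a) \<Rightarrow> 'v::comm_monoid_add" where
  "lin_ext sc g f = (\<Sum>k\<in>Poly_Mapping.keys f. sc (Poly_Mapping.lookup f k) (g k))"

definition monom :: "'k \<Rightarrow> ('k \<Rightarrow>\<^sub>0 'a::field)" where
  "monom k = Poly_Mapping.single k 1"

definition gen :: "'g \<Rightarrow> ('g list \<Rightarrow>\<^sub>0 'a::field)" where
  "gen x = monom [x]"

definition free_alg :: "'g set \<Rightarrow> ('g list \<Rightarrow>\<^sub>0 'a::field) set" where
  "free_alg X = {f. \<forall>w\<in>Poly_Mapping.keys f. set w \<subseteq> X}"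


section \<open>Lie algebras, enveloping algebras and \<open>L\<close>-algebras\<close>

record ('a, 'l) lie =
  lie_carrier :: "'l set"
  lie_scale :: "'a \<Rightarrow> 'l \<Rightarrow> 'l"
  lie_bracket :: "'l \<Rightarrow> 'l \<Rightarrow> 'l"

locale lie_algebra = vector_space "lie_scale L"
  for L :: "('a::field, 'l::ab_group_add) lie" +
  assumes subspace_carrier: "subspace (lie_carrier L)"
    and bracket_closed:
      "\<lbrakk>g \<in> lie_carrier L; h \<in> lie_carrier L\<rbrakk> \<Longrightarrow> lie_bracket L g h \<in> lie_carrier L"
    and bracket_add_left:
      "\<lbrakk>g \<in> lie_carrier L; g' \<in> lie_carrier L; h \<in> lie_carrier L\<rbrakk>
        \<Longrightarrow> lie_bracket L (g + g') h = lie_bracket L g h + lie_bracket L g' h"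
    and bracket_scale_left:
      "\<lbrakk>g \<in> lie_carrier L; h \<in> lie_carrier L\<rbrakk>
        \<Longrightarrow> lie_bracket L (lie_scale L c g) h = lie_scale L c (lie_bracket L g h)"
    and bracket_add_right:
      "\<lbrakk>g \<in> lie_carrier L; h \<in> lie_carrier L; h' \<in> lie_carrier L\<rbrakk>
        \<Longrightarrow> lie_bracket L g (h + h') = lie_bracket L g h + lie_bracket L g h'"
    and bracket_scale_right:
      "\<lbrakk>g \<in> lie_carrier L; h \<in> lie_carrier L\<rbrakk>
        \<Longrightarrow> lie_bracket L g (lie_scale L c h) = lie_scale L c (lie_bracket L g h)"
    and bracket_self: "g \<in> lie_carrier L \<Longrightarrow> lie_bracket L g g = 0"
    and jacobi:
      "\<lbrakk>g \<in> lie_carrier L; h \<in> lie_carrier L; k \<in> lie_carrier L\<rbrakk>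
        \<Longrightarrow> lie_bracket L g (lie_bracket L h k) + lie_bracket L h (lie_bracket L k g)
            + lie_bracket L k (lie_bracket L g h) = 0"

definition derivation :: "('a::field \<Rightarrow> 'v \<Rightarrow> 'v) \<Rightarrow> ('v::ring_1 \<Rightarrow> 'v) \<Rightarrow> bool" where
  "derivation sc d \<longleftrightarrow>
     (\<forall>a b. d (a + b) = d a + d b) \<and> (\<forall>c a. d (sc c a) = sc c (d a)) \<and>
     (\<forall>a b. d (a * b) = d a * b + a * d b)"

text \<open>An \<open>L\<close>-algebra whose underlying associative algebra is the whole of the type \<open>'v\<close>.\<close>

locale L_algebra = lie_algebra L + A: vector_space sc
  for L :: "('a::field, 'l::ab_group_add) lie" and sc :: "'a \<Rightarrow> 'v \<Rightarrow> 'v::ring_1" +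
  fixes act :: "'l \<Rightarrow> 'v \<Rightarrow> 'v"
  assumes scale_mult_left: "sc c (a * b) = sc c a * b"
    and scale_mult_right: "sc c (a * b) = a * sc c b"
    and act_derivation: "g \<in> lie_carrier L \<Longrightarrow> derivation sc (act g)"
    and act_add: "\<lbrakk>g \<in> lie_carrier L; h \<in> lie_carrier L\<rbrakk> \<Longrightarrow> act (g + h) a = act g a + act h a"
    and act_scale: "g \<in> lie_carrier L \<Longrightarrow> act (lie_scale L c g) a = sc c (act g a)"
    and act_bracket: "\<lbrakk>g \<in> lie_carrier L; h \<in> lie_carrier L\<rbrakk>
        \<Longrightarrow> act (lie_bracket L g h) a = act g (act h a) - act h (act g a)"

text \<open>
  The enveloping algebra is \<open>U(L) = T / I\<close>, where \<open>T\<close> is the free unital algebra on the set \<open>L\<close>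
  and \<open>I\<close> is the ideal of \<open>T\<close> generated by the relations below; the first two kinds turn \<open>T\<close> into
  the tensor algebra of the vector space \<open>L\<close>.  Elements of \<open>U(L)\<close> are represented by elements
  of \<open>T\<close>.
\<close>

definition env_rels :: "('a::field, 'l::ab_group_add) lie \<Rightarrow> ('l list \<Rightarrow>\<^sub>0 'a) set" where
  "env_rels L =
     {gen (g + h) - gen g - gen h | g h. g \<in> lie_carrier L \<and> h \<in> lie_carrier L} \<union>
     {gen (lie_scale L c g) - fscale c (gen g) | c g. g \<in> lie_carrier L} \<union>
     {gen g * gen h - gen h * gen g - gen (lie_bracket L g h) | g h.
        g \<in> lie_carrier L \<and> h \<in> lie_carrier L}"

definition env_ideal :: "('a::field, 'l::ab_group_add) lie \<Rightarrow> ('l list \<Rightarrow>\<^sub>0 'a) set" where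
  "env_ideal L = FV.span {u * r * v | u r v.
     u \<in> free_alg (lie_carrier L) \<and> r \<in> env_rels L \<and> v \<in> free_alg (lie_carrier L)}"

definition env_basis :: "('a::field, 'l::ab_group_add) lie \<Rightarrow> ('l list \<Rightarrow>\<^sub>0 'a) set \<Rightarrow> bool" where
  "env_basis L B \<longleftrightarrow> FV.basis_mod (free_alg (lie_carrier L)) (env_ideal L) B \<and> 1 \<in> B"

lemma (in lie_algebra) env_basis_exists: "\<exists>B. env_basis L B"
proof -
  let ?T = "free_alg (lie_carrier L) :: ('l list \<Rightarrow>\<^sub>0 'a) set"
  let ?J = "{f \<in> ?T. [] \<notin> Poly_Mapping.keys f}"
  have sub_T: "FV.subspace ?T"
  proof (rule FV.subspaceI)
    fix f g :: "'l list \<Rightarrow>\<^sub>0 'a" and c :: 'a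
    assume "f \<in> ?T" "g \<in> ?T"
    then show "f + g \<in> ?T" "fscale c f \<in> ?T"
      using keys_add[of f g] by (auto simp: free_alg_def in_keys_iff)
  qed (simp add: free_alg_def)
  have sub_J: "FV.subspace ?J"
  proof (rule FV.subspaceI)
    fix f g :: "'l list \<Rightarrow>\<^sub>0 'a" and c :: 'a
    assume "f \<in> ?J" "g \<in> ?J"
    then show "f + g \<in> ?J" "fscale c f \<in> ?J"
      using FV.subspace_add[OF sub_T] FV.subspace_scale[OF sub_T]
      by (auto simp: in_keys_iff lookup_add)
  qed (simp add: free_alg_def)
  have diff_J: "f - g \<in> ?J" if "f \<in> ?J" "g \<in> ?J" for f g
    using sub_J that by (rule FV.subspace_diff)
  have gen_J: "gen g \<in> ?J" if "g \<in> lie_carrier L" for g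
    using that by (simp add: gen_def monom_def free_alg_def)
  have mult_J: "u * r * v \<in> ?J" if u: "u \<in> ?T" and r: "r \<in> ?J" and v: "v \<in> ?T" for u r v
  proof -
    have "w \<noteq> [] \<and> set w \<subseteq> lie_carrier L" if w: "w \<in> Poly_Mapping.keys (u * r * v)" for w
    proof -
      obtain w' c where w': "w = w' + c" "w' \<in> Poly_Mapping.keys (u * r)" "c \<in> Poly_Mapping.keys v"
        using subsetD[OF keys_mult w] by (elim CollectE exE conjE)
      obtain a b where w'_eq: "w' = a + b" "a \<in> Poly_Mapping.keys u" "b \<in> Poly_Mapping.keys r"
        using subsetD[OF keys_mult w'(2)] by (elim CollectE exE conjE)
      have "b \<noteq> []" "set a \<subseteq> lie_carrier L" "set b \<subseteq> lie_carrier L" "set c \<subseteq> lie_carrier L"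
        using w'(3) w'_eq(2,3) u r v by (auto simp only: free_alg_def mem_Collect_eq)
      then show ?thesis
        by (simp add: w'(1) w'_eq(1) plus_list_def)
    qed
    then show ?thesis
      by (simp add: free_alg_def) blast
  qed
  have mult_gen_J: "gen g * gen h \<in> ?J" if "g \<in> lie_carrier L" "h \<in> lie_carrier L" for g h
    using that by (simp add: gen_def monom_def free_alg_def mult_single plus_list_def)
  have rels_J: "r \<in> ?J" if "r \<in> env_rels L" for r
  proof -
    from that consider
      g h where "r = gen (g + h) - gen g - gen h" "g \<in> lie_carrier L" "h \<in> lie_carrier L"
    | c g where "r = gen (lie_scale L c g) - fscale c (gen g)" "g \<in> lie_carrier L"
    | g h where "r = gen g * gen h - gen h * gen g - gen (lie_bracket L g h)"
        "g \<in> lie_carrier L" "h \<in> lie_carrier L"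
      unfolding env_rels_def by blast
    then show ?thesis
    proof cases
      case 1
      show ?thesis
        unfolding 1(1) by (intro diff_J gen_J subspace_add[OF subspace_carrier] 1)
    next
      case 2
      show ?thesis
        unfolding 2(1)
        by (intro diff_J gen_J FV.subspace_scale[OF sub_J] subspace_scale[OF subspace_carrier] 2)
    next
      case 3
      show ?thesis
        unfolding 3(1) by (intro diff_J gen_J mult_gen_J bracket_closed 3)
    qed
  qed
  have I_J: "env_ideal L \<subseteq> ?J"
    unfolding env_ideal_def
  proof (rule FV.span_minimal[OF _ sub_J], rule subsetI)
    fix f
    assume "f \<in> {u * r * v | u r v. u \<in> ?T \<and> r \<in> env_rels L \<and> v \<in> ?T}"
    then obtain u r v where "f = u * r * v" "u \<in> ?T" "r \<in> env_rels L" "v \<in> ?T"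
      by (elim CollectE exE conjE)
    then show "f \<in> ?J"
      using mult_J[OF _ rels_J] by simp
  qed
  have sub_I: "FV.subspace (env_ideal L)"
    unfolding env_ideal_def by (rule FV.subspace_span)
  have I_T: "env_ideal L \<subseteq> ?T"
    using I_J by (rule subset_trans) blast
  have one: "1 \<in> ?T" "1 \<notin> ?J"
    by (simp_all add: free_alg_def zero_list_def)
  then have "1 \<notin> env_ideal L"
    using I_J by (blast dest: subsetD)
  then show ?thesis
    unfolding env_basis_def by (rule FV.basis_mod_exists[OF sub_T sub_I I_T one(1)])
qed

definition env_act ::
    "('a::field \<Rightarrow> 'v \<Rightarrow> 'v) \<Rightarrow> ('l \<Rightarrow> 'v \<Rightarrow> 'v) \<Rightarrow> ('l list \<Rightarrow>\<^sub>0 'a) \<Rightarrow> 'v \<Rightarrow> 'v::comm_monoid_add" where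
  "env_act sc act h a = lin_ext sc (\<lambda>w. foldr act w a) h"


section \<open>Differential polynomials\<close>

type_synonym ('a, 'l) dpoly = "(nat \<times> ('l list \<Rightarrow>\<^sub>0 'a)) list \<Rightarrow>\<^sub>0 'a"

text \<open>
  The generator \<open>x\<^sub>j\<^sup>b\<close> with \<open>b \<in> B\<close> is the letter \<open>(j, b)\<close>, and the variables are
  \<open>x\<^sub>1, x\<^sub>2, \<dots>\<close>; there are no constant terms.
\<close>

definition diff_polys :: "('l list \<Rightarrow>\<^sub>0 'a::field) set \<Rightarrow> ('a, 'l) dpoly set" where
  "diff_polys B = {f. \<forall>w\<in>Poly_Mapping.keys f. w \<noteq> [] \<and> set w \<subseteq> {1..} \<times> B}"

text \<open>\<open>x\<^sub>j\<^sup>h\<close> for arbitrary \<open>h \<in> U(L)\<close>, by linearity in \<open>h\<close>.\<close>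

definition dvar ::
    "('a::field, 'l::ab_group_add) lie \<Rightarrow> ('l list \<Rightarrow>\<^sub>0 'a) set \<Rightarrow> nat \<Rightarrow> ('l list \<Rightarrow>\<^sub>0 'a) \<Rightarrow> ('a, 'l) dpoly" where
  "dvar L B j h = (let c = FV.coords_mod (env_ideal L) B h in
     \<Sum>b | c b \<noteq> 0. fscale (c b) (gen (j, b)))"

text \<open>
  The action of \<open>g \<in> L\<close> on differential polynomials: the derivation with \<open>x\<^sub>j\<^sup>b \<mapsto> x\<^sub>j\<^sup>g\<^sup>b\<close>,
  given on monomials by the Leibniz rule.
\<close>

fun deriv_word ::
    "('a::field, 'l::ab_group_add) lie \<Rightarrow> ('l list \<Rightarrow>\<^sub>0 'a) set \<Rightarrow> 'l \<Rightarrow>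
      (nat \<times> ('l list \<Rightarrow>\<^sub>0 'a)) list \<Rightarrow> ('a, 'l) dpoly" where
  "deriv_word L B g [] = 0"
| "deriv_word L B g ((j, b) # w) =
     dvar L B j (gen g * b) * monom w + gen (j, b) * deriv_word L B g w"

definition dpoly_act ::
    "('a::field, 'l::ab_group_add) lie \<Rightarrow> ('l list \<Rightarrow>\<^sub>0 'a) set \<Rightarrow> 'l \<Rightarrow> ('a, 'l) dpoly \<Rightarrow> ('a, 'l) dpoly" where
  "dpoly_act L B g = lin_ext fscale (deriv_word L B g)"

text \<open>
  Substitution \<open>x\<^sub>j \<mapsto> s j\<close>, \<open>x\<^sub>j\<^sup>h \<mapsto> h(s j)\<close> into an algebra on which \<open>L\<close> acts.
\<close>

definition dsubst ::
    "('a::field \<Rightarrow> 'v \<Rightarrow> 'v) \<Rightarrow> ('l \<Rightarrow> 'v \<Rightarrow> 'v) \<Rightarrow> (nat \<Rightarrow> 'v) \<Rightarrow> ('a, 'l) dpoly \<Rightarrow> 'v::ring_1" where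
  "dsubst sc act s =
     lin_ext sc (\<lambda>w. prod_list (map (\<lambda>(j, b). env_act sc act b (s j)) w))"

definition diff_identities ::
    "('l list \<Rightarrow>\<^sub>0 'a) set \<Rightarrow> ('a::field \<Rightarrow> 'v \<Rightarrow> 'v) \<Rightarrow> ('l \<Rightarrow> 'v \<Rightarrow> 'v::ring_1) \<Rightarrow> ('a, 'l) dpoly set" where
  "diff_identities B sc act = {f \<in> diff_polys B. \<forall>s. dsubst sc act s f = 0}"

definition TL_ideal ::
    "('a::field, 'l::ab_group_add) lie \<Rightarrow> ('l list \<Rightarrow>\<^sub>0 'a) set \<Rightarrow> ('a, 'l) dpoly set \<Rightarrow> bool" where
  "TL_ideal L B J \<longleftrightarrow> J \<subseteq> diff_polys B \<and> FV.subspace J \<and>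
     (\<forall>f\<in>J. \<forall>p\<in>diff_polys B. p * f \<in> J \<and> f * p \<in> J) \<and>
     (\<forall>f\<in>J. \<forall>h\<in>free_alg (lie_carrier L). env_act fscale (dpoly_act L B) h f \<in> J) \<and>
     (\<forall>f\<in>J. \<forall>s. range s \<subseteq> diff_polys B \<longrightarrow> dsubst fscale (dpoly_act L B) s f \<in> J)"

definition TL_generated ::
    "('a::field, 'l::ab_group_add) lie \<Rightarrow> ('l list \<Rightarrow>\<^sub>0 'a) set \<Rightarrow> ('a, 'l) dpoly set \<Rightarrow> ('a, 'l) dpoly set" where
  "TL_generated L B S = \<Inter>{J. TL_ideal L B J \<and> S \<subseteq> J}"


section \<open>Codimensions and cocharacters\<close>

definition multilin :: "('l list \<Rightarrow>\<^sub>0 'a::field) set \<Rightarrow> nat \<Rightarrow> ('a, 'l) dpoly set" where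
  "multilin B n = FV.span {monom (map (\<lambda>i. (\<sigma> i, h i)) [1..<n + 1]) | \<sigma> h.
     \<sigma> permutes {1..n} \<and> (\<forall>i\<in>{1..n}. h i \<in> B)}"

definition dpoly_perm :: "(nat \<Rightarrow> nat) \<Rightarrow> ('a::field, 'l) dpoly \<Rightarrow> ('a, 'l) dpoly" where
  "dpoly_perm \<sigma> = lin_ext fscale (\<lambda>w. monom (map (\<lambda>(j, b). (\<sigma> j, b)) w))"

definition diff_codim ::
    "('l list \<Rightarrow>\<^sub>0 'a) set \<Rightarrow> ('a::field \<Rightarrow> 'v \<Rightarrow> 'v) \<Rightarrow> ('l \<Rightarrow> 'v \<Rightarrow> 'v::ring_1) \<Rightarrow> nat \<Rightarrow> nat" where
  "diff_codim B sc act n =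
     FV.quot_dim (multilin B n) (multilin B n \<inter> diff_identities B sc act)"

text \<open>Characters of \<open>S\<^sub>n\<close> are regarded as functions on the permutations of \<open>{1..n}\<close>.\<close>

definition diff_cochar ::
    "('l list \<Rightarrow>\<^sub>0 'a) set \<Rightarrow> ('a::field \<Rightarrow> 'v \<Rightarrow> 'v) \<Rightarrow> ('l \<Rightarrow> 'v \<Rightarrow> 'v::ring_1) \<Rightarrow> nat \<Rightarrow> (nat \<Rightarrow> nat) \<Rightarrow> 'a" where
  "diff_cochar B sc act n \<sigma> =
     FV.quot_trace (multilin B n) (multilin B n \<inter> diff_identities B sc act) (dpoly_perm \<sigma>)"


section \<open>Irreducible characters of symmetric groups\<close>

text \<open>
  A partition is a weakly decreasing list of positive numbers, and \<open>\<chi>\<^sub>\<lambda>\<close> is the character of the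
  Specht module of \<open>\<lambda>\<close>, which is irreducible in characteristic zero.  Rows and columns are
  counted from \<open>0\<close>; a tabloid is the list of the sets of entries of the rows of a tableau.
\<close>

definition cells :: "nat list \<Rightarrow> (nat \<times> nat) set" where
  "cells lam = {(i, j). i < length lam \<and> j < lam ! i}"

definition tableau :: "nat list \<Rightarrow> (nat \<times> nat \<Rightarrow> nat) \<Rightarrow> bool" where
  "tableau lam t \<longleftrightarrow> bij_betw t (cells lam) {1..sum_list lam}"

definition tabloid :: "nat list \<Rightarrow> (nat \<times> nat \<Rightarrow> nat) \<Rightarrow> nat set list" where
  "tabloid lam t = map (\<lambda>i. {t (i, j) | j. j < lam ! i}) [0..<length lam]"

definition column_stabilizer :: "nat list \<Rightarrow> (nat \<times> nat \<Rightarrow> nat) \<Rightarrow> (nat \<Rightarrow> nat) set" where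
  "column_stabilizer lam t = {\<pi>. \<pi> permutes {1..sum_list lam} \<and>
     (\<forall>j. \<pi> ` {t (i, j) | i. (i, j) \<in> cells lam} = {t (i, j) | i. (i, j) \<in> cells lam})}"

definition polytabloid :: "nat list \<Rightarrow> (nat \<times> nat \<Rightarrow> nat) \<Rightarrow> (nat set list \<Rightarrow>\<^sub>0 'a::field)" where
  "polytabloid lam t =
     (\<Sum>\<pi>\<in>column_stabilizer lam t. fscale (of_int (sign \<pi>)) (monom (tabloid lam (\<pi> \<circ> t))))"

definition specht :: "nat list \<Rightarrow> (nat set list \<Rightarrow>\<^sub>0 'a::field) set" where
  "specht lam = FV.span {polytabloid lam t | t. tableau lam t}"

definition tabloid_perm ::
    "(nat \<Rightarrow> nat) \<Rightarrow> (nat set list \<Rightarrow>\<^sub>0 'a::field) \<Rightarrow> (nat set list \<Rightarrow>\<^sub>0 'a)" where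
  "tabloid_perm \<sigma> = lin_ext fscale (\<lambda>T. monom (map ((`) \<sigma>) T))"

definition irr_char :: "nat list \<Rightarrow> (nat \<Rightarrow> nat) \<Rightarrow> 'a::field_char_0" where
  "irr_char lam \<sigma> = FV.quot_trace (specht lam) {0} (tabloid_perm \<sigma>)"


section \<open>The algebra \<open>C\<close> and the derivation \<open>\<epsilon>\<close>\<close>

definition mat_unit :: "2 \<Rightarrow> 2 \<Rightarrow> 'a::field^2^2" where
  "mat_unit i j = axis i (axis j 1)"

definition mat_scale :: "'a::field \<Rightarrow> 'a^2^2 \<Rightarrow> 'a^2^2" where
  "mat_scale c M = (\<chi> i j. c * M $ i $ j)"

definition C_matrices :: "('a::field^2^2) set" where
  "C_matrices =
     {mat_scale \<alpha> (mat_unit 1 1 + mat_unit 2 2) + mat_scale \<beta> (mat_unit 1 2) | \<alpha> \<beta>. True}"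

lemma mat_entries [simp]:
  "mat_scale c M $ i $ j = c * M $ i $ j"
  "mat_unit k l $ i $ j = (if i = k \<and> j = l then 1 else 0)"
  by (auto simp: mat_scale_def mat_unit_def axis_def)

lemma C_matrices_iff: "M \<in> C_matrices \<longleftrightarrow> M $ 1 $ 1 = M $ 2 $ 2 \<and> M $ 2 $ 1 = 0"
  unfolding C_matrices_def
  by (auto simp: vec_eq_iff forall_2 intro!: exI[of _ "M $ 1 $ 1"] exI[of _ "M $ 1 $ 2"])

typedef (overloaded) 'a calg = "C_matrices :: ('a::field^2^2) set"
  morphisms calg_matrix of_matrix
  by (rule exI[of _ 0]) (simp add: C_matrices_iff)

setup_lifting type_definition_calg

instantiation calg :: (field) ring_1
begin

lift_definition zero_calg :: "'a calg" is 0
  by (simp add: C_matrices_iff)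

lift_definition one_calg :: "'a calg" is "mat 1"
  by (simp add: C_matrices_iff mat_def)

lift_definition plus_calg :: "'a calg \<Rightarrow> 'a calg \<Rightarrow> 'a calg" is "(+)"
  by (simp add: C_matrices_iff)

lift_definition uminus_calg :: "'a calg \<Rightarrow> 'a calg" is uminus
  by (simp add: C_matrices_iff)

lift_definition minus_calg :: "'a calg \<Rightarrow> 'a calg \<Rightarrow> 'a calg" is "(-)"
  by (simp add: C_matrices_iff)

lift_definition times_calg :: "'a calg \<Rightarrow> 'a calg \<Rightarrow> 'a calg" is "(**)"
  by (simp add: C_matrices_iff matrix_matrix_mult_def sum_2)

instance
  by (standard; transfer)
    (simp_all add: matrix_mul_assoc matrix_add_ldistrib,
      simp_all add: vec_eq_iff forall_2 mat_def matrix_matrix_mult_def sum_2 algebra_simps)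

end

lift_definition cscale :: "'a::field \<Rightarrow> 'a calg \<Rightarrow> 'a calg" is mat_scale
  by (simp add: C_matrices_iff)

lift_definition celem :: "'a::field \<Rightarrow> 'a \<Rightarrow> 'a calg" is
  "\<lambda>\<alpha> \<beta>. mat_scale \<alpha> (mat_unit 1 1 + mat_unit 2 2) + mat_scale \<beta> (mat_unit 1 2)"
  by (simp add: C_matrices_iff)

lift_definition eps :: "'a::field calg \<Rightarrow> 'a calg" is
  "\<lambda>M. mat_scale (M $ 1 $ 2) (mat_unit 1 2)"
  by (simp add: C_matrices_iff)

lemma celem_cases: obtains \<alpha> \<beta> where "a = celem \<alpha> \<beta>"
proof -
  have "\<exists>\<alpha> \<beta>. a = celem \<alpha> \<beta>"
    by transfer (auto simp: C_matrices_def)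
  then show ?thesis
    using that by blast
qed

lemma celem_simps [simp]:
  "celem \<alpha> \<beta> = celem \<alpha>' \<beta>' \<longleftrightarrow> \<alpha> = \<alpha>' \<and> \<beta> = \<beta>'"
  "celem \<alpha> \<beta> + celem \<alpha>' \<beta>' = celem (\<alpha> + \<alpha>') (\<beta> + \<beta>')"
  "celem \<alpha> \<beta> - celem \<alpha>' \<beta>' = celem (\<alpha> - \<alpha>') (\<beta> - \<beta>')"
  "celem \<alpha> \<beta> * celem \<alpha>' \<beta>' = celem (\<alpha> * \<alpha>') (\<alpha> * \<beta>' + \<beta> * \<alpha>')"
  "cscale c (celem \<alpha> \<beta>) = celem (c * \<alpha>) (c * \<beta>)"
  by (transfer; auto simp: vec_eq_iff forall_2 matrix_matrix_mult_def sum_2)+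

lemma zero_celem: "0 = celem 0 0" and one_celem: "1 = celem 1 0"
  by (transfer; auto simp: vec_eq_iff forall_2 mat_def)+

lemma eps_celem [simp]: "eps (celem \<alpha> \<beta>) = celem 0 \<beta>"
  by transfer (auto simp: vec_eq_iff forall_2)

definition L_eps :: "('a::field, 'a calg \<Rightarrow> 'a calg) lie" where
  "L_eps = \<lparr>lie_carrier = {\<lambda>a. cscale c (eps a) | c. True},
            lie_scale = (\<lambda>c d a. cscale c (d a)),
            lie_bracket = (\<lambda>d d' a. d (d' a) - d' (d a))\<rparr>"

lemma derivations_calg:
  "{d. derivation (cscale :: 'a::field_char_0 \<Rightarrow> _) d} = lie_carrier L_eps"
proof (intro equalityI subsetI)
  fix d :: "'a calg \<Rightarrow> 'a calg"
  assume "d \<in> {d. derivation cscale d}"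
  then have add: "\<And>a b. d (a + b) = d a + d b" and sc: "\<And>c a. d (cscale c a) = cscale c (d a)"
    and mult: "\<And>a b. d (a * b) = d a * b + a * d b"
    by (auto simp: derivation_def)
  obtain p q where pq: "d (celem 1 0) = celem p q" by (rule celem_cases)
  obtain r s where rs: "d (celem 0 1) = celem r s" by (rule celem_cases)
  have "p = 0" "q = 0"
    using mult[of "celem 1 0" "celem 1 0"] by (simp_all add: pq)
  moreover have "r = 0"
    using mult[of "celem 0 1" "celem 0 1"] sc[of 0 "celem 0 0"] by (simp add: rs)
  moreover have "d (celem \<alpha> \<beta>) = cscale \<alpha> (d (celem 1 0)) + cscale \<beta> (d (celem 0 1))" for \<alpha> \<beta>
    by (simp flip: add sc)
  ultimately have "d a = cscale s (eps a)" for a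
    by (cases a rule: celem_cases) (simp add: pq rs)
  then show "d \<in> lie_carrier L_eps"
    by (auto simp: L_eps_def)
next
  fix d :: "'a calg \<Rightarrow> 'a calg"
  assume "d \<in> lie_carrier L_eps"
  then obtain c where d: "d = (\<lambda>a. cscale c (eps a))"
    by (auto simp: L_eps_def)
  have "d (a + b) = d a + d b" "d (a * b) = d a * b + a * d b" "d (cscale k a) = cscale k (d a)" for a b k
    by (cases a rule: celem_cases; cases b rule: celem_cases; simp add: d algebra_simps)+
  then show "d \<in> {d. derivation cscale d}"
    by (simp add: derivation_def)
qed

lemma L_algebra_calg: "L_algebra (L_eps :: ('a::field_char_0, _) lie) cscale (\<lambda>d. d)"
proof -
  have vs: "vector_space (cscale :: 'a \<Rightarrow> _)"
  proof
    fix a b :: 'a and x y :: "'a calg"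
    show "cscale a (x + y) = cscale a x + cscale a y" "cscale (a + b) x = cscale a x + cscale b x"
      "cscale a (cscale b x) = cscale (a * b) x" "cscale 1 x = x"
      by (cases x rule: celem_cases; cases y rule: celem_cases; simp add: algebra_simps)+
  qed
  interpret C: vector_space "cscale :: 'a \<Rightarrow> _" by (rule vs)
  have E: "vector_space (lie_scale (L_eps :: ('a, _) lie))"
    by standard (auto simp: L_eps_def fun_eq_iff C.scale_right_distrib C.scale_left_distrib)
  interpret E: vector_space "lie_scale (L_eps :: ('a, _) lie)" by (rule E)
  have carrier: "d \<in> lie_carrier L_eps \<longleftrightarrow> (\<exists>c. d = (\<lambda>a. cscale c (eps a)))"
    for d :: "'a calg \<Rightarrow> 'a calg"
    by (simp add: L_eps_def)
  have sub: "E.subspace (lie_carrier L_eps)"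
  proof (rule E.subspaceI)
    show "0 \<in> lie_carrier (L_eps :: ('a, _) lie)"
      unfolding carrier by (rule exI[of _ 0]) (simp add: fun_eq_iff)
    fix d d' :: "'a calg \<Rightarrow> 'a calg" and k
    assume "d \<in> lie_carrier L_eps" "d' \<in> lie_carrier L_eps"
    then obtain c c' where d: "d = (\<lambda>a. cscale c (eps a))" "d' = (\<lambda>a. cscale c' (eps a))"
      unfolding carrier by (elim exE)
    show "d + d' \<in> lie_carrier L_eps"
      unfolding carrier
      by (rule exI[of _ "c + c'"]) (simp add: d fun_eq_iff C.scale_left_distrib)
    show "lie_scale L_eps k d \<in> lie_carrier L_eps"
      unfolding carrier by (rule exI[of _ "k * c"]) (simp add: d L_eps_def)
  qed
  have bracket: "lie_bracket L_eps d d' = 0"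
    if "d \<in> lie_carrier L_eps" "d' \<in> lie_carrier L_eps" for d d' :: "'a calg \<Rightarrow> 'a calg"
  proof
    fix a :: "'a calg"
    obtain c c' where d: "d = (\<lambda>a. cscale c (eps a))" "d' = (\<lambda>a. cscale c' (eps a))"
      using \<open>d \<in> _\<close> \<open>d' \<in> _\<close> unfolding carrier by (elim exE)
    show "lie_bracket L_eps d d' a = 0 a"
      by (cases a rule: celem_cases) (simp add: d L_eps_def zero_celem)
  qed
  note zero = E.subspace_0[OF sub] and add = E.subspace_add[OF sub]
    and scale = E.subspace_scale[OF sub]
  have lie: "lie_algebra (L_eps :: ('a, _) lie)"
    by (intro lie_algebra.intro[OF E] lie_algebra_axioms.intro sub)
      (simp_all add: bracket zero add scale)
  have "L_algebra_axioms (L_eps :: ('a, _) lie) cscale (\<lambda>d. d)"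
  proof
    fix c and a b :: "'a calg"
    show "cscale c (a * b) = cscale c a * b" "cscale c (a * b) = a * cscale c b"
      by (cases a rule: celem_cases; cases b rule: celem_cases; simp add: algebra_simps)+
  qed (use derivations_calg in \<open>auto simp: L_eps_def\<close>)
  with lie vs show ?thesis
    by (rule L_algebra.intro)
qed

end

theory Submission
  imports Defs
begin

text \<open>
  Put \<open>E\<^sub>j = x\<^sub>j\<^sup>\<epsilon>\<close> and \<open>Y\<^sub>j = x\<^sub>j - x\<^sub>j\<^sup>\<epsilon>\<close>.  Under \<open>x\<^sub>j \<mapsto> \<alpha>\<^sub>j (e\<^sub>1\<^sub>1 + e\<^sub>2\<^sub>2) + \<beta>\<^sub>j e\<^sub>1\<^sub>2\<close> they take the
  values \<open>\<beta>\<^sub>j e\<^sub>1\<^sub>2\<close> and \<open>\<alpha>\<^sub>j (e\<^sub>1\<^sub>1 + e\<^sub>2\<^sub>2)\<close>: the derivation \<open>\<epsilon>\<close> is diagonal on \<open>C\<close> with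
  eigenvalues \<open>0\<close> and \<open>1\<close>, and these are the projections to its eigenspaces.

  \<^bold>\<open>Identities.\<close>  Let \<open>J\<close> be the \<open>T\<^sub>L\<close>-ideal generated by the three relations.  It consists of
  identities of \<open>C\<close>, because the relations are identities and the identities form a \<open>T\<^sub>L\<close>-ideal
  (\<open>TL_ideal_diff_identities\<close>).  Conversely, since \<open>x\<^sup>\<epsilon>\<^sup>\<epsilon> = x\<^sup>\<epsilon>\<close> modulo \<open>J\<close>, each letter \<open>x\<^sub>j\<^sup>h\<close> is
  congruent to \<open>p Y\<^sub>j + q E\<^sub>j\<close>, where \<open>p, q\<close> are the eigenvalues of \<open>h\<close> on \<open>C\<close>
  (\<open>eigenvalues_exist\<close>).  Letters commute modulo \<open>J\<close> and a product with two factors \<open>E\<close> vanishes,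
  so every differential polynomial is congruent to a combination of the monomials \<open>Y\<^sup>M\<close> and
  \<open>E\<^sub>j Y\<^sup>M\<close> (\<open>diff_polys_reducible\<close>).  The values of these monomials are the functions \<open>\<alpha>\<^sup>M\<close> and
  \<open>\<beta>\<^sub>j \<alpha>\<^sup>M\<close> times a fixed basis of \<open>C\<close>.  As \<open>\<alpha> \<mapsto> \<alpha>\<^sup>M\<close> are distinct multiplicative characters, they
  are linearly independent by Dedekind's argument (\<open>independent_characters\<close>), so a normal form that
  vanishes on \<open>C\<close> is zero.

  \<^bold>\<open>Codimensions and cocharacters.\<close>  A multilinear polynomial is determined modulo identities by
  \<open>n + 1\<close> numbers, the coefficients of \<open>Y\<^sub>1 \<cdots> Y\<^sub>n\<close> and of \<open>E\<^sub>k\<close> times the product of the \<open>Y\<^sub>i\<close> with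
  \<open>i \<noteq> k\<close>.  They are obtained by evaluation at \<open>n + 1\<close> points of \<open>C\<close>, which gives functionals dual
  to these polynomials (\<open>dual_bases_multilin\<close>).  For such a dual pair the dimension and the traces of
  a quotient space are explicit sums (locale \<open>dual_bases_mod\<close>).  As, modulo identities, \<open>S\<^sub>n\<close> fixes
  the first polynomial and permutes the others like the points \<open>1, \<dots>, n\<close>, the trace of \<open>\<sigma>\<close> is one more than
  the number of its fixed points.  The same trace formula gives \<open>1\<close> for the Specht module of \<open>(n)\<close>
  and one less than the number of fixed points for that of \<open>(n-1,1)\<close>, and
  \<open>1 + fix = 2 + (fix - 1)\<close>.
\<close>

section \<open>Linear extension from monomials\<close>

lemma fscale_monom_expansion: "p = (\<Sum>k\<in>Poly_Mapping.keys p. fscale (Poly_Mapping.lookup p k) (monom k))"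
proof (rule poly_mapping_eqI)
  fix k
  have "Poly_Mapping.lookup (\<Sum>l\<in>Poly_Mapping.keys p. fscale (Poly_Mapping.lookup p l) (monom l)) k
      = (\<Sum>l\<in>Poly_Mapping.keys p. if l = k then Poly_Mapping.lookup p l else 0)"
    unfolding lookup_sum by (rule sum.cong) (auto simp: monom_def lookup_single)
  also have "\<dots> = Poly_Mapping.lookup p k"
    by (simp add: sum.delta in_keys_iff)
  finally show "Poly_Mapping.lookup p k
      = Poly_Mapping.lookup (\<Sum>k\<in>Poly_Mapping.keys p. fscale (Poly_Mapping.lookup p k) (monom k)) k"
    by simp
qed

lemma subspace_contains_if_monoms:
  assumes "FV.subspace S" and "\<And>k. k \<in> Poly_Mapping.keys p \<Longrightarrow> monom k \<in> S"
  shows "p \<in> S"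
  by (subst fscale_monom_expansion)
    (intro FV.subspace_sum[OF assms(1)] FV.subspace_scale[OF assms(1)] assms(2))

context vector_space
begin

lemma lin_ext_superset:
  assumes "finite A" "Poly_Mapping.keys f \<subseteq> A"
  shows "lin_ext scale g f = (\<Sum>k\<in>A. scale (Poly_Mapping.lookup f k) (g k))"
  unfolding lin_ext_def
  by (rule sum.mono_neutral_left) (use assms in \<open>auto simp: in_keys_iff\<close>)

lemma module_hom_lin_ext: "module_hom fscale scale (lin_ext scale g)"
proof
  fix p q :: "'c \<Rightarrow>\<^sub>0 'a" and c :: 'a
  let ?A = "Poly_Mapping.keys p \<union> Poly_Mapping.keys q"
  have "Poly_Mapping.keys (p + q) \<subseteq> ?A"
    by (rule keys_add)
  then show "lin_ext scale g (p + q) = lin_ext scale g p + lin_ext scale g q"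
    by (simp add: lin_ext_superset[where A = ?A] lookup_add scale_left_distrib sum.distrib)
  have "Poly_Mapping.keys (fscale c p) \<subseteq> Poly_Mapping.keys p"
    by (auto simp: in_keys_iff)
  then show "lin_ext scale g (fscale c p) = scale c (lin_ext scale g p)"
    by (simp add: lin_ext_superset[where A = "Poly_Mapping.keys p"] scale_sum_right)
qed

lemmas lin_ext_add = module_hom.add[OF module_hom_lin_ext]
lemmas lin_ext_scale = module_hom.scale[OF module_hom_lin_ext]
lemmas lin_ext_zero = module_hom.zero[OF module_hom_lin_ext]

lemma lin_ext_monom: "lin_ext scale g (monom k) = g k"
  by (simp add: lin_ext_def monom_def)

lemma module_hom_eqI:
  assumes "module_hom fscale scale S" "module_hom fscale scale T"
    and "\<And>k. k \<in> Poly_Mapping.keys p \<Longrightarrow> S (monom k) = T (monom k)"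
  shows "S p = T p"
proof -
  interpret S: module_hom fscale scale S by (rule assms(1))
  interpret T: module_hom fscale scale T by (rule assms(2))
  have "FV.subspace {p. S p = T p}"
    by (rule FV.subspaceI) (simp_all add: S.zero T.zero S.add T.add S.scale T.scale)
  then have "p \<in> {p. S p = T p}"
    by (rule subspace_contains_if_monoms) (simp add: assms(3))
  then show ?thesis by simp
qed

end

lemma lin_ext_hom:
  assumes "module_hom sc sc' T"
  shows "T (lin_ext sc g p) = lin_ext sc' (\<lambda>k. T (g k)) p"
  unfolding lin_ext_def
  by (simp add: module_hom.sum[OF assms] module_hom.scale[OF assms])


section \<open>Multiplication in the free algebra\<close>

lemma monom_mult: "monom u * monom v = monom (u + v)"
  by (simp add: monom_def mult_single)

lemma monom_Nil: "monom [] = 1"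
  by (simp add: monom_def flip: zero_list_def)

lemma monom_Cons: "monom (x # w) = gen x * monom w"
  by (simp add: gen_def monom_mult plus_list_def)

lemma fscale_mult_left: "fscale c (p * q) = fscale c p * q"
  for p q :: "'k::monoid_add \<Rightarrow>\<^sub>0 'a::field"
  by (simp add: fscale_def mult_map_scale_conv_mult mult.assoc)

lemma single_zero_commute: "Poly_Mapping.single 0 c * p = p * Poly_Mapping.single 0 c"
  for p :: "'k::monoid_add \<Rightarrow>\<^sub>0 'a::field"
proof -
  let ?S = "{p :: 'k \<Rightarrow>\<^sub>0 'a. Poly_Mapping.single 0 c * p = p * Poly_Mapping.single 0 c}"
  have "FV.subspace ?S"
  proof (rule FV.subspaceI)
    fix p :: "'k \<Rightarrow>\<^sub>0 'a" and d :: 'a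
    assume "p \<in> ?S"
    then have "Poly_Mapping.single 0 d * (Poly_Mapping.single 0 c * p)
        = Poly_Mapping.single 0 d * p * Poly_Mapping.single 0 c"
      by (simp add: mult.assoc)
    then show "fscale d p \<in> ?S"
      by (simp add: fscale_def mult_map_scale_conv_mult mult.assoc[symmetric] mult_single mult.commute[of c d])
  qed (simp_all add: algebra_simps)
  then have "p \<in> ?S"
    by (rule subspace_contains_if_monoms) (simp add: monom_def mult_single)
  then show ?thesis by simp
qed

lemma fscale_mult_right: "fscale c (p * q) = p * fscale c q"
  for p q :: "'k::monoid_add \<Rightarrow>\<^sub>0 'a::field"
  unfolding fscale_def mult_map_scale_conv_mult
  by (metis mult.assoc single_zero_commute)

lemma module_hom_left_mult:
  "module_hom fscale fscale ((*) p)" for p :: "'k::monoid_add \<Rightarrow>\<^sub>0 'a::field"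
  by (standard) (simp_all add: algebra_simps FV.scale_right_distrib FV.scale_left_distrib fscale_mult_right)

lemma module_hom_right_mult:
  "module_hom fscale fscale (\<lambda>q. q * p)" for p :: "'k::monoid_add \<Rightarrow>\<^sub>0 'a::field"
  by (standard) (simp_all add: algebra_simps FV.scale_right_distrib FV.scale_left_distrib fscale_mult_left)

text \<open>
  The universal property of a monoid algebra: a monoid homomorphism into the multiplicative monoid
  of an algebra extends to an algebra homomorphism.
\<close>

lemma lin_ext_mult:
  fixes sc :: "'a::field \<Rightarrow> 'v \<Rightarrow> 'v::ring_1" and g :: "'k::monoid_add \<Rightarrow> 'v"
  assumes "vector_space sc"
    and left: "\<And>c a b. sc c (a * b) = sc c a * b"
    and right: "\<And>c a b. sc c (a * b) = a * sc c b"
    and hom: "\<And>u v. g (u + v) = g u * g v"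
  shows "lin_ext sc g (p * q) = lin_ext sc g p * lin_ext sc g q"
proof -
  interpret V: vector_space sc by (rule assms(1))
  let ?h = "lin_ext sc g"
  note hom_simps = V.lin_ext_add V.lin_ext_scale distrib_left distrib_right V.scale_right_distrib
    V.scale_left_distrib fscale_mult_left[symmetric] fscale_mult_right[symmetric]
    left[symmetric] right[symmetric]
  have gen: "?h (monom u * q) = g u * ?h q" for u q
    by (rule V.module_hom_eqI[where T = "\<lambda>q. g u * ?h q"]; (standard)?)
      (simp_all add: hom_simps monom_mult V.lin_ext_monom hom)
  show ?thesis
    by (rule V.module_hom_eqI[where S = "\<lambda>p. ?h (p * q)" and T = "\<lambda>p. ?h p * ?h q"]; (standard)?)
      (simp_all add: hom_simps gen V.lin_ext_monom)
qed

lemma free_alg_iff: "f \<in> free_alg X \<longleftrightarrow> Poly_Mapping.keys f \<subseteq> lists X"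
  by (auto simp: free_alg_def lists_eq_set)

lemma subspace_keys: "FV.subspace {f. Poly_Mapping.keys f \<subseteq> K}"
proof (rule FV.subspaceI)
  fix f g :: "'b \<Rightarrow>\<^sub>0 'a" and c :: 'a
  assume "f \<in> {f. Poly_Mapping.keys f \<subseteq> K}" "g \<in> {f. Poly_Mapping.keys f \<subseteq> K}"
  then show "f + g \<in> {f. Poly_Mapping.keys f \<subseteq> K}" "fscale c f \<in> {f. Poly_Mapping.keys f \<subseteq> K}"
    using keys_add[of f g] by (auto simp: in_keys_iff)
qed simp

lemma subspace_free_alg: "FV.subspace (free_alg X)"
  using subspace_keys[of "lists X"] by (simp add: free_alg_iff[abs_def, symmetric])

lemma keys_mult_subset:
  assumes "Poly_Mapping.keys f \<subseteq> K" "Poly_Mapping.keys g \<subseteq> M" "\<And>u v. u \<in> K \<Longrightarrow> v \<in> M \<Longrightarrow> u + v \<in> N"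
  shows "Poly_Mapping.keys (f * g) \<subseteq> N"
proof
  fix w assume "w \<in> Poly_Mapping.keys (f * g)"
  then obtain u v where "w = u + v" "u \<in> Poly_Mapping.keys f" "v \<in> Poly_Mapping.keys g"
    using keys_mult[of f g] by blast
  then show "w \<in> N" using assms by blast
qed

lemma free_alg_mult: "f \<in> free_alg X \<Longrightarrow> g \<in> free_alg X \<Longrightarrow> f * g \<in> free_alg X"
  unfolding free_alg_iff by (rule keys_mult_subset) (auto simp: plus_list_def)

lemma monom_in_free_alg [simp]: "monom w \<in> free_alg X \<longleftrightarrow> set w \<subseteq> X"
  by (simp add: free_alg_def monom_def)

lemma gen_in_free_alg [simp]: "gen x \<in> free_alg X \<longleftrightarrow> x \<in> X"
  by (simp add: gen_def)

lemma one_in_free_alg [simp]: "1 \<in> free_alg X"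
  by (simp flip: monom_Nil)


section \<open>Dimension and trace of a quotient from a dual basis\<close>

context quot_space
begin

lemma sum_support_superset:
  assumes "finite A" "{b. c b \<noteq> 0} \<subseteq> A"
  shows "(\<Sum>b | c b \<noteq> 0. scale (c b) b) = (\<Sum>b\<in>A. scale (c b) b)"
  by (rule sum.mono_neutral_left) (use assms in auto)

lemma coords_mod:
  assumes "basis_mod V W S" "v \<in> V"
  shows "finite {b. coords_mod W S v b \<noteq> 0}" "{b. coords_mod W S v b \<noteq> 0} \<subseteq> S"
    "v - (\<Sum>b | coords_mod W S v b \<noteq> 0. scale (coords_mod W S v b) b) \<in> W"
  using theI'[OF bspec[OF conjunct2[OF assms(1)[unfolded basis_mod_def]] assms(2)]]
  unfolding coords_mod_def by blast+

lemma coords_mod_eqI: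
  assumes "basis_mod V W S" "v \<in> V"
    and "finite A" "A \<subseteq> S" "\<And>b. b \<notin> A \<Longrightarrow> c b = 0" "v - (\<Sum>b\<in>A. scale (c b) b) \<in> W"
  shows "coords_mod W S v = c"
proof -
  have sub: "{b. c b \<noteq> 0} \<subseteq> A"
    using assms(5) by blast
  show ?thesis
    unfolding coords_mod_def
  proof (rule the1_equality)
    show "\<exists>!c. finite {b. c b \<noteq> 0} \<and> {b. c b \<noteq> 0} \<subseteq> S \<and> v - (\<Sum>b | c b \<noteq> 0. scale (c b) b) \<in> W"
      using assms(1,2) unfolding basis_mod_def by blast
    show "finite {b. c b \<noteq> 0} \<and> {b. c b \<noteq> 0} \<subseteq> S \<and> v - (\<Sum>b | c b \<noteq> 0. scale (c b) b) \<in> W"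
      using assms(3,4,6) sub finite_subset[OF sub] by (simp add: sum_support_superset[of A])
  qed
qed

lemma coords_mod_add:
  assumes S: "basis_mod V W S" and V: "subspace V" and W: "subspace W" and x: "x \<in> V" and y: "y \<in> V"
  shows "coords_mod W S (x + y) = (\<lambda>b. coords_mod W S x b + coords_mod W S y b)"
proof -
  let ?c = "coords_mod W S"
  let ?A = "{b. ?c x b \<noteq> 0} \<union> {b. ?c y b \<noteq> 0}"
  note cx = coords_mod[OF S x] and cy = coords_mod[OF S y]
  have fin: "finite ?A"
    using cx(1) cy(1) by simp
  have "(x - (\<Sum>b\<in>?A. scale (?c x b) b)) + (y - (\<Sum>b\<in>?A. scale (?c y b) b)) \<in> W"
    using cx(3) cy(3) sum_support_superset[OF fin, of "?c x"] sum_support_superset[OF fin, of "?c y"]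
    by (auto intro: subspace_add[OF W])
  also have "(x - (\<Sum>b\<in>?A. scale (?c x b) b)) + (y - (\<Sum>b\<in>?A. scale (?c y b) b))
      = x + y - (\<Sum>b\<in>?A. scale (?c x b + ?c y b) b)"
    by (simp add: scale_left_distrib sum.distrib)
  finally show ?thesis
    by (intro coords_mod_eqI[OF S subspace_add[OF V x y] fin]) (use cx(2) cy(2) in auto)
qed

lemma coords_mod_scale:
  assumes S: "basis_mod V W S" and V: "subspace V" and W: "subspace W" and x: "x \<in> V"
  shows "coords_mod W S (scale a x) = (\<lambda>b. a * coords_mod W S x b)"
proof -
  let ?c = "coords_mod W S"
  note cx = coords_mod[OF S x]
  have "scale a (x - (\<Sum>b | ?c x b \<noteq> 0. scale (?c x b) b)) \<in> W"
    by (rule subspace_scale[OF W cx(3)])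
  then show ?thesis
    by (intro coords_mod_eqI[OF S subspace_scale[OF V x] cx(1,2)])
      (simp_all add: scale_right_diff_distrib scale_sum_right)
qed

lemma coords_mod_zero:
  assumes "basis_mod V W S" "x \<in> V" "x \<in> W"
  shows "coords_mod W S x = (\<lambda>b. 0)"
  by (rule coords_mod_eqI[OF assms(1,2), of "{}"]) (use assms(3) in auto)

lemma coords_mod_base:
  assumes S: "basis_mod V W S" and W: "subspace W" and b: "b \<in> S"
  shows "coords_mod W S b = (\<lambda>b'. of_bool (b' = b))"
proof -
  have "b \<in> V"
    using S b by (auto simp: basis_mod_def)
  then show ?thesis
    by (rule coords_mod_eqI[OF S, of b "{b}"]) (use b subspace_0[OF W] in auto)
qed

lemma coords_mod_cong:
  assumes S: "basis_mod V W S" and V: "subspace V" and W: "subspace W"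
    and xy: "x \<in> V" "y \<in> V" "x - y \<in> W"
  shows "coords_mod W S x = coords_mod W S y"
proof -
  have "coords_mod W S (x - y + y) = (\<lambda>b. coords_mod W S (x - y) b + coords_mod W S y b)"
    by (rule coords_mod_add[OF S V W]) (use xy subspace_diff[OF V] in auto)
  moreover have "coords_mod W S (x - y) = (\<lambda>b. 0)"
    by (rule coords_mod_zero[OF S]) (use xy subspace_diff[OF V] in auto)
  ultimately show ?thesis
    by simp
qed

lemma coords_mod_sum:
  assumes S: "basis_mod V W S" and V: "subspace V" and W: "subspace W"
    and "finite I" "\<And>i. i \<in> I \<Longrightarrow> v i \<in> V"
  shows "coords_mod W S (\<Sum>i\<in>I. scale (a i) (v i)) b = (\<Sum>i\<in>I. a i * coords_mod W S (v i) b)"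
  using assms(4,5)
proof (induction I)
  case empty
  have "coords_mod W S 0 = (\<lambda>b. 0)"
    by (rule coords_mod_zero[OF S]) (simp_all add: subspace_0 V W)
  then show ?case by simp
next
  case (insert i I)
  then show ?case
    by (simp add: coords_mod_add[OF S V W] coords_mod_scale[OF S V W] subspace_scale[OF V] subspace_sum[OF V])
qed

end

text \<open>
  The functions \<open>quot_dim\<close> and \<open>quot_trace\<close> refer to an arbitrary basis of \<open>V / W\<close>; they are made
  accessible by vectors \<open>v i\<close> and functionals \<open>\<phi> i\<close> that are dual to each other modulo \<open>W\<close>.
  In the applications the functionals read off a coefficient or evaluate at a point, so that they are
  defined on the whole space and kill \<open>W\<close> for an obvious reason.
\<close>

locale dual_bases_mod = quot_space scale
  for scale :: "'a::field \<Rightarrow> 'b::ab_group_add \<Rightarrow> 'b" +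
  fixes V W :: "'b set" and I :: "'i set" and v :: "'i \<Rightarrow> 'b" and \<phi> :: "'i \<Rightarrow> 'b \<Rightarrow> 'a"
  assumes V: "subspace V" and W: "subspace W" and W_V: "W \<subseteq> V"
    and I: "finite I" "I \<noteq> {}"
    and v_V: "i \<in> I \<Longrightarrow> v i \<in> V"
    and functional: "i \<in> I \<Longrightarrow> module_hom scale (*) (\<phi> i)"
    and functional_W: "i \<in> I \<Longrightarrow> x \<in> W \<Longrightarrow> \<phi> i x = 0"
    and dual: "i \<in> I \<Longrightarrow> j \<in> I \<Longrightarrow> \<phi> i (v j) = of_bool (i = j)"
    and separating: "x \<in> V \<Longrightarrow> (\<And>i. i \<in> I \<Longrightarrow> \<phi> i x = 0) \<Longrightarrow> x \<in> W"
begin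

lemma expansion_mod:
  assumes x: "x \<in> V"
  shows "x - (\<Sum>i\<in>I. scale (\<phi> i x) (v i)) \<in> W"
proof (rule separating)
  show "x - (\<Sum>i\<in>I. scale (\<phi> i x) (v i)) \<in> V"
    by (intro subspace_diff[OF V] x subspace_sum[OF V] subspace_scale[OF V] v_V)
  fix j assume j: "j \<in> I"
  interpret \<phi>: module_hom scale "(*)" "\<phi> j" by (rule functional[OF j])
  have "\<phi> j (\<Sum>i\<in>I. scale (\<phi> i x) (v i)) = (\<Sum>i\<in>I. if i = j then \<phi> i x else 0)"
    unfolding \<phi>.sum \<phi>.scale by (rule sum.cong) (simp_all add: dual j)
  then show "\<phi> j (x - (\<Sum>i\<in>I. scale (\<phi> i x) (v i))) = 0"
    using j I by (simp add: \<phi>.diff)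
qed

lemma ex_basis_mod: "\<exists>S. basis_mod V W S"
proof -
  obtain i where i: "i \<in> I"
    using I by blast
  have "v i \<notin> W"
    using functional_W[OF i, of "v i"] dual[OF i i] by auto
  then show ?thesis
    using basis_mod_exists[OF V W W_V v_V[OF i]] by blast
qed

lemma coords_mod_expansion:
  assumes S: "basis_mod V W S" and x: "x \<in> V"
  shows "coords_mod W S x b = (\<Sum>i\<in>I. \<phi> i x * coords_mod W S (v i) b)"
proof -
  have "coords_mod W S x = coords_mod W S (\<Sum>i\<in>I. scale (\<phi> i x) (v i))"
    by (intro coords_mod_cong[OF S V W x] expansion_mod[OF x] subspace_sum[OF V] subspace_scale[OF V] v_V)
  then show ?thesis
    by (simp add: coords_mod_sum[OF S V W I(1) v_V])
qed

text \<open>Every element of \<open>S\<close> occurs in the coordinates of some \<open>v i\<close>.\<close>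

lemma finite_basis_mod:
  assumes S: "basis_mod V W S"
  shows "finite S"
proof (rule finite_subset)
  show "S \<subseteq> (\<Union>i\<in>I. {b. coords_mod W S (v i) b \<noteq> 0})"
  proof
    fix b assume b: "b \<in> S"
    then have "b \<in> V"
      using S by (auto simp: basis_mod_def)
    then have "(\<Sum>i\<in>I. \<phi> i b * coords_mod W S (v i) b) = 1"
      using coords_mod_base[OF S W b] coords_mod_expansion[OF S, of b b] by simp
    then have "\<exists>i\<in>I. coords_mod W S (v i) b \<noteq> 0"
      by (metis (no_types, lifting) mult_zero_right sum.neutral zero_neq_one)
    then show "b \<in> (\<Union>i\<in>I. {b. coords_mod W S (v i) b \<noteq> 0})"
      by blast
  qed
  show "finite (\<Union>i\<in>I. {b. coords_mod W S (v i) b \<noteq> 0})"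
    using I(1) coords_mod(1)[OF S v_V] by blast
qed

text \<open>
  Expanding \<open>b\<close> in the \<open>v i\<close> turns the trace over \<open>S\<close> into a double sum over \<open>i\<close> and \<open>b\<close>;
  carrying out the summation over \<open>b\<close> first applies \<open>\<phi> i\<close> to the expansion of \<open>f (v i)\<close> in \<open>S\<close>.
\<close>

lemma trace_basis_mod:
  assumes S: "basis_mod V W S" and f: "module_hom scale scale f" "f ` V \<subseteq> V" "f ` W \<subseteq> W"
  shows "(\<Sum>b\<in>S. coords_mod W S (f b) b) = (\<Sum>i\<in>I. \<phi> i (f (v i)))"
proof -
  interpret f: module_hom scale scale f by (rule f(1))
  let ?c = "coords_mod W S"
  have S_V: "b \<in> V" if "b \<in> S" for b
    using S that by (auto simp: basis_mod_def)
  have fin: "finite S"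
    by (rule finite_basis_mod[OF S])
  have f_V: "f x \<in> V" if "x \<in> V" for x
    using f(2) that by blast
  have expand: "?c (f b) b = (\<Sum>i\<in>I. \<phi> i b * ?c (f (v i)) b)" if b: "b \<in> S" for b
  proof -
    have "f (b - (\<Sum>i\<in>I. scale (\<phi> i b) (v i))) \<in> W"
      using expansion_mod[OF S_V[OF b]] f(3) by blast
    then have "f b - (\<Sum>i\<in>I. scale (\<phi> i b) (f (v i))) \<in> W"
      by (simp add: f.diff f.sum f.scale)
    then have "?c (f b) = ?c (\<Sum>i\<in>I. scale (\<phi> i b) (f (v i)))"
      by (intro coords_mod_cong[OF S V W] f_V S_V[OF b] subspace_sum[OF V] subspace_scale[OF V] v_V)
    then show ?thesis
      by (simp add: coords_mod_sum[OF S V W I(1) f_V[OF v_V]])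
  qed
  have contract: "(\<Sum>b\<in>S. \<phi> i b * ?c x b) = \<phi> i x" if i: "i \<in> I" and x: "x \<in> V" for i x
  proof -
    interpret \<phi>: module_hom scale "(*)" "\<phi> i" by (rule functional[OF i])
    have "x - (\<Sum>b\<in>S. scale (?c x b) b) \<in> W"
      using coords_mod[OF S x] sum_support_superset[OF fin, of "?c x"] by simp
    from functional_W[OF i this] show ?thesis
      by (simp add: \<phi>.diff \<phi>.sum \<phi>.scale mult.commute)
  qed
  have "(\<Sum>b\<in>S. ?c (f b) b) = (\<Sum>b\<in>S. \<Sum>i\<in>I. \<phi> i b * ?c (f (v i)) b)"
    by (rule sum.cong) (simp_all add: expand)
  also have "\<dots> = (\<Sum>i\<in>I. \<Sum>b\<in>S. \<phi> i b * ?c (f (v i)) b)"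
    by (rule sum.swap)
  also have "\<dots> = (\<Sum>i\<in>I. \<phi> i (f (v i)))"
    by (rule sum.cong) (simp_all add: contract f_V v_V)
  finally show ?thesis .
qed

lemma quot_trace_eq:
  assumes "module_hom scale scale f" "f ` V \<subseteq> V" "f ` W \<subseteq> W"
  shows "quot_trace V W f = (\<Sum>i\<in>I. \<phi> i (f (v i)))"
  unfolding quot_trace_def Let_def
  by (rule trace_basis_mod[OF someI_ex[OF ex_basis_mod] assms])

text \<open>
  The dimension is the trace of the identity; this is an equation in the field and determines
  \<open>quot_dim\<close> in characteristic zero.
\<close>

lemma of_nat_quot_dim: "of_nat (quot_dim V W) = (of_nat (card I) :: 'a)"
proof -
  define S where "S = (SOME S. basis_mod V W S)"
  have S: "basis_mod V W S"
    unfolding S_def by (rule someI_ex[OF ex_basis_mod])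
  have "(\<Sum>b\<in>S. coords_mod W S (id b) b) = (\<Sum>i\<in>I. \<phi> i (id (v i)))"
    by (rule trace_basis_mod[OF S linear_id[folded module_hom_iff_linear]]) simp_all
  then show ?thesis
    by (simp add: quot_dim_def coords_mod_base[OF S W] dual flip: S_def)
qed

end


section \<open>The characters of the trivial and the standard representation\<close>

lemma module_hom_lookup: "module_hom fscale (*) (\<lambda>f. Poly_Mapping.lookup f k)"
  by standard (simp_all add: lookup_add algebra_simps)

lemma module_hom_tabloid_perm: "module_hom fscale fscale (tabloid_perm \<sigma>)"
  unfolding tabloid_perm_def by (rule FV.module_hom_lin_ext)

lemma tabloid_perm_monom: "tabloid_perm \<sigma> (monom T) = monom (map ((`) \<sigma>) T)"
  unfolding tabloid_perm_def by (rule FV.lin_ext_monom)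

lemma lookup_monom: "Poly_Mapping.lookup (monom k) l = of_bool (k = l)"
  by (simp add: monom_def lookup_single)

text \<open>
  With a single row all columns are singletons and all tableaux have the same tabloid, so the
  Specht module of \<open>(n)\<close> is a line fixed by every permutation.
\<close>

lemma polytabloid_row:
  assumes "tableau [n] t"
  shows "polytabloid [n] t = monom [{1..n}]"
proof -
  have t: "bij_betw t ({0} \<times> {..<n}) {1..n}"
  proof -
    have "cells [n] = {0} \<times> {..<n}"
      by (auto simp: cells_def)
    then show ?thesis using assms by (simp add: tableau_def)
  qed
  have T: "{t (0, j) | j. j < n} = {1..n}"
    unfolding bij_betw_imp_surj_on[OF t, symmetric] by auto
  have "column_stabilizer [n] t = {id}"
  proof (intro equalityI subsetI)
    fix \<pi> assume \<pi>: "\<pi> \<in> column_stabilizer [n] t"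
    have "\<pi> x = x" for x
    proof (cases "x \<in> {1..n}")
      case True
      then obtain j where j: "j < n" "x = t (0, j)"
        using T by blast
      have "{t (i, j) | i. (i, j) \<in> cells [n]} = {x}"
        using j by (auto simp: cells_def)
      moreover have "\<pi> ` {t (i, j) | i. (i, j) \<in> cells [n]} = {t (i, j) | i. (i, j) \<in> cells [n]}"
        using \<pi> by (simp add: column_stabilizer_def)
      ultimately show ?thesis by simp
    next
      case False
      then show ?thesis
        using \<pi> by (auto simp: column_stabilizer_def permutes_def)
    qed
    then show "\<pi> \<in> {id}"
      by auto
  qed (auto simp: column_stabilizer_def permutes_id)
  then show ?thesis
    by (simp add: polytabloid_def tabloid_def T sign_id)
qed

lemma irr_char_row:
  assumes \<sigma>: "\<sigma> permutes {1..n}"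
  shows "irr_char [n] \<sigma> = (1 :: 'a::field_char_0)"
proof -
  let ?V = "specht [n] :: (nat set list \<Rightarrow>\<^sub>0 'a) set" and ?e = "monom [{1..n}] :: nat set list \<Rightarrow>\<^sub>0 'a"
  have "tableau [n] (\<lambda>(i, j). Suc j)"
    unfolding tableau_def
    by (rule bij_betwI[where g = "\<lambda>k. (0, k - 1)"]) (auto simp: cells_def)
  then have "{polytabloid [n] t | t. tableau [n] t} = {?e}"
    using polytabloid_row[of n] by (intro equalityI subsetI) (auto, metis)
  then have span_e: "?V = FV.span {?e}"
    by (simp add: specht_def)
  have e: "?e \<in> ?V"
    unfolding span_e by (simp add: FV.span_base)
  interpret dual_bases_mod fscale ?V "{0}" "{()}" "\<lambda>_. ?e" "\<lambda>_ f. Poly_Mapping.lookup f [{1..n}]"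
  proof
    fix x assume x: "x \<in> ?V" "\<And>i. i \<in> {()} \<Longrightarrow> Poly_Mapping.lookup x [{1..n}] = 0"
    then obtain c where "x = fscale c ?e"
      unfolding span_e FV.span_singleton by blast
    with x(2)[of "()"] show "x \<in> {0}"
      by (simp add: lookup_monom poly_mapping_eqI)
  next
    show "FV.subspace ?V" "{0} \<subseteq> ?V" "?e \<in> ?V"
      by (simp_all only: span_e FV.subspace_span e[unfolded span_e]) (simp add: FV.span_zero)
  qed (simp_all add: FV.subspace_def lookup_monom lookup_add algebra_simps)
  interpret P: module_hom fscale fscale "tabloid_perm \<sigma> :: _ \<Rightarrow> (nat set list \<Rightarrow>\<^sub>0 'a)"
    by (rule module_hom_tabloid_perm)
  have fixed: "tabloid_perm \<sigma> ?e = ?e"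
    using permutes_image[OF \<sigma>] by (simp add: tabloid_perm_monom)
  have "tabloid_perm \<sigma> ` ?V \<subseteq> ?V"
    unfolding span_e FV.span_singleton by (auto simp: P.scale fixed simp del: One_nat_def)
  then have "irr_char [n] \<sigma> = Poly_Mapping.lookup (tabloid_perm \<sigma> ?e) [{1..n}]"
    unfolding irr_char_def by (subst quot_trace_eq) (simp_all add: P.zero module_hom_tabloid_perm)
  then show ?thesis
    unfolding fixed by (simp add: lookup_monom)
qed

text \<open>
  A tabloid of shape \<open>(n-1,1)\<close> is determined by the entry \<open>k\<close> of its second row, and a polytabloid
  is the difference of the two tabloids obtained from the entries of the first column.
\<close>

definition hook_tabloid :: "nat \<Rightarrow> nat \<Rightarrow> nat set list" where
  "hook_tabloid n k = [{1..n} - {k}, {k}]"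

lemma hook_tabloid_eq_iff [simp]: "hook_tabloid n k = hook_tabloid n l \<longleftrightarrow> k = l"
  by (auto simp: hook_tabloid_def)

lemma map_image_hook_tabloid:
  assumes "\<sigma> permutes {1..n}"
  shows "map ((`) \<sigma>) (hook_tabloid n k) = hook_tabloid n (\<sigma> k)"
  using image_set_diff[OF permutes_inj[OF assms]] permutes_image[OF assms]
  by (simp add: hook_tabloid_def)

lemma cells_hook:
  assumes "n \<ge> 2"
  shows "cells [n - 1, 1] = insert (1, 0) ({0} \<times> {..<n - 1})"
  by (auto simp: cells_def nth_Cons' split: if_splits)

lemma tableau_hook:
  assumes n: "n \<ge> 2" and t: "tableau [n - 1, 1] t"
  shows "bij_betw t (insert (1, 0) ({0} \<times> {..<n - 1})) {1..n}"
    and "t (0, 0) \<in> {1..n}" "t (1, 0) \<in> {1..n}" "t (0, 0) \<noteq> t (1, 0)"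
proof -
  have "sum_list [n - 1, 1] = n"
    using n by simp
  then show bij: "bij_betw t (insert (1, 0) ({0} \<times> {..<n - 1})) {1..n}"
    using t by (simp only: tableau_def cells_hook[OF n])
  have mem: "(0, 0) \<in> insert (1, 0) ({0} \<times> {..<n - 1})" "(1, 0) \<in> insert (1, 0) ({0 :: nat} \<times> {..<n - 1})"
    using n by auto
  show "t (0, 0) \<in> {1..n}" "t (1, 0) \<in> {1..n}"
    by (rule bij_betw_apply[OF bij mem(1)], rule bij_betw_apply[OF bij mem(2)])
  show "t (0, 0) \<noteq> t (1, 0)"
    using inj_onD[OF bij_betw_imp_inj_on[OF bij] _ mem] by auto
qed

text \<open>
  Apart from the first column, \<open>{t (0, 0), t (1, 0)}\<close>, all columns are singletons.
\<close>

lemma column_stabilizer_hook: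
  assumes n: "n \<ge> 2" and t: "tableau [n - 1, 1] t"
  shows "column_stabilizer [n - 1, 1] t = {id, Transposition.transpose (t (0, 0)) (t (1, 0))}"
proof -
  let ?a = "t (0, 0)" and ?b = "t (1, 0)"
  note bij = tableau_hook(1)[OF n t] and ab = tableau_hook(2-4)[OF n t]
  have size: "sum_list [n - 1, 1] = n"
    using n by simp
  define col where "col j = {t (i, j) | i. (i, j) \<in> cells [n - 1, 1]}" for j
  have stabilizer_iff: "\<pi> \<in> column_stabilizer [n - 1, 1] t \<longleftrightarrow> \<pi> permutes {1..n} \<and> (\<forall>j. \<pi> ` col j = col j)" for \<pi>
    unfolding column_stabilizer_def size col_def by (rule mem_Collect_eq)
  have first: "col 0 = {?a, ?b}"
    using n by (auto simp: col_def cells_hook[OF n] simp del: One_nat_def)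
  have rest: "col j = (if j < n - 1 then {t (0, j)} else {})" if "j > 0" for j
    using that by (auto simp: col_def cells_hook[OF n] simp del: One_nat_def)
  have cover: "x \<in> {?a, ?b} \<or> (\<exists>j. 0 < j \<and> j < n - 1 \<and> x = t (0, j))" if "x \<in> {1..n}" for x
  proof -
    have "x \<in> t ` (insert (1, 0) ({0} \<times> {..<n - 1}))"
      using that bij by (simp add: bij_betw_def)
    then obtain c where "c \<in> insert (1, 0) ({0} \<times> {..<n - 1})" "x = t c"
      by blast
    then show ?thesis
      by (cases "snd c = 0") auto
  qed
  show ?thesis
  proof (intro equalityI subsetI)
    fix \<pi> assume "\<pi> \<in> column_stabilizer [n - 1, 1] t"
    then have \<pi>: "\<pi> permutes {1..n}"
      and stab: "\<pi> ` col j = col j" for j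
      unfolding stabilizer_iff by blast+
    have fix_rest: "\<pi> x = x" if ne: "x \<noteq> ?a" "x \<noteq> ?b" for x
    proof (cases "x \<in> {1..n}")
      case True
      then obtain j where j: "0 < j" "j < n - 1" "x = t (0, j)"
        using cover[OF True] ne by blast
      then show ?thesis
        using stab[of j] rest[of j] by simp
    next
      case False
      then show ?thesis
        using \<pi> by (auto simp: permutes_def)
    qed
    have "\<pi> ` {?a, ?b} = {?a, ?b}"
      using stab[of 0] unfolding first .
    then have "{\<pi> ?a, \<pi> ?b} = {?a, ?b}"
      by simp
    then consider "\<pi> ?a = ?a" "\<pi> ?b = ?b" | "\<pi> ?a = ?b" "\<pi> ?b = ?a"
      unfolding doubleton_eq_iff by blast
    then show "\<pi> \<in> {id, Transposition.transpose ?a ?b}"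
    proof cases
      case 1
      have "\<pi> x = id x" for x
        using fix_rest[of x] 1 by (cases "x = ?a"; cases "x = ?b") auto
      then have "\<pi> = id" by (rule ext)
      then show ?thesis by simp
    next
      case 2
      have "\<pi> x = Transposition.transpose ?a ?b x" for x
        using fix_rest[of x] 2 by (simp add: Transposition.transpose_def)
      then have "\<pi> = Transposition.transpose ?a ?b" by (rule ext)
      then show ?thesis by simp
    qed
  next
    fix \<pi> assume "\<pi> \<in> {id, Transposition.transpose ?a ?b}"
    then consider "\<pi> = id" | "\<pi> = Transposition.transpose ?a ?b"
      by blast
    then show "\<pi> \<in> column_stabilizer [n - 1, 1] t"
    proof cases
      case 1
      then show ?thesis unfolding stabilizer_iff by (simp add: permutes_id)
    next
      case 2
      have "\<pi> ` col j = col j" for j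
      proof (cases "j = 0")
        case True
        show ?thesis
          unfolding True first 2 by auto
      next
        case False
        have "t (0, j) \<noteq> ?a \<and> t (0, j) \<noteq> ?b" if "j < n - 1"
          using inj_onD[OF bij_betw_imp_inj_on[OF bij], of "(0, j)" "(0, 0)"]
            inj_onD[OF bij_betw_imp_inj_on[OF bij], of "(0, j)" "(1, 0)"] that False n by auto
        then show ?thesis
          using rest[of j] False by (simp add: 2)
      qed
      moreover have "\<pi> permutes {1..n}"
        unfolding 2 by (rule permutes_swap_id) (use ab in auto)
      ultimately show ?thesis
        unfolding stabilizer_iff by blast
    qed
  qed
qed

lemma tabloid_hook:
  assumes n: "n \<ge> 2" and t: "tableau [n - 1, 1] t"
  shows "tabloid [n - 1, 1] t = hook_tabloid n (t (1, 0))"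
proof -
  note bij = tableau_hook(1)[OF n t]
  have "{1..n} - {t (1, 0)} = t ` ({0} \<times> {..<n - 1})"
  proof -
    have "t (1, 0) \<notin> t ` ({0} \<times> {..<n - 1})"
      using bij_betw_imp_inj_on[OF bij] unfolding inj_on_insert by simp
    then show ?thesis
      unfolding bij_betw_imp_surj_on[OF bij, symmetric] image_insert by blast
  qed
  also have "\<dots> = {t (0, j) | j. j < n - 1}"
    by auto
  finally show ?thesis
    by (simp add: tabloid_def hook_tabloid_def)
qed

lemma polytabloid_hook:
  assumes n: "n \<ge> 2" and t: "tableau [n - 1, 1] t"
  shows "polytabloid [n - 1, 1] t = monom (hook_tabloid n (t (1, 0))) - monom (hook_tabloid n (t (0, 0)))"
proof -
  let ?a = "t (0, 0)" and ?b = "t (1, 0)" and ?\<tau> = "Transposition.transpose (t (0, 0)) (t (1, 0))"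
  have bij: "bij_betw t (cells [n - 1, 1]) {1..sum_list [n - 1, 1]}"
    using t by (simp add: tableau_def)
  note ab = tableau_hook(4)[OF n t]
  then have "?\<tau> \<noteq> id"
    by (metis id_apply transpose_apply_first)
  then have sum: "polytabloid [n - 1, 1] t = monom (tabloid [n - 1, 1] t)
      + fscale (of_int (sign ?\<tau>)) (monom (tabloid [n - 1, 1] (?\<tau> \<circ> t)))"
    unfolding polytabloid_def column_stabilizer_hook[OF n t] by (simp add: sign_id)
  have swapped: "tableau [n - 1, 1] (?\<tau> \<circ> t)"
  proof -
    have "?\<tau> \<in> column_stabilizer [n - 1, 1] t"
      unfolding column_stabilizer_hook[OF n t] by blast
    then have "bij_betw ?\<tau> {1..sum_list [n - 1, 1]} {1..sum_list [n - 1, 1]}"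
      unfolding column_stabilizer_def by (blast intro: permutes_imp_bij)
    then show ?thesis
      unfolding tableau_def by (rule bij_betw_trans[OF bij])
  qed
  show ?thesis
    unfolding sum tabloid_hook[OF n t] tabloid_hook[OF n swapped]
    by (rule poly_mapping_eqI) (simp add: sign_swap_id ab[simplified] lookup_add lookup_minus)
qed

text \<open>
  The polytabloids are all differences of two distinct tabloids, since a tableau may have any two
  distinct entries in its first column.
\<close>

lemma specht_hook:
  assumes n: "n \<ge> 2"
  shows "(specht [n - 1, 1] :: (nat set list \<Rightarrow>\<^sub>0 'a::field) set) =
    FV.span {monom (hook_tabloid n k) - monom (hook_tabloid n l) | k l. k \<in> {1..n} \<and> l \<in> {1..n} \<and> k \<noteq> l}"
  unfolding specht_def
proof (rule arg_cong[where f = FV.span], intro equalityI subsetI)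
  fix x :: "nat set list \<Rightarrow>\<^sub>0 'a"
  assume "x \<in> {polytabloid [n - 1, 1] t | t. tableau [n - 1, 1] t}"
  then obtain t where t: "tableau [n - 1, 1] t" and x: "x = polytabloid [n - 1, 1] t"
    by blast
  show "x \<in> {monom (hook_tabloid n k) - monom (hook_tabloid n l) | k l. k \<in> {1..n} \<and> l \<in> {1..n} \<and> k \<noteq> l}"
    unfolding x polytabloid_hook[OF n t]
    using tableau_hook(2-4)[OF n t] by (intro CollectI exI[of _ "t (1, 0)"] exI[of _ "t (0, 0)"]) simp
next
  fix x :: "nat set list \<Rightarrow>\<^sub>0 'a"
  assume "x \<in> {monom (hook_tabloid n k) - monom (hook_tabloid n l) | k l. k \<in> {1..n} \<and> l \<in> {1..n} \<and> k \<noteq> l}"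
  then obtain k l where kl: "k \<in> {1..n}" "l \<in> {1..n}" "k \<noteq> l"
    and x: "x = monom (hook_tabloid n k) - monom (hook_tabloid n l)"
    by blast
  have "card (cells [n - 1, 1]) = card {1..n}"
    unfolding cells_hook[OF n] using n by (subst card_insert_disjoint) (auto simp: card_cartesian_product)
  moreover have "finite (cells [n - 1, 1])"
    unfolding cells_hook[OF n] by simp
  ultimately obtain t0 where t0: "bij_betw t0 (cells [n - 1, 1]) {1..n}"
    using finite_same_card_bij[of "cells [n - 1, 1]" "{1..n}"] by blast
  then have "tableau [n - 1, 1] t0"
    using n by (simp add: tableau_def)
  note corner = tableau_hook(2-4)[OF n this]
  \<comment> \<open>an arbitrary tableau is moved so that its first column becomes \<open>l, k\<close>\<close>
  define m where "m = Transposition.transpose (t0 (0, 0)) l (t0 (1, 0))"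
  define \<pi> where "\<pi> = Transposition.transpose m k \<circ> Transposition.transpose (t0 (0, 0)) l"
  have m: "m \<in> {1..n}" "m \<noteq> l"
    using corner kl by (auto simp: m_def Transposition.transpose_def)
  have \<pi>: "\<pi> permutes {1..n}"
    unfolding \<pi>_def by (intro permutes_compose permutes_swap_id kl m corner)
  have col: "\<pi> (t0 (0, 0)) = l" "\<pi> (t0 (1, 0)) = k"
    using m kl unfolding \<pi>_def comp_def m_def[symmetric] by (simp_all add: transpose_eq_iff)
  have t: "tableau [n - 1, 1] (\<pi> \<circ> t0)"
    unfolding tableau_def using bij_betw_trans[OF t0 permutes_imp_bij[OF \<pi>]] n by simp
  moreover have "x = polytabloid [n - 1, 1] (\<pi> \<circ> t0)"
    unfolding polytabloid_hook[OF n t] x comp_apply col ..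
  ultimately show "x \<in> {polytabloid [n - 1, 1] t | t. tableau [n - 1, 1] t}"
    by blast
qed

text \<open>
  The permutation module on the tabloids has trace the number of fixed points, and the Specht module
  is its hyperplane of coefficient sum zero, with basis the differences to the first tabloid.
\<close>

lemma irr_char_hook:
  assumes n: "n \<ge> 2" and \<sigma>: "\<sigma> permutes {1..n}"
  shows "irr_char [n - 1, 1] \<sigma> = (of_nat (card {k \<in> {1..n}. \<sigma> k = k}) - 1 :: 'a::field_char_0)"
proof -
  let ?V = "specht [n - 1, 1] :: (nat set list \<Rightarrow>\<^sub>0 'a) set"
  define e :: "nat \<Rightarrow> nat set list \<Rightarrow>\<^sub>0 'a" where "e k = monom (hook_tabloid n k)" for k
  define \<phi> :: "nat \<Rightarrow> (nat set list \<Rightarrow>\<^sub>0 'a) \<Rightarrow> 'a" where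
    "\<phi> k f = Poly_Mapping.lookup f (hook_tabloid n k)" for k f
  interpret \<phi>: module_hom fscale "(*)" "\<phi> k" for k
    unfolding \<phi>_def by (rule module_hom_lookup)
  have \<phi>_e: "\<phi> k (e l) = of_bool (l = k)" for k l
    by (simp add: \<phi>_def e_def lookup_monom)
  have span_e: "?V = FV.span {e k - e l | k l. k \<in> {1..n} \<and> l \<in> {1..n} \<and> k \<noteq> l}"
    unfolding specht_hook[OF n] e_def ..
  let ?U = "{f. Poly_Mapping.keys f \<subseteq> hook_tabloid n ` {1..n}} \<inter> {f. (\<Sum>k=1..n. \<phi> k f) = 0}"
  have e_keys: "Poly_Mapping.keys (e k) \<subseteq> hook_tabloid n ` {1..n}" if "k \<in> {1..n}" for k
    using that by (simp add: e_def monom_def)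
  have "FV.subspace {f. (\<Sum>k=1..n. \<phi> k f) = 0}"
    by (rule FV.subspaceI) (simp_all add: \<phi>.zero \<phi>.add \<phi>.scale sum.distrib flip: sum_distrib_left)
  then have "FV.subspace ?U"
    by (rule FV.subspace_inter[OF subspace_keys])
  then have V_U: "?V \<subseteq> ?U"
    unfolding span_e
  proof (rule FV.span_minimal[rotated], safe)
    fix k l assume "k \<in> {1..n}" "l \<in> {1..n}"
    then show "(\<Sum>i=1..n. \<phi> i (e k - e l)) = 0"
      by (simp add: \<phi>.diff \<phi>_e sum_subtractf of_bool_def)
    fix T assume "T \<in> Poly_Mapping.keys (e k - e l)"
    then have "T \<in> Poly_Mapping.keys (e k) \<or> T \<in> Poly_Mapping.keys (e l)"
      by (auto simp: in_keys_iff lookup_minus)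
    then show "T \<in> hook_tabloid n ` {1..n}"
      using e_keys[OF \<open>k \<in> _\<close>] e_keys[OF \<open>l \<in> _\<close>] by blast
  qed
  interpret dual_bases_mod fscale ?V "{0}" "{2..n}" "\<lambda>k. e k - e 1" \<phi>
  proof
    show "FV.subspace ?V" "FV.subspace {0 :: nat set list \<Rightarrow>\<^sub>0 'a}" "{0} \<subseteq> ?V"
      by (simp_all only: span_e FV.subspace_span FV.subspace_single_0) (simp add: FV.span_zero)
    show "{2..n} \<noteq> {}" using n by simp
    fix x assume x: "x \<in> ?V" "\<And>k. k \<in> {2..n} \<Longrightarrow> \<phi> k x = 0"
    have sum_0: "(\<Sum>k=1..n. \<phi> k x) = 0" and keys: "Poly_Mapping.keys x \<subseteq> hook_tabloid n ` {1..n}"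
      using x(1) V_U by blast+
    have first_rest: "{1..n} = insert 1 {2..n}"
      using n by auto
    have "\<phi> 1 x = 0"
      using sum_0 unfolding first_rest by (simp add: x(2))
    then have "\<phi> k x = 0" if "k \<in> {1..n}" for k
      using that x(2)[of k] unfolding first_rest by blast
    then have "Poly_Mapping.lookup x T = 0" if "T \<in> hook_tabloid n ` {1..n}" for T
      using that unfolding \<phi>_def by blast
    then have "Poly_Mapping.keys x = {}"
      using keys by (meson in_keys_iff subset_eq equals0I)
    then show "x \<in> {0}"
      by simp
  next
    fix k :: nat assume "k \<in> {2..n}"
    then show "e k - e 1 \<in> ?V"
      unfolding span_e
      by (intro FV.span_base CollectI exI[of _ k] exI[of _ 1]) (use n in simp)
  qed (simp_all add: \<phi>.diff \<phi>_e \<phi>.zero \<phi>.add \<phi>.scale algebra_simps)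
  interpret P: module_hom fscale fscale "tabloid_perm \<sigma> :: _ \<Rightarrow> (nat set list \<Rightarrow>\<^sub>0 'a)"
    by (rule module_hom_tabloid_perm)
  have P_e: "tabloid_perm \<sigma> (e k) = e (\<sigma> k)" for k
    by (simp add: e_def tabloid_perm_monom map_image_hook_tabloid[OF \<sigma>])
  have \<sigma>_mem: "\<sigma> k \<in> {1..n} \<longleftrightarrow> k \<in> {1..n}" for k
    by (rule permutes_in_image[OF \<sigma>])
  have "tabloid_perm \<sigma> ` ?V = FV.span (tabloid_perm \<sigma> ` {e k - e l | k l. k \<in> {1..n} \<and> l \<in> {1..n} \<and> k \<noteq> l})"
    unfolding span_e by (rule P.span_image[symmetric])
  also have "\<dots> \<subseteq> ?V"
    unfolding span_e
  proof (rule FV.span_mono, safe)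
    fix k l assume "k \<in> {1..n}" "l \<in> {1..n}" "k \<noteq> l"
    then show "\<exists>k' l'. tabloid_perm \<sigma> (e k - e l) = e k' - e l' \<and> k' \<in> {1..n} \<and> l' \<in> {1..n} \<and> k' \<noteq> l'"
      by (intro exI[of _ "\<sigma> k"] exI[of _ "\<sigma> l"])
        (simp add: P.diff P_e \<sigma>_mem inj_eq[OF permutes_inj[OF \<sigma>]] del: atLeastAtMost_iff One_nat_def)
  qed
  finally have stable: "tabloid_perm \<sigma> ` ?V \<subseteq> ?V" .
  have "irr_char [n - 1, 1] \<sigma> = (\<Sum>k=2..n. \<phi> k (tabloid_perm \<sigma> (e k - e 1)))"
    unfolding irr_char_def by (rule quot_trace_eq[OF module_hom_tabloid_perm stable]) (simp add: P.zero)
  also have "\<dots> = (\<Sum>k=2..n. of_bool (\<sigma> k = k) - of_bool (\<sigma> 1 = k))"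
    by (rule sum.cong) (simp_all add: P.diff P_e \<phi>.diff \<phi>_e)
  also have "\<dots> = (\<Sum>k=1..n. of_bool (\<sigma> k = k) - of_bool (\<sigma> 1 = k))"
    using n by (subst sum.atLeast_Suc_atMost[of 1 n]) (auto simp: numeral_2_eq_2)
  also have "\<dots> = of_nat (card {k \<in> {1..n}. \<sigma> k = k}) - 1"
  proof -
    have "\<sigma> 1 \<in> {1..n}"
      using \<sigma>_mem n by simp
    then show ?thesis
      by (simp add: sum_subtractf of_bool_def sum.If_cases Int_def del: atLeastAtMost_iff)
  qed
  finally show ?thesis .
qed


section \<open>The action of the enveloping algebra\<close>

(* keeps the variable index 1 and the intervals {1..n} from being rewritten to Suc 0 *)
declare One_nat_def [simp del]

lemma foldr_module_hom:
  assumes "vector_space sc" "\<And>g. g \<in> set w \<Longrightarrow> module_hom sc sc (act g)"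
  shows "module_hom sc sc (foldr act w)"
  using assms(2)
proof (induction w)
  case Nil
  interpret vector_space sc by (rule assms(1))
  show ?case by standard simp_all
next
  case (Cons g w)
  then show ?case
    using module_hom_compose[of sc sc "foldr act w" sc "act g"] by (simp add: comp_def)
qed

context vector_space
begin

lemma lin_ext_in_subspace:
  assumes "subspace S" "\<And>k. k \<in> Poly_Mapping.keys f \<Longrightarrow> g k \<in> S"
  shows "lin_ext scale g f \<in> S"
  unfolding lin_ext_def by (intro subspace_sum subspace_scale assms)

lemma module_hom_env_act: "module_hom fscale scale (\<lambda>h. env_act scale act h a)"
  unfolding env_act_def by (rule module_hom_lin_ext)

lemma env_act_monom: "env_act scale act (monom w) a = foldr act w a"
  by (simp add: env_act_def lin_ext_monom)

lemma env_act_gen: "env_act scale act (gen g) a = act g a"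
  by (simp add: gen_def env_act_monom)

lemma env_act_one: "env_act scale act 1 a = a"
  using env_act_monom[of act "[]"] by (simp add: monom_Nil)

lemma env_act_mult:
  assumes act: "\<And>g. g \<in> X \<Longrightarrow> module_hom scale scale (act g)" and u: "u \<in> free_alg X"
  shows "env_act scale act (u * v) a = env_act scale act u (env_act scale act v a)"
proof (rule module_hom_eqI[where S = "\<lambda>u. env_act scale act (u * v) a"])
  show "module_hom fscale scale (\<lambda>u. env_act scale act (u * v) a)"
    using module_hom_compose[OF module_hom_right_mult module_hom_env_act] by (simp add: comp_def)
  fix w assume w: "w \<in> Poly_Mapping.keys u"
  have fold: "module_hom scale scale (foldr act w)"
    by (rule foldr_module_hom[OF vector_space_axioms]) (use u w act in \<open>auto simp: free_alg_def\<close>)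
  have "env_act scale act (monom w * v) a = foldr act w (env_act scale act v a)"
  proof (rule module_hom_eqI)
    show "module_hom fscale scale (\<lambda>v. env_act scale act (monom w * v) a)"
      using module_hom_compose[OF module_hom_left_mult module_hom_env_act] by (simp add: comp_def)
    show "module_hom fscale scale (\<lambda>v. foldr act w (env_act scale act v a))"
      using module_hom_compose[OF module_hom_env_act fold] by (simp add: comp_def)
  qed (simp add: monom_mult env_act_monom plus_list_def)
  then show "env_act scale act (monom w * v) a = env_act scale act (monom w) (env_act scale act v a)"
    by (simp add: env_act_monom)
qed (rule module_hom_env_act)

lemma env_act_in_subspace:
  assumes "subspace S" "\<And>g b. g \<in> X \<Longrightarrow> b \<in> S \<Longrightarrow> act g b \<in> S" "a \<in> S" "h \<in> free_alg X"
  shows "env_act scale act h a \<in> S"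
  unfolding env_act_def
proof (rule lin_ext_in_subspace[OF assms(1)])
  fix w assume "w \<in> Poly_Mapping.keys h"
  then have "set w \<subseteq> X"
    using assms(4) by (simp add: free_alg_def)
  then show "foldr act w a \<in> S"
    by (induction w) (simp_all add: assms(2,3))
qed

end


section \<open>Differential polynomials\<close>

locale diff_poly_algebra = lie_algebra L
  for L :: "('a::field, 'l::ab_group_add) lie" +
  fixes B :: "('l list \<Rightarrow>\<^sub>0 'a) set"
  assumes env_basis: "env_basis L B"
begin

abbreviation T :: "('l list \<Rightarrow>\<^sub>0 'a) set" where "T \<equiv> free_alg (lie_carrier L)"
abbreviation coord where "coord \<equiv> FV.coords_mod (env_ideal L) B"
abbreviation letters :: "(nat \<times> ('l list \<Rightarrow>\<^sub>0 'a)) set" where "letters \<equiv> {1..} \<times> B"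
abbreviation diff_act where "diff_act \<equiv> dpoly_act L B"

lemma basis_mod: "FV.basis_mod T (env_ideal L) B" and one_in_B: "1 \<in> B"
  using env_basis by (simp_all add: env_basis_def)

lemma B_in_T: "b \<in> B \<Longrightarrow> b \<in> T"
  using basis_mod by (auto simp: FV.basis_mod_def)

lemma subspace_env_ideal: "FV.subspace (env_ideal L)"
  unfolding env_ideal_def by (rule FV.subspace_span)

lemma env_ideal_left_mult:
  assumes "u \<in> T" "i \<in> env_ideal L"
  shows "u * i \<in> env_ideal L"
  using assms(2) unfolding env_ideal_def
proof (induction rule: FV.span_induct)
  case base
  interpret module_hom fscale fscale "(*) u" by (rule module_hom_left_mult)
  show ?case
    using subspace_vimage[OF FV.subspace_span] by (simp add: vimage_def)
next
  case (step x)
  then obtain p r v where "x = p * r * v" "p \<in> T" "r \<in> env_rels L" "v \<in> T"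
    by blast
  then have "u * x = (u * p) * r * v" "u * p \<in> T"
    using assms(1) free_alg_mult by (simp_all add: mult.assoc)
  then show ?case
    using \<open>r \<in> _\<close> \<open>v \<in> T\<close> by (intro FV.span_base) blast
qed

text \<open>
  The factorization of \<open>u * r * v\<close> into successive actions requires \<open>r\<close> to be a combination of
  words in \<open>L\<close>.
\<close>

lemma env_rels_in_T: "r \<in> env_rels L \<Longrightarrow> r \<in> T"
  unfolding env_rels_def
  by (elim UnE CollectE exE conjE;
      simp add: FV.subspace_diff[OF subspace_free_alg] FV.subspace_scale[OF subspace_free_alg] free_alg_mult
        subspace_add[OF subspace_carrier] subspace_scale[OF subspace_carrier] bracket_closed)

lemma dvar_superset:
  assumes "finite A" "{b. coord h b \<noteq> 0} \<subseteq> A"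
  shows "dvar L B j h = (\<Sum>b\<in>A. fscale (coord h b) (gen (j, b)))"
  unfolding dvar_def Let_def by (rule sum.mono_neutral_left) (use assms in auto)

lemma dvar_add:
  assumes "h \<in> T" "h' \<in> T"
  shows "dvar L B j (h + h') = dvar L B j h + dvar L B j h'"
proof -
  let ?A = "{b. coord h b \<noteq> 0} \<union> {b. coord h' b \<noteq> 0}"
  have "finite ?A"
    using FV.coords_mod(1)[OF basis_mod] assms by simp
  moreover have "coord (h + h') b = coord h b + coord h' b" for b
    using FV.coords_mod_add[OF basis_mod subspace_free_alg subspace_env_ideal assms] by simp
  ultimately show ?thesis
    by (subst (1 2 3) dvar_superset[of ?A])
      (auto simp: FV.scale_left_distrib sum.distrib simp del: fscale_def)
qed

lemma dvar_scale: "h \<in> T \<Longrightarrow> dvar L B j (fscale c h) = fscale c (dvar L B j h)"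
  using FV.coords_mod(1)[OF basis_mod, of h]
  by (subst (1 2) dvar_superset[of "{b. coord h b \<noteq> 0}"])
    (auto simp: FV.coords_mod_scale[OF basis_mod subspace_free_alg subspace_env_ideal] FV.scale_sum_right)

lemma dvar_zero: "dvar L B j 0 = 0"
proof -
  have "coord 0 = (\<lambda>b. 0)"
    by (rule FV.coords_mod_zero[OF basis_mod])
      (simp_all add: FV.subspace_0 subspace_free_alg subspace_env_ideal)
  then show ?thesis by (simp add: dvar_def)
qed

lemma dvar_diff: "h \<in> T \<Longrightarrow> h' \<in> T \<Longrightarrow> dvar L B j (h - h') = dvar L B j h - dvar L B j h'"
  using dvar_add[of "h - h'" h' j] FV.subspace_diff[OF subspace_free_alg, of h _ h'] by simp

lemma dvar_sum:
  assumes "finite A" "\<And>i. i \<in> A \<Longrightarrow> v i \<in> T"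
  shows "dvar L B j (\<Sum>i\<in>A. fscale (a i) (v i)) = (\<Sum>i\<in>A. fscale (a i) (dvar L B j (v i)))"
  using assms
  by (induction A)
    (simp_all add: dvar_zero dvar_add dvar_scale FV.subspace_scale[OF subspace_free_alg]
      FV.subspace_sum[OF subspace_free_alg])

lemma dvar_cong:
  assumes "h \<in> T" "h' \<in> T" "h - h' \<in> env_ideal L"
  shows "dvar L B j h = dvar L B j h'"
  using FV.coords_mod_cong[OF basis_mod subspace_free_alg subspace_env_ideal assms] by (simp add: dvar_def)

lemma dvar_basis: "b \<in> B \<Longrightarrow> dvar L B j b = gen (j, b)"
  by (subst dvar_superset[of "{b}"])
    (auto simp: FV.coords_mod_base[OF basis_mod subspace_env_ideal] FV.scale_one)

lemma dvar_one: "dvar L B j 1 = gen (j, 1)"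
  by (rule dvar_basis[OF one_in_B])

text \<open>
  A representative \<open>h\<close> of an element of \<open>U(L)\<close> differs from its expansion in \<open>B\<close> by an element of
  the ideal of relations, while \<open>x\<^sub>j\<^sup>h\<close> is equal to the corresponding combination of generators.
\<close>

lemma basis_expansion:
  assumes "h \<in> T"
  obtains A where "finite A" "A \<subseteq> B" "h - (\<Sum>b\<in>A. fscale (coord h b) b) \<in> env_ideal L"
    "\<And>j. dvar L B j h = (\<Sum>b\<in>A. fscale (coord h b) (gen (j, b)))"
  using FV.coords_mod[OF basis_mod assms] that[of "{b. coord h b \<noteq> 0}"]
  by (simp add: dvar_superset)

lemma diff_polys_iff: "f \<in> diff_polys B \<longleftrightarrow> Poly_Mapping.keys f \<subseteq> {w. w \<noteq> [] \<and> set w \<subseteq> letters}"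
  by (auto simp: diff_polys_def)

lemma subspace_diff_polys: "FV.subspace (diff_polys B)"
proof -
  have "diff_polys B = {f. Poly_Mapping.keys f \<subseteq> {w. w \<noteq> [] \<and> set w \<subseteq> letters}}"
    by (intro set_eqI) (simp only: diff_polys_iff mem_Collect_eq)
  then show ?thesis
    by (simp only: subspace_keys)
qed

lemma diff_polys_in_free_alg: "f \<in> diff_polys B \<Longrightarrow> f \<in> free_alg letters"
  by (auto simp: diff_polys_def free_alg_def)

lemma diff_polys_mult_left: "p \<in> free_alg letters \<Longrightarrow> q \<in> diff_polys B \<Longrightarrow> p * q \<in> diff_polys B"
  unfolding diff_polys_iff free_alg_iff by (erule keys_mult_subset) (auto simp: plus_list_def)

lemma diff_polys_mult_right: "p \<in> diff_polys B \<Longrightarrow> q \<in> free_alg letters \<Longrightarrow> p * q \<in> diff_polys B"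
  unfolding diff_polys_iff free_alg_iff by (erule keys_mult_subset) (auto simp: plus_list_def)

lemma dvar_in_diff_polys:
  assumes "j \<ge> 1" "h \<in> T"
  shows "dvar L B j h \<in> diff_polys B"
proof -
  obtain A where A: "finite A" "A \<subseteq> B" "h - (\<Sum>b\<in>A. fscale (coord h b) b) \<in> env_ideal L"
    and dvar_h: "\<And>j. dvar L B j h = (\<Sum>b\<in>A. fscale (coord h b) (gen (j, b)))"
    by (rule basis_expansion[OF assms(2)], rule that)
  show ?thesis
    unfolding dvar_h
    by (intro FV.subspace_sum[OF subspace_diff_polys] FV.subspace_scale[OF subspace_diff_polys])
      (use A(2) assms(1) in \<open>auto simp: diff_polys_def gen_def monom_def\<close>)
qed

lemma deriv_word_in_diff_polys:
  assumes "g \<in> lie_carrier L" "set w \<subseteq> letters"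
  shows "deriv_word L B g w \<in> diff_polys B"
  using assms(2)
proof (induction w)
  case Nil
  show ?case by (simp add: FV.subspace_0[OF subspace_diff_polys])
next
  case (Cons x w)
  obtain j b where x: "x = (j, b)" "j \<ge> 1" "b \<in> B"
    using Cons.prems by (cases x) auto
  have "gen g * b \<in> T"
    using assms(1) x(3) B_in_T by (intro free_alg_mult) simp_all
  then have "dvar L B j (gen g * b) * monom w \<in> diff_polys B"
    using Cons.prems x(2) by (intro diff_polys_mult_right dvar_in_diff_polys) simp_all
  moreover have "gen (j, b) * deriv_word L B g w \<in> diff_polys B"
    using Cons x by (intro diff_polys_mult_left) simp_all
  ultimately show ?case
    unfolding x(1) deriv_word.simps by (rule FV.subspace_add[OF subspace_diff_polys])
qed

lemma module_hom_diff_act: "module_hom fscale fscale (diff_act g)"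
  unfolding dpoly_act_def by (rule FV.module_hom_lin_ext)

lemma diff_act_in_diff_polys: "g \<in> lie_carrier L \<Longrightarrow> f \<in> diff_polys B \<Longrightarrow> diff_act g f \<in> diff_polys B"
  unfolding dpoly_act_def
  by (rule FV.lin_ext_in_subspace[OF subspace_diff_polys], rule deriv_word_in_diff_polys)
    (simp_all add: diff_polys_def)

lemma env_act_in_diff_polys:
  "h \<in> T \<Longrightarrow> f \<in> diff_polys B \<Longrightarrow> env_act fscale diff_act h f \<in> diff_polys B"
  by (rule FV.env_act_in_subspace[OF subspace_diff_polys diff_act_in_diff_polys])

text \<open>
  On the generators this is the definition of the action; it extends to all exponents because \<open>dvar\<close>
  is linear and insensitive to the ideal of relations, which is stable under left multiplication.
\<close>

lemma diff_act_dvar: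
  assumes g: "g \<in> lie_carrier L" and h: "h \<in> T"
  shows "diff_act g (dvar L B j h) = dvar L B j (gen g * h)"
proof -
  interpret D: module_hom fscale fscale "diff_act g" by (rule module_hom_diff_act)
  obtain A where A: "finite A" "A \<subseteq> B" "h - (\<Sum>b\<in>A. fscale (coord h b) b) \<in> env_ideal L"
    and dvar_h: "\<And>j. dvar L B j h = (\<Sum>b\<in>A. fscale (coord h b) (gen (j, b)))"
    by (rule basis_expansion[OF h], rule that)
  have gT: "gen g \<in> T"
    using g by simp
  have A_T: "b \<in> T" if "b \<in> A" for b
    using that A(2) B_in_T by blast
  have "diff_act g (gen (j, b)) = dvar L B j (gen g * b)" for b
    by (simp add: dpoly_act_def gen_def FV.lin_ext_monom monom_Nil)
  then have "diff_act g (dvar L B j h) = (\<Sum>b\<in>A. fscale (coord h b) (dvar L B j (gen g * b)))"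
    unfolding dvar_h by (simp add: D.sum D.scale)
  also have "\<dots> = dvar L B j (\<Sum>b\<in>A. fscale (coord h b) (gen g * b))"
    by (rule dvar_sum[symmetric, OF A(1)]) (intro free_alg_mult gT A_T)
  also have "(\<Sum>b\<in>A. fscale (coord h b) (gen g * b)) = gen g * (\<Sum>b\<in>A. fscale (coord h b) b)"
    by (simp add: sum_distrib_left fscale_mult_right)
  also have "dvar L B j \<dots> = dvar L B j (gen g * h)"
  proof (rule dvar_cong[symmetric])
    show "gen g * h - gen g * (\<Sum>b\<in>A. fscale (coord h b) b) \<in> env_ideal L"
      using env_ideal_left_mult[OF gT A(3)] by (simp add: right_diff_distrib)
  qed (intro free_alg_mult gT h FV.subspace_sum[OF subspace_free_alg] FV.subspace_scale[OF subspace_free_alg] A_T; assumption)+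
  finally show ?thesis .
qed

lemma env_act_dvar:
  assumes u: "u \<in> T" and h: "h \<in> T"
  shows "env_act fscale diff_act u (dvar L B j h) = dvar L B j (u * h)"
proof -
  have word: "foldr diff_act w (dvar L B j h) = dvar L B j (monom w * h)" if "set w \<subseteq> lie_carrier L" for w
    using that
  proof (induction w)
    case (Cons g w)
    then show ?case
      by (simp add: monom_Cons mult.assoc diff_act_dvar free_alg_mult h)
  qed (simp add: monom_Nil)
  have letters_u: "set w \<subseteq> lie_carrier L" if "w \<in> Poly_Mapping.keys u" for w
    using u that by (simp add: free_alg_def)
  have "env_act fscale diff_act u (dvar L B j h)
      = (\<Sum>w\<in>Poly_Mapping.keys u. fscale (Poly_Mapping.lookup u w) (dvar L B j (monom w * h)))"
    unfolding env_act_def lin_ext_def by (rule sum.cong) (simp_all add: word letters_u)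
  also have "\<dots> = dvar L B j (\<Sum>w\<in>Poly_Mapping.keys u. fscale (Poly_Mapping.lookup u w) (monom w * h))"
    by (rule dvar_sum[symmetric]) (simp_all add: free_alg_mult h letters_u)
  also have "\<dots> = dvar L B j ((\<Sum>w\<in>Poly_Mapping.keys u. fscale (Poly_Mapping.lookup u w) (monom w)) * h)"
    by (simp add: sum_distrib_right fscale_mult_left)
  finally show ?thesis
    by (simp flip: fscale_monom_expansion)
qed

end

lemma dsubst_gen: 
  assumes "vector_space sc"
  shows "dsubst sc act s (gen (j, b)) = env_act sc act b (s j)"
  by (simp add: dsubst_def gen_def vector_space.lin_ext_monom[OF assms])

lemma dsubst_mult:
  fixes sc :: "'a::field \<Rightarrow> 'v \<Rightarrow> 'v::ring_1"
  assumes "vector_space sc" "\<And>c a b. sc c (a * b) = sc c a * b" "\<And>c a b. sc c (a * b) = a * sc c b"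
  shows "dsubst sc act s (p * q) = dsubst sc act s p * dsubst sc act s q"
  unfolding dsubst_def by (rule lin_ext_mult[OF assms]) (simp add: plus_list_def)

context diff_poly_algebra
begin

lemma module_hom_dsubst_diff: "module_hom fscale fscale (dsubst fscale diff_act s)"
  unfolding dsubst_def by (rule FV.module_hom_lin_ext)

lemma dsubst_diff_gen: "dsubst fscale diff_act s (gen (j, b)) = env_act fscale diff_act b (s j)"
  by (rule dsubst_gen) (rule FV.vector_space_axioms)

lemma dsubst_diff_mult:
  "dsubst fscale diff_act s (p * q) = dsubst fscale diff_act s p * dsubst fscale diff_act s q"
  by (rule dsubst_mult[OF FV.vector_space_axioms fscale_mult_left fscale_mult_right])

lemma dsubst_in_diff_polys:
  assumes s: "range s \<subseteq> diff_polys B" and f: "f \<in> diff_polys B"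
  shows "dsubst fscale diff_act s f \<in> diff_polys B"
  unfolding dsubst_def
proof (rule FV.lin_ext_in_subspace[OF subspace_diff_polys])
  fix w assume "w \<in> Poly_Mapping.keys f"
  then have w: "w \<noteq> []" "set w \<subseteq> letters"
    using f by (auto simp: diff_polys_def)
  show "prod_list (map (\<lambda>(j, b). env_act fscale diff_act b (s j)) w) \<in> diff_polys B"
    using w
  proof (induction w rule: list_nonempty_induct)
    case (single x)
    then show ?case
      using s B_in_T by (auto intro!: env_act_in_diff_polys)
  next
    case (cons x w)
    then show ?case
      using s B_in_T by (auto intro!: env_act_in_diff_polys diff_polys_mult_right diff_polys_in_free_alg)
  qed
qed

text \<open>
  Substituting \<open>x\<^sub>j \<mapsto> x\<^bsub>\<tau> j\<^esub>\<close> is the only kind of substitution into a relation with derivatives that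
  the reduction to normal forms requires.  Its effect follows from \<open>env_act_dvar\<close>.
\<close>

lemma dsubst_rename:
  assumes "h \<in> T"
  shows "dsubst fscale diff_act (\<lambda>i. dvar L B (\<tau> i) 1) (dvar L B j h) = dvar L B (\<tau> j) h"
proof -
  let ?s = "\<lambda>i. dvar L B (\<tau> i) 1"
  interpret S: module_hom fscale fscale "dsubst fscale diff_act ?s" by (rule module_hom_dsubst_diff)
  obtain A where A: "finite A" "A \<subseteq> B" "h - (\<Sum>b\<in>A. fscale (coord h b) b) \<in> env_ideal L"
    and dvar_h: "\<And>j. dvar L B j h = (\<Sum>b\<in>A. fscale (coord h b) (gen (j, b)))"
    by (rule basis_expansion[OF assms], rule that)
  have "dsubst fscale diff_act ?s (gen (j, b)) = gen (\<tau> j, b)" if "b \<in> A" for b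
    using A(2) that B_in_T[of b] by (auto simp: dsubst_diff_gen env_act_dvar dvar_basis)
  then show ?thesis
    unfolding dvar_h by (simp add: S.sum S.scale)
qed

end


section \<open>Differential identities form a \<open>T\<close>-ideal\<close>

locale diff_poly_rep = L_algebra L sc act + diff_poly_algebra L B
  for L :: "('a::field, 'l::ab_group_add) lie" and sc :: "'a \<Rightarrow> 'v \<Rightarrow> 'v::ring_1"
    and act :: "'l \<Rightarrow> 'v \<Rightarrow> 'v" and B :: "('l list \<Rightarrow>\<^sub>0 'a) set"
begin

abbreviation ev where "ev s \<equiv> dsubst sc act s"
abbreviation uact where "uact \<equiv> env_act sc act"

lemma act_hom: "g \<in> lie_carrier L \<Longrightarrow> module_hom sc sc (act g)"
  using act_derivation[of g] by unfold_locales (auto simp: derivation_def)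

lemma act_one: "g \<in> lie_carrier L \<Longrightarrow> act g 1 = 0"
  using act_derivation[of g] unfolding derivation_def
  by (metis add_cancel_right_right mult.left_neutral mult.right_neutral)

lemma uact_mult: "u \<in> T \<Longrightarrow> uact (u * v) a = uact u (uact v a)"
  by (rule A.env_act_mult[OF act_hom])

lemma module_hom_uact_exponent: "module_hom fscale sc (\<lambda>h. uact h a)"
  by (rule A.module_hom_env_act)

lemma uact_zero: "h \<in> T \<Longrightarrow> uact h 0 = 0"
  using A.env_act_in_subspace[OF A.subspace_single_0, of "lie_carrier L" act 0 h]
    module_hom.zero[OF act_hom] by simp

text \<open>
  The relations of \<open>U(L)\<close> express linearity in \<open>L\<close> and compatibility with the bracket, so they act
  as zero on an \<open>L\<close>-algebra and the action of \<open>U(L)\<close> is independent of representatives.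
\<close>

lemma uact_env_rels: "r \<in> env_rels L \<Longrightarrow> uact r a = 0"
proof -
  assume r: "r \<in> env_rels L"
  interpret U: module_hom fscale sc "\<lambda>h. uact h a" by (rule module_hom_uact_exponent)
  show ?thesis
    using r unfolding env_rels_def
    by (auto simp: U.diff U.scale A.env_act_gen uact_mult act_add act_scale act_bracket)
qed

lemma uact_env_ideal: "i \<in> env_ideal L \<Longrightarrow> uact i a = 0"
  unfolding env_ideal_def
proof (induction rule: FV.span_induct)
  case base
  interpret U: module_hom fscale sc "\<lambda>h. uact h a" by (rule module_hom_uact_exponent)
  show ?case
    using U.subspace_kernel by simp
next
  case (step x)
  then obtain u r v where x: "x = u * r * v" "u \<in> T" "r \<in> env_rels L" "v \<in> T"
    by blast
  then show ?case
    by (simp add: mult.assoc uact_mult env_rels_in_T uact_env_rels uact_zero)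
qed

lemma module_hom_ev: "module_hom fscale sc (ev s)"
  unfolding dsubst_def by (rule A.module_hom_lin_ext)

lemma ev_gen: "ev s (gen (j, b)) = uact b (s j)"
  by (rule dsubst_gen) (rule A.vector_space_axioms)

lemma ev_mult: "ev s (p * q) = ev s p * ev s q"
  by (rule dsubst_mult[OF A.vector_space_axioms scale_mult_left scale_mult_right])

lemma ev_one: "ev s 1 = 1"
  unfolding dsubst_def monom_Nil[symmetric] A.lin_ext_monom by simp

text \<open>
  An evaluation is given on the generators with exponents in the basis; this is the same rule for
  all other exponents.
\<close>

lemma ev_dvar:
  assumes h: "h \<in> T"
  shows "ev s (dvar L B j h) = uact h (s j)"
proof -
  interpret E: module_hom fscale sc "ev s" by (rule module_hom_ev)
  interpret U: module_hom fscale sc "\<lambda>h. uact h (s j)" by (rule module_hom_uact_exponent)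
  obtain A where A: "finite A" "A \<subseteq> B" "h - (\<Sum>b\<in>A. fscale (coord h b) b) \<in> env_ideal L"
    and dvar_h: "\<And>j. dvar L B j h = (\<Sum>b\<in>A. fscale (coord h b) (gen (j, b)))"
    by (rule basis_expansion[OF h], rule that)
  have "uact h (s j) = (\<Sum>b\<in>A. sc (coord h b) (uact b (s j)))"
    using uact_env_ideal[OF A(3), of "s j"] by (simp add: U.diff U.sum U.scale)
  then show ?thesis
    unfolding dvar_h by (simp add: E.sum E.scale ev_gen)
qed

text \<open>
  The recursion of \<open>deriv_word\<close> is the Leibniz rule, which \<open>act g\<close> satisfies too.
\<close>

lemma ev_diff_act:
  assumes g: "g \<in> lie_carrier L" and f: "f \<in> free_alg letters"
  shows "ev s (diff_act g f) = act g (ev s f)"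
proof (rule A.module_hom_eqI)
  show "module_hom fscale sc (\<lambda>f. ev s (diff_act g f))"
    using module_hom_compose[OF module_hom_diff_act module_hom_ev] by (simp add: comp_def)
  show "module_hom fscale sc (\<lambda>f. act g (ev s f))"
    using module_hom_compose[OF module_hom_ev act_hom[OF g]] by (simp add: comp_def)
  fix w assume "w \<in> Poly_Mapping.keys f"
  then have "set w \<subseteq> letters"
    using f by (simp add: free_alg_def)
  then have "ev s (deriv_word L B g w) = act g (ev s (monom w))"
  proof (induction w)
    case Nil
    show ?case
      by (simp add: monom_Nil ev_one act_one[OF g] module_hom.zero[OF module_hom_ev])
  next
    case (Cons x w)
    obtain j b where x: "x = (j, b)" "b \<in> T"
      using Cons.prems B_in_T by (cases x) auto
    have gen_b: "gen g * b \<in> T"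
      using g x(2) by (intro free_alg_mult) simp_all
    have leibniz: "act g (a * c) = act g a * c + a * act g c" for a c
      using act_derivation[OF g] by (simp add: derivation_def)
    show ?case
      using Cons by (simp add: x(1) module_hom.add[OF module_hom_ev] ev_mult ev_dvar[OF gen_b] monom_Cons
          ev_gen leibniz uact_mult g A.env_act_gen)
  qed
  then show "ev s (diff_act g (monom w)) = act g (ev s (monom w))"
    by (simp add: dpoly_act_def FV.lin_ext_monom)
qed

lemma ev_env_act:
  assumes h: "h \<in> T" and f: "f \<in> diff_polys B"
  shows "ev s (env_act fscale diff_act h f) = uact h (ev s f)"
proof -
  have fold: "foldr diff_act w f \<in> diff_polys B \<and> ev s (foldr diff_act w f) = foldr act w (ev s f)"
    if "set w \<subseteq> lie_carrier L" for w
    using that by (induction w) (simp_all add: f diff_act_in_diff_polys ev_diff_act diff_polys_in_free_alg)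
  have "ev s (env_act fscale diff_act h f) = lin_ext sc (\<lambda>w. ev s (foldr diff_act w f)) h"
    unfolding env_act_def by (rule lin_ext_hom[OF module_hom_ev])
  also have "\<dots> = uact h (ev s f)"
    unfolding env_act_def lin_ext_def by (rule sum.cong) (use h in \<open>auto simp: fold free_alg_def\<close>)
  finally show ?thesis .
qed

lemma ev_dsubst:
  assumes t: "range t \<subseteq> diff_polys B" and f: "f \<in> free_alg letters"
  shows "ev s (dsubst fscale diff_act t f) = ev (\<lambda>j. ev s (t j)) f"
proof (rule A.module_hom_eqI)
  show "module_hom fscale sc (\<lambda>f. ev s (dsubst fscale diff_act t f))"
    using module_hom_compose[OF module_hom_dsubst_diff module_hom_ev] by (simp add: comp_def)
  fix w assume "w \<in> Poly_Mapping.keys f"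
  then have "set w \<subseteq> letters"
    using f by (simp add: free_alg_def)
  then show "ev s (dsubst fscale diff_act t (monom w)) = ev (\<lambda>j. ev s (t j)) (monom w)"
  proof (induction w)
    case Nil
    have "dsubst fscale diff_act t (monom []) = 1"
      unfolding dsubst_def FV.lin_ext_monom by simp
    then show ?case
      by (simp add: monom_Nil ev_one)
  next
    case (Cons x w)
    obtain j b where x: "x = (j, b)" "b \<in> T"
      using Cons.prems B_in_T by (cases x) auto
    have "ev s (env_act fscale diff_act b (t j)) = uact b (ev s (t j))"
      using t by (intro ev_env_act x(2)) auto
    then show ?case
      using Cons by (simp add: x(1) monom_Cons dsubst_diff_mult ev_mult dsubst_diff_gen ev_gen)
  qed
qed (rule module_hom_ev)

text \<open>
  An evaluation is multiplicative and commutes with the action of \<open>U(L)\<close>, and a substitution followed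
  by an evaluation is another evaluation.  Hence each closure property of a \<open>T\<^sub>L\<close>-ideal holds for the
  common kernel of all evaluations.
\<close>

theorem TL_ideal_diff_identities: "TL_ideal L B (diff_identities B sc act)"
  unfolding TL_ideal_def
proof (intro conjI ballI allI impI)
  let ?Id = "diff_identities B sc act"
  have Id: "f \<in> ?Id \<longleftrightarrow> f \<in> diff_polys B \<and> (\<forall>s. ev s f = 0)" for f
    by (simp add: diff_identities_def)
  show "?Id \<subseteq> diff_polys B"
    by (auto simp: Id)
  show "FV.subspace ?Id"
    by (rule FV.subspaceI)
      (simp_all add: Id FV.subspace_0 FV.subspace_add FV.subspace_scale subspace_diff_polys
        module_hom.zero[OF module_hom_ev] module_hom.add[OF module_hom_ev] module_hom.scale[OF module_hom_ev])
  fix f assume f: "f \<in> ?Id"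
  show "p * f \<in> ?Id" "f * p \<in> ?Id" if "p \<in> diff_polys B" for p
    using f that by (simp_all add: Id ev_mult diff_polys_mult_left diff_polys_in_free_alg)
  show "env_act fscale diff_act h f \<in> ?Id" if "h \<in> T" for h
    using f that by (simp add: Id ev_env_act env_act_in_diff_polys uact_zero)
  show "dsubst fscale diff_act t f \<in> ?Id" if "range t \<subseteq> diff_polys B" for t
    using f that by (simp add: Id ev_dsubst dsubst_in_diff_polys diff_polys_in_free_alg)
qed

end

lemma TL_ideal_generated:
  assumes "TL_ideal L B J" "S \<subseteq> J"
  shows "TL_ideal L B (TL_generated L B S)"
  unfolding TL_ideal_def
proof (intro conjI ballI allI impI)
  show "TL_generated L B S \<subseteq> diff_polys B"
    using assms unfolding TL_generated_def TL_ideal_def by blast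
  show "FV.subspace (TL_generated L B S)"
    unfolding TL_generated_def by (rule FV.subspace_Inter) (auto simp: TL_ideal_def)
qed (auto simp: TL_generated_def TL_ideal_def)


section \<open>Independence of characters\<close>

text \<open>
  Dedekind's argument: multiplying a relation by the value of one character and subtracting removes
  that character from the relation.
\<close>

lemma independent_characters:
  fixes \<psi> :: "'i \<Rightarrow> 'm \<Rightarrow> 'a::field"
  assumes "finite A"
    and mult: "\<And>i x y. i \<in> A \<Longrightarrow> \<psi> i (mul x y) = \<psi> i x * \<psi> i y"
    and nonzero: "\<And>i. i \<in> A \<Longrightarrow> \<exists>x. \<psi> i x \<noteq> 0"
    and distinct: "\<And>i j. i \<in> A \<Longrightarrow> j \<in> A \<Longrightarrow> i \<noteq> j \<Longrightarrow> \<exists>x. \<psi> i x \<noteq> \<psi> j x"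
    and relation: "\<And>x. (\<Sum>i\<in>A. c i * \<psi> i x) = 0"
  shows "\<forall>i\<in>A. c i = 0"
  using assms
proof (induction A arbitrary: c)
  case (insert j A)
  have rel: "c j * \<psi> j x + (\<Sum>i\<in>A. c i * \<psi> i x) = 0" for x
    using insert.prems(4)[of x] insert.hyps by simp
  have "\<forall>i\<in>A. c i * (\<psi> i y - \<psi> j y) = 0" for y
  proof (rule insert.IH)
    fix x
    have "(\<Sum>i\<in>A. c i * (\<psi> i y - \<psi> j y) * \<psi> i x)
        = (\<Sum>i\<in>A. c i * (\<psi> i y * \<psi> i x)) - \<psi> j y * (\<Sum>i\<in>A. c i * \<psi> i x)"
      by (simp add: sum_distrib_left sum_subtractf algebra_simps)
    also have "(\<Sum>i\<in>A. c i * (\<psi> i y * \<psi> i x)) = (\<Sum>i\<in>A. c i * \<psi> i (mul y x))"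
      by (rule sum.cong) (simp_all add: insert.prems(1))
    also have "\<dots> = - (c j * (\<psi> j y * \<psi> j x))"
      using rel[of "mul y x"] by (simp add: insert.prems(1) eq_neg_iff_add_eq_0 add.commute)
    also have "(\<Sum>i\<in>A. c i * \<psi> i x) = - (c j * \<psi> j x)"
      using rel[of x] by (simp add: eq_neg_iff_add_eq_0 add.commute)
    finally show "(\<Sum>i\<in>A. c i * (\<psi> i y - \<psi> j y) * \<psi> i x) = 0"
      by simp
  next
    show "\<exists>x. \<psi> i x \<noteq> 0" if "i \<in> A" for i
      using insert.prems(2) that by blast
    show "\<exists>x. \<psi> i x \<noteq> \<psi> k x" if "i \<in> A" "k \<in> A" "i \<noteq> k" for i k
      using insert.prems(3) that by blast
  qed (simp add: insert.prems(1))
  then have A: "c i = 0" if "i \<in> A" for i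
    using insert.prems(3)[of i j] insert.hyps that by (metis insertCI mult_eq_0_iff right_minus_eq)
  obtain x where "\<psi> j x \<noteq> 0"
    using insert.prems(2) by blast
  then have "c j = 0"
    using rel[of x] A by simp
  with A show ?case by simp
qed simp

text \<open>
  Monomials in commuting variables are characters of the monoid of points under pointwise
  multiplication.  Two of them differ at a point with one coordinate \<open>2\<close> and all others \<open>1\<close>, as the
  powers of \<open>2\<close> are distinct in characteristic zero.
\<close>

lemma monomial_functions_independent:
  fixes c :: "nat multiset \<Rightarrow> 'a::field_char_0"
  assumes "finite A" and "\<And>\<alpha>. (\<Sum>M\<in>A. c M * (\<Prod>j\<in>#M. \<alpha> j)) = 0"
  shows "\<forall>M\<in>A. c M = 0"
proof (rule independent_characters[where \<psi> = "\<lambda>M \<alpha>. \<Prod>j\<in>#M. \<alpha> j" and mul = "\<lambda>\<alpha> \<beta> j. \<alpha> j * \<beta> j", OF assms(1)])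
  show "\<exists>\<alpha>. (\<Prod>j\<in>#M. \<alpha> j) \<noteq> (0::'a)" for M
    by (rule exI[of _ "\<lambda>_. 1"]) simp
  fix M N :: "nat multiset" assume "M \<noteq> N"
  then obtain j where j: "count M j \<noteq> count N j"
    by (auto simp: multiset_eq_iff)
  have "(\<Prod>i\<in>#K. if i = j then 2 else 1 :: 'a) = 2 ^ count K j" for K
    by (induction K) simp_all
  moreover have "(2::'a) ^ count M j \<noteq> 2 ^ count N j"
  proof
    assume "(2::'a) ^ count M j = 2 ^ count N j"
    then have "(of_nat (2 ^ count M j) :: 'a) = of_nat (2 ^ count N j)"
      by simp
    then have "(2::nat) ^ count M j = 2 ^ count N j"
      by (simp only: of_nat_eq_iff)
    then show False
      using j by simp
  qed
  ultimately show "\<exists>\<alpha>. (\<Prod>j\<in>#M. \<alpha> j) \<noteq> (\<Prod>j\<in>#N. \<alpha> j :: 'a)"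
    by metis
qed (simp_all add: prod_mset.distrib assms(2))


section \<open>Evaluation in \<open>C\<close>\<close>

instance calg :: (field) comm_ring_1
proof
  fix a b :: "'a calg"
  show "a * b = b * a"
    by (cases a rule: celem_cases; cases b rule: celem_cases) (simp add: algebra_simps)
qed (simp_all add: distrib_right)

definition calg_diag :: "'a::field calg \<Rightarrow> 'a" where "calg_diag a = calg_matrix a $ 1 $ 1"
definition calg_off :: "'a::field calg \<Rightarrow> 'a" where "calg_off a = calg_matrix a $ 1 $ 2"

lemma calg_parts [simp]: "calg_diag (celem \<alpha> \<beta>) = \<alpha>" "calg_off (celem \<alpha> \<beta>) = \<beta>"
  unfolding calg_diag_def calg_off_def by (transfer; simp)+

lemma celem_eta: "celem (calg_diag a) (calg_off a) = a"
  by (cases a rule: celem_cases) simp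

lemma celem_sum: "(\<Sum>i\<in>A. celem (a i) (b i)) = celem (\<Sum>i\<in>A. a i) (\<Sum>i\<in>A. b i)"
  by (induction A rule: infinite_finite_induct) (simp_all add: zero_celem)

text \<open>Since \<open>e\<^sub>1\<^sub>2\<close> squares to zero, only the terms with at most one factor \<open>e\<^sub>1\<^sub>2\<close> survive.\<close>

lemma celem_prod:
  assumes "finite A"
  shows "(\<Prod>i\<in>A. celem (a i) (b i)) = celem (\<Prod>i\<in>A. a i) (\<Sum>i\<in>A. b i * (\<Prod>k\<in>A - {i}. a k))"
  using assms
proof (induction A)
  case (insert x A)
  have "(\<Sum>i\<in>A. b i * (\<Prod>k\<in>insert x A - {i}. a k)) = (\<Sum>i\<in>A. a x * (b i * (\<Prod>k\<in>A - {i}. a k)))"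
  proof (rule sum.cong)
    fix i assume "i \<in> A"
    then have "insert x A - {i} = insert x (A - {i})" "x \<notin> A - {i}"
      using insert.hyps by auto
    then show "b i * (\<Prod>k\<in>insert x A - {i}. a k) = a x * (b i * (\<Prod>k\<in>A - {i}. a k))"
      using insert.hyps by (simp add: mult.left_commute)
  qed simp
  then show ?case
    using insert by (simp add: sum_distrib_left)
qed (simp add: one_celem)

lemma lie_carrier_L_eps: "g \<in> lie_carrier L_eps \<longleftrightarrow> (\<exists>c. g = lie_scale L_eps c eps)"
  by (simp add: L_eps_def)

lemma eps_in_carrier [simp]: "eps \<in> lie_carrier L_eps"
proof -
  have "eps a = cscale 1 (eps a)" for a :: "'a calg"
    by (cases a rule: celem_cases) simp
  then show ?thesis
    by (auto simp: L_eps_def fun_eq_iff)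
qed

locale calg_identities =
  fixes B :: "(('a::field_char_0 calg \<Rightarrow> 'a calg) list \<Rightarrow>\<^sub>0 'a) set"
  assumes B: "env_basis L_eps B"

sublocale calg_identities \<subseteq> diff_poly_rep "L_eps :: ('a, 'a calg \<Rightarrow> 'a calg) lie" cscale "\<lambda>d. d" B
proof -
  interpret L_algebra "L_eps :: ('a, 'a calg \<Rightarrow> 'a calg) lie" cscale "\<lambda>d. d"
    by (rule L_algebra_calg)
  show "diff_poly_rep (L_eps :: ('a, 'a calg \<Rightarrow> 'a calg) lie) cscale (\<lambda>d. d) B"
    by unfold_locales (rule B)
qed

context calg_identities
begin

definition relations where
  "relations = {dvar L_eps B 1 1 * dvar L_eps B 2 1 - dvar L_eps B 2 1 * dvar L_eps B 1 1,
     dvar L_eps B 1 (gen eps) * dvar L_eps B 2 (gen eps),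
     dvar L_eps B 1 (gen eps * gen eps) - dvar L_eps B 1 (gen eps)}"

abbreviation J where "J \<equiv> TL_generated L_eps B relations"
abbreviation Id_C where "Id_C \<equiv> diff_identities B cscale (\<lambda>d. d)"

text \<open>
  The components of \<open>x\<^sub>j\<close> in the eigenspaces of \<open>\<epsilon>\<close> for the eigenvalues \<open>1\<close> and \<open>0\<close>.
\<close>

definition E where "E j = dvar L_eps B j (gen eps)"
definition Y where "Y j = dvar L_eps B j (1 - gen eps)"

lemma exponents_in_T: "gen eps \<in> T" "1 - gen eps \<in> T" "gen eps * gen eps \<in> T" "1 \<in> T"
  by (simp_all add: free_alg_mult FV.subspace_diff[OF subspace_free_alg])

lemma E_Y_in_diff_polys: "j \<ge> 1 \<Longrightarrow> E j \<in> diff_polys B" "j \<ge> 1 \<Longrightarrow> Y j \<in> diff_polys B"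
  unfolding E_def Y_def by (simp_all add: dvar_in_diff_polys exponents_in_T)

lemma uact_exponents [simp]:
  "uact (gen eps) (celem \<alpha> \<beta>) = celem 0 \<beta>" "uact (1 - gen eps) (celem \<alpha> \<beta>) = celem \<alpha> 0"
  "uact 1 a = a" "uact (gen eps * gen eps) (celem \<alpha> \<beta>) = celem 0 \<beta>"
  by (simp_all add: A.env_act_gen A.env_act_one uact_mult exponents_in_T
      module_hom.diff[OF module_hom_uact_exponent])

lemma ev_E: "ev s (E j) = celem 0 (calg_off (s j))" and ev_Y: "ev s (Y j) = celem (calg_diag (s j)) 0"
  by (cases "s j" rule: celem_cases; simp add: E_def Y_def ev_dvar exponents_in_T)+

lemma relations_in_identities: "relations \<subseteq> Id_C"
proof -
  have "ev s r = 0" if r: "r \<in> relations" for r s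
  proof -
    obtain a b c d where s: "s 1 = celem a b" "s 2 = celem c d"
      by (metis celem_cases)
    show ?thesis
      using r by (auto simp: relations_def module_hom.diff[OF module_hom_ev] ev_mult ev_dvar exponents_in_T
          s mult.commute zero_celem)
  qed
  moreover have "r \<in> diff_polys B" if "r \<in> relations" for r
    using that unfolding relations_def
    by (auto intro!: FV.subspace_diff[OF subspace_diff_polys] diff_polys_mult_left diff_polys_in_free_alg
        dvar_in_diff_polys exponents_in_T)
  ultimately show ?thesis
    by (auto simp: diff_identities_def)
qed

lemma TL_ideal_J: "TL_ideal L_eps B J"
  by (rule TL_ideal_generated[OF TL_ideal_diff_identities relations_in_identities])

lemma J_in_identities: "J \<subseteq> Id_C"
  unfolding TL_generated_def using TL_ideal_diff_identities relations_in_identities by blast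

lemma relations_in_J: "relations \<subseteq> J"
  unfolding TL_generated_def by blast

lemma subspace_J: "FV.subspace J"
  and J_mult: "f \<in> J \<Longrightarrow> p \<in> diff_polys B \<Longrightarrow> p * f \<in> J \<and> f * p \<in> J"
  and J_env_act: "f \<in> J \<Longrightarrow> h \<in> T \<Longrightarrow> env_act fscale diff_act h f \<in> J"
  and J_dsubst: "f \<in> J \<Longrightarrow> range s \<subseteq> diff_polys B \<Longrightarrow> dsubst fscale diff_act s f \<in> J"
  using TL_ideal_J unfolding TL_ideal_def by blast+

text \<open>
  The factors in the definition of a \<open>T\<^sub>L\<close>-ideal have no constant terms.  A constant term of \<open>p\<close>
  contributes a multiple of \<open>f\<close>, so arbitrary factors, such as the empty product, are absorbed.
\<close>

lemma J_mult_free_alg: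
  assumes f: "f \<in> J" and p: "p \<in> free_alg letters"
  shows "p * f \<in> J" "f * p \<in> J"
proof -
  have "monom w * f \<in> J \<and> f * monom w \<in> J" if "w \<in> Poly_Mapping.keys p" for w
  proof (cases "w = []")
    case True
    then show ?thesis using f by (simp add: monom_Nil)
  next
    case False
    then have "monom w \<in> diff_polys B"
      using p that by (auto simp: diff_polys_def free_alg_def monom_def)
    then show ?thesis using J_mult[OF f] by blast
  qed
  moreover have "FV.subspace {p. p * f \<in> J}" "FV.subspace {p. f * p \<in> J}"
    by (rule FV.subspaceI; simp add: FV.subspace_0[OF subspace_J] FV.subspace_add[OF subspace_J]
        FV.subspace_scale[OF subspace_J] distrib_left distrib_right flip: fscale_mult_left fscale_mult_right)+
  ultimately show "p * f \<in> J" "f * p \<in> J"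
    using subspace_contains_if_monoms[of "{p. p * f \<in> J}" p] subspace_contains_if_monoms[of "{p. f * p \<in> J}" p]
    by auto
qed

definition cong_J (infix \<open>\<approx>\<close> 50) where "p \<approx> q \<longleftrightarrow> p - q \<in> J"

lemma cong_refl [simp]: "p \<approx> p"
  by (simp add: cong_J_def FV.subspace_0[OF subspace_J])

lemma cong_trans [trans]: "p \<approx> q \<Longrightarrow> q \<approx> r \<Longrightarrow> p \<approx> r"
  using FV.subspace_add[OF subspace_J, of "p - q" "q - r"] by (simp add: cong_J_def)

lemma cong_add: "p \<approx> q \<Longrightarrow> p' \<approx> q' \<Longrightarrow> p + p' \<approx> q + q'"
  using FV.subspace_add[OF subspace_J, of "p - q" "p' - q'"] by (simp add: cong_J_def algebra_simps)

lemma cong_scale: "p \<approx> q \<Longrightarrow> fscale c p \<approx> fscale c q"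
  using FV.subspace_scale[OF subspace_J, of "p - q" c] by (simp add: cong_J_def FV.scale_right_diff_distrib)

lemma cong_mult_left: "p \<approx> q \<Longrightarrow> r \<in> free_alg letters \<Longrightarrow> r * p \<approx> r * q"
  using J_mult_free_alg(1)[of "p - q" r] by (simp add: cong_J_def algebra_simps)

lemma cong_mult_right: "p \<approx> q \<Longrightarrow> r \<in> free_alg letters \<Longrightarrow> p * r \<approx> q * r"
  using J_mult_free_alg(2)[of "p - q" r] by (simp add: cong_J_def algebra_simps)

text \<open>
  Substitute \<open>p, q\<close> for the two variables of the commutator relation.
\<close>

lemma commute_mod_J:
  assumes "p \<in> diff_polys B" "q \<in> diff_polys B"
  shows "p * q \<approx> q * p"
proof -
  let ?s = "\<lambda>j. if j = 1 then p else q"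
  have "dsubst fscale diff_act ?s (dvar L_eps B 1 1 * dvar L_eps B 2 1 - dvar L_eps B 2 1 * dvar L_eps B 1 1) \<in> J"
    using relations_in_J assms by (intro J_dsubst) (auto simp: relations_def)
  then show ?thesis
    by (simp add: cong_J_def module_hom.diff[OF module_hom_dsubst_diff] dsubst_diff_mult dvar_one dsubst_diff_gen
        FV.env_act_one)
qed

lemma E_E_mod_J:
  assumes "i \<ge> 1" "j \<ge> 1"
  shows "E i * E j \<approx> 0"
proof -
  let ?\<tau> = "\<lambda>k. if k = 1 then i else j"
  have "dsubst fscale diff_act (\<lambda>k. dvar L_eps B (?\<tau> k) 1) (dvar L_eps B 1 (gen eps) * dvar L_eps B 2 (gen eps)) \<in> J"
    using relations_in_J assms exponents_in_T
    by (intro J_dsubst) (auto simp: relations_def intro!: dvar_in_diff_polys)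
  then show ?thesis
    by (simp add: cong_J_def E_def dsubst_diff_mult dsubst_rename[of _ ?\<tau>] exponents_in_T)
qed

lemma eps_eps_mod_J:
  assumes "j \<ge> 1"
  shows "dvar L_eps B j (gen eps * gen eps) \<approx> E j"
proof -
  have "dsubst fscale diff_act (\<lambda>k. dvar L_eps B j 1) (dvar L_eps B 1 (gen eps * gen eps) - dvar L_eps B 1 (gen eps)) \<in> J"
    using relations_in_J assms exponents_in_T
    by (intro J_dsubst) (auto simp: relations_def intro!: dvar_in_diff_polys)
  then show ?thesis
    by (simp add: cong_J_def E_def module_hom.diff[OF module_hom_dsubst_diff] dsubst_rename[of _ "\<lambda>_. j"]
        exponents_in_T)
qed

text \<open>
  Modulo \<open>J\<close> every \<open>x\<^sub>j\<^sup>h\<close> is a combination of \<open>Y j\<close> and \<open>E j\<close>, and its coefficients are the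
  eigenvalues of \<open>h\<close> on \<open>C\<close>.
\<close>

definition eigenvalues where
  "eigenvalues h p q \<longleftrightarrow> (\<forall>\<alpha> \<beta>. uact h (celem \<alpha> \<beta>) = celem (p * \<alpha>) (q * \<beta>)) \<and>
     (\<forall>j\<ge>1. dvar L_eps B j h \<approx> fscale p (Y j) + fscale q (E j))"

lemma eigenvalues_one: "eigenvalues 1 1 1"
proof -
  have "Y j + E j = dvar L_eps B j 1" for j
    unfolding Y_def E_def by (simp add: exponents_in_T flip: dvar_add)
  then show ?thesis
    by (simp add: eigenvalues_def FV.scale_one)
qed

text \<open>
  Apply \<open>g = c \<epsilon>\<close> to the congruence for \<open>h\<close>: as \<open>\<epsilon>\<epsilon>\<close> and \<open>\<epsilon>\<close> agree as exponents modulo \<open>J\<close>, it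
  kills \<open>Y j\<close> and multiplies \<open>E j\<close> by \<open>c\<close>.
\<close>

lemma eigenvalues_gen_mult:
  assumes h: "h \<in> T" "eigenvalues h p q" and g: "g = lie_scale L_eps c eps"
  shows "eigenvalues (gen g * h) 0 (c * q)"
proof -
  let ?d = "dvar L_eps B"
  have g_carrier: "g \<in> lie_carrier L_eps"
    unfolding lie_carrier_L_eps g by blast
  have g_T: "gen g \<in> T"
    using g_carrier by simp
  have "gen g - fscale c (gen eps) \<in> env_rels L_eps"
    unfolding env_rels_def g using eps_in_carrier by blast
  then have g_eps: "?d j (gen g * u) = fscale c (?d j (gen eps * u))" if "u \<in> T" for j u
  proof -
    have "gen g * u - fscale c (gen eps * u) \<in> env_ideal L_eps"
      using that \<open>gen g - _ \<in> _\<close> unfolding env_ideal_def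
      by (intro FV.span_base CollectI exI[of _ 1] exI[of _ "gen g - fscale c (gen eps)"] exI[of _ u])
        (simp add: left_diff_distrib fscale_mult_left)
    then show ?thesis
      using that g_T exponents_in_T(1)
      by (simp add: dvar_cong[of "gen g * u" "fscale c (gen eps * u)"] dvar_scale free_alg_mult
          FV.subspace_scale[OF subspace_free_alg])
  qed
  have "?d j (gen g * h) \<approx> fscale 0 (Y j) + fscale (c * q) (E j)" if j: "j \<ge> 1" for j
  proof -
    have "env_act fscale diff_act (gen g) (?d j h - (fscale p (Y j) + fscale q (E j))) \<in> J"
      using h(2) j g_T by (intro J_env_act) (auto simp: eigenvalues_def cong_J_def)
    then have "?d j (gen g * h) \<approx> fscale p (?d j (gen g * (1 - gen eps))) + fscale q (?d j (gen g * gen eps))"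
      using h(1) g_carrier exponents_in_T
      by (simp add: cong_J_def FV.env_act_gen Y_def E_def diff_act_dvar module_hom.diff[OF module_hom_diff_act]
          module_hom.add[OF module_hom_diff_act] module_hom.scale[OF module_hom_diff_act])
    also have "\<dots> \<approx> fscale p (fscale c (E j - E j)) + fscale q (fscale c (E j))"
    proof -
      have "?d j (gen eps * (1 - gen eps)) = E j - ?d j (gen eps * gen eps)"
        by (simp add: right_diff_distrib dvar_diff exponents_in_T E_def)
      also have "\<dots> \<approx> E j - E j"
        using eps_eps_mod_J[OF j] FV.subspace_neg[OF subspace_J] by (fastforce simp: cong_J_def)
      finally show ?thesis
        using eps_eps_mod_J[OF j]
        by (simp only: g_eps exponents_in_T) (intro cong_add cong_scale)
    qed
    finally show ?thesis
      by (simp add: mult.commute)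
  qed
  moreover have "g a = cscale c (eps a)" for a
    by (simp add: g L_eps_def)
  ultimately show ?thesis
    using h g_T by (simp add: eigenvalues_def uact_mult A.env_act_gen)
qed

lemma eigenvalues_exist:
  assumes "h \<in> T"
  shows "\<exists>p q. eigenvalues h p q"
proof -
  have word: "\<exists>p q. eigenvalues (monom w) p q" if "set w \<subseteq> lie_carrier L_eps" for w
    using that
  proof (induction w)
    case Nil
    then show ?case using eigenvalues_one by (auto simp: monom_Nil)
  next
    case (Cons g w)
    then show ?case
      using eigenvalues_gen_mult[of "monom w" _ _ g] by (fastforce simp: monom_Cons lie_carrier_L_eps)
  qed
  have "FV.subspace {h \<in> T. \<exists>p q. eigenvalues h p q}"
  proof (rule FV.subspaceI)
    have "eigenvalues 0 0 0"
      by (simp add: eigenvalues_def dvar_zero zero_celem module_hom.zero[OF module_hom_uact_exponent])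
    then show "0 \<in> {h \<in> T. \<exists>p q. eigenvalues h p q}"
      by (auto simp: FV.subspace_0[OF subspace_free_alg])
    fix h h' c assume h: "h \<in> {h \<in> T. \<exists>p q. eigenvalues h p q}"
    then obtain p q where pq: "eigenvalues h p q" "h \<in> T"
      by blast
    have "fscale c (dvar L_eps B j h) \<approx> fscale (c * p) (Y j) + fscale (c * q) (E j)" if "j \<ge> 1" for j
      using cong_scale[of "dvar L_eps B j h" _ c] pq that
      by (fastforce simp: eigenvalues_def FV.scale_right_distrib)
    then have "eigenvalues (fscale c h) (c * p) (c * q)"
      using pq by (simp add: eigenvalues_def dvar_scale module_hom.scale[OF module_hom_uact_exponent])
    then show "fscale c h \<in> {h \<in> T. \<exists>p q. eigenvalues h p q}"
      using pq(2) FV.subspace_scale[OF subspace_free_alg] by blast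
    assume "h' \<in> {h \<in> T. \<exists>p q. eigenvalues h p q}"
    then obtain p' q' where pq': "eigenvalues h' p' q'" "h' \<in> T"
      by blast
    have "dvar L_eps B j h + dvar L_eps B j h' \<approx> fscale (p + p') (Y j) + fscale (q + q') (E j)" if "j \<ge> 1" for j
      using cong_add[of "dvar L_eps B j h" _ "dvar L_eps B j h'"] pq pq' that
      by (fastforce simp: eigenvalues_def FV.scale_left_distrib algebra_simps)
    then have "eigenvalues (h + h') (p + p') (q + q')"
      using pq pq'
      by (simp add: eigenvalues_def dvar_add module_hom.add[OF module_hom_uact_exponent] distrib_right)
    then show "h + h' \<in> {h \<in> T. \<exists>p q. eigenvalues h p q}"
      using pq(2) pq'(2) FV.subspace_add[OF subspace_free_alg] by blast
  qed
  then have "h \<in> {h \<in> T. \<exists>p q. eigenvalues h p q}"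
  proof (rule subspace_contains_if_monoms)
    fix w assume "w \<in> Poly_Mapping.keys h"
    then have "set w \<subseteq> lie_carrier L_eps"
      using assms by (simp add: free_alg_def)
    then show "monom w \<in> {h \<in> T. \<exists>p q. eigenvalues h p q}"
      using word by simp
  qed
  then show ?thesis by blast
qed

end


context calg_identities
begin

section \<open>Normal forms\<close>

text \<open>
  The key \<open>(None, M)\<close> stands for the monomial \<open>Y\<^sup>M\<close> and \<open>(Some j, M)\<close> for \<open>E j * Y\<^sup>M\<close>; the factors
  commute only modulo \<open>J\<close>, so those of \<open>Y\<^sup>M\<close> are arranged in increasing order.
\<close>

definition normal_monomial :: "nat option \<times> nat multiset \<Rightarrow> _" where
  "normal_monomial = (\<lambda>(e, M). (case e of None \<Rightarrow> 1 | Some j \<Rightarrow> E j) *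
     prod_list (map Y (sorted_list_of_multiset M)))"

definition normal_keys :: "(nat option \<times> nat multiset) set" where
  "normal_keys = {(e, M). (e = None \<longrightarrow> M \<noteq> {#}) \<and> set_mset M \<subseteq> {1..} \<and> set_option e \<subseteq> {1..}}"

lemma E_Y_in_free_alg: "j \<ge> 1 \<Longrightarrow> E j \<in> free_alg letters" "j \<ge> 1 \<Longrightarrow> Y j \<in> free_alg letters"
  by (simp_all add: diff_polys_in_free_alg E_Y_in_diff_polys)

lemma Y_prod_in_free_alg: "set xs \<subseteq> {1..} \<Longrightarrow> prod_list (map Y xs) \<in> free_alg letters"
  by (induction xs) (simp_all add: free_alg_mult E_Y_in_free_alg)

lemma Y_insort:
  assumes "j \<ge> 1" "set xs \<subseteq> {1..}"
  shows "Y j * prod_list (map Y xs) \<approx> prod_list (map Y (insort j xs))"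
  using assms(2)
proof (induction xs)
  case (Cons a xs)
  show ?case
  proof (cases "j \<le> a")
    case False
    have "Y j * (Y a * prod_list (map Y xs)) = (Y j * Y a) * prod_list (map Y xs)"
      by (simp add: mult.assoc)
    also have "\<dots> \<approx> (Y a * Y j) * prod_list (map Y xs)"
      using Cons.prems assms(1)
      by (intro cong_mult_right commute_mod_J E_Y_in_diff_polys Y_prod_in_free_alg) auto
    also have "\<dots> = Y a * (Y j * prod_list (map Y xs))"
      by (simp add: mult.assoc)
    also have "\<dots> \<approx> Y a * prod_list (map Y (insort j xs))"
      using Cons by (intro cong_mult_left E_Y_in_free_alg) auto
    finally show ?thesis
      using False by simp
  qed simp
qed simp

definition reducible where
  "reducible = {f. \<exists>c. Poly_Mapping.keys c \<subseteq> normal_keys \<and> f \<approx> lin_ext fscale normal_monomial c}"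

lemma reducible_cong: "f \<approx> g \<Longrightarrow> g \<in> reducible \<Longrightarrow> f \<in> reducible"
  unfolding reducible_def using cong_trans by blast

lemma subspace_reducible: "FV.subspace reducible"
proof (rule FV.subspaceI)
  show "0 \<in> reducible"
    unfolding reducible_def by (intro CollectI exI[of _ 0]) (simp add: FV.lin_ext_zero)
  fix f g c assume f: "f \<in> reducible"
  then obtain p where p: "Poly_Mapping.keys p \<subseteq> normal_keys" "f \<approx> lin_ext fscale normal_monomial p"
    by (auto simp: reducible_def)
  have "Poly_Mapping.keys (fscale c p) \<subseteq> normal_keys"
    using p(1) by (auto simp: in_keys_iff)
  then show "fscale c f \<in> reducible"
    unfolding reducible_def using cong_scale[OF p(2), of c] by (auto simp: FV.lin_ext_scale)
  assume "g \<in> reducible"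
  then obtain q where q: "Poly_Mapping.keys q \<subseteq> normal_keys" "g \<approx> lin_ext fscale normal_monomial q"
    by (auto simp: reducible_def)
  have "Poly_Mapping.keys (p + q) \<subseteq> normal_keys"
    using p(1) q(1) keys_add[of p q] by blast
  then show "f + g \<in> reducible"
    unfolding reducible_def using cong_add[OF p(2) q(2)] by (auto simp: FV.lin_ext_add)
qed

lemma normal_monomial_reducible: "k \<in> normal_keys \<Longrightarrow> normal_monomial k \<in> reducible"
  unfolding reducible_def
  by (intro CollectI exI[of _ "monom k"]) (simp add: FV.lin_ext_monom, simp add: monom_def)

lemma reducible_mult:
  assumes p: "p \<in> free_alg letters" and step: "\<And>k. k \<in> normal_keys \<Longrightarrow> p * normal_monomial k \<in> reducible"
    and f: "f \<in> reducible"
  shows "p * f \<in> reducible"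
proof -
  obtain c where c: "Poly_Mapping.keys c \<subseteq> normal_keys" "f \<approx> lin_ext fscale normal_monomial c"
    using f by (auto simp: reducible_def)
  have "p * lin_ext fscale normal_monomial c = lin_ext fscale (\<lambda>k. p * normal_monomial k) c"
    by (rule lin_ext_hom[OF module_hom_left_mult])
  also have "\<dots> \<in> reducible"
    using c(1) step by (intro FV.lin_ext_in_subspace[OF subspace_reducible]) auto
  finally show ?thesis
    by (rule reducible_cong[OF cong_mult_left[OF c(2) p]])
qed

lemma Y_mult_reducible:
  assumes "j \<ge> 1" "f \<in> reducible"
  shows "Y j * f \<in> reducible"
proof (rule reducible_mult[OF E_Y_in_free_alg(2)[OF assms(1)] _ assms(2)])
  fix k assume k: "k \<in> normal_keys"
  obtain e M where kM: "k = (e, M)" by (cases k)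
  have M: "set (sorted_list_of_multiset M) \<subseteq> {1..}"
    using k by (simp add: kM normal_keys_def)
  have key: "(e, add_mset j M) \<in> normal_keys"
    using k assms(1) by (simp add: kM normal_keys_def)
  have "Y j * normal_monomial k \<approx> normal_monomial (e, add_mset j M)"
  proof (cases e)
    case None
    then show ?thesis
      using Y_insort[OF assms(1) M] by (simp add: kM normal_monomial_def)
  next
    case (Some i)
    then have i: "i \<ge> 1"
      using k by (simp add: kM normal_keys_def)
    let ?R = "prod_list (map Y (sorted_list_of_multiset M))"
    have "Y j * (E i * ?R) = (Y j * E i) * ?R"
      by (simp add: mult.assoc)
    also have "\<dots> \<approx> (E i * Y j) * ?R"
      by (intro cong_mult_right commute_mod_J E_Y_in_diff_polys Y_prod_in_free_alg assms(1) i M)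
    also have "\<dots> = E i * (Y j * ?R)"
      by (simp add: mult.assoc)
    also have "\<dots> \<approx> E i * prod_list (map Y (insort j (sorted_list_of_multiset M)))"
      by (intro cong_mult_left Y_insort E_Y_in_free_alg assms(1) i M)
    finally show ?thesis
      by (simp add: kM Some normal_monomial_def)
  qed
  then show "Y j * normal_monomial k \<in> reducible"
    by (rule reducible_cong) (rule normal_monomial_reducible[OF key])
qed

lemma E_mult_reducible:
  assumes "j \<ge> 1" "f \<in> reducible"
  shows "E j * f \<in> reducible"
proof (rule reducible_mult[OF E_Y_in_free_alg(1)[OF assms(1)] _ assms(2)])
  fix k assume k: "k \<in> normal_keys"
  obtain e M where kM: "k = (e, M)" by (cases k)
  show "E j * normal_monomial k \<in> reducible"
  proof (cases e)
    case None
    have "E j * normal_monomial k = normal_monomial (Some j, M)"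
      by (simp add: kM None normal_monomial_def)
    moreover have "(Some j, M) \<in> normal_keys"
      using k assms(1) by (simp add: kM normal_keys_def)
    ultimately show ?thesis
      by (simp add: normal_monomial_reducible)
  next
    case (Some i)
    have i: "i \<ge> 1" and M: "set (sorted_list_of_multiset M) \<subseteq> {1..}"
      using k by (simp_all add: kM Some normal_keys_def)
    have "E j * normal_monomial k = (E j * E i) * prod_list (map Y (sorted_list_of_multiset M))"
      by (simp add: kM Some normal_monomial_def mult.assoc)
    also have "\<dots> \<approx> 0 * prod_list (map Y (sorted_list_of_multiset M))"
      by (intro cong_mult_right E_E_mod_J Y_prod_in_free_alg assms(1) i M)
    finally show ?thesis
      by (rule reducible_cong) (simp add: FV.subspace_0[OF subspace_reducible])
  qed
qed

text \<open>
  Multiplying a normal form by a letter \<open>p Y\<^sub>j + q E\<^sub>j\<close> gives a combination of normal forms, so the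
  words are reduced one letter at a time from the right.
\<close>

lemma diff_polys_reducible:
  assumes "f \<in> diff_polys B"
  shows "f \<in> reducible"
proof (rule subspace_contains_if_monoms[OF subspace_reducible])
  fix w assume "w \<in> Poly_Mapping.keys f"
  then have "w \<noteq> []" "set w \<subseteq> letters"
    using assms by (auto simp: diff_polys_def)
  then show "monom w \<in> reducible"
  proof (induction w rule: list_nonempty_induct)
    case (single x)
    obtain j b where x: "x = (j, b)" "j \<ge> 1" "b \<in> B"
      using single by (cases x) auto
    obtain p q where pq: "eigenvalues b p q"
      using eigenvalues_exist[OF B_in_T[OF x(3)]] by blast
    have "normal_monomial (None, {#j#}) \<in> reducible" "normal_monomial (Some j, {#}) \<in> reducible"
      using x(2) by (simp_all add: normal_monomial_reducible normal_keys_def)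
    then have "Y j \<in> reducible" "E j \<in> reducible"
      by (simp_all add: normal_monomial_def)
    then have "fscale p (Y j) + fscale q (E j) \<in> reducible"
      by (intro FV.subspace_add[OF subspace_reducible] FV.subspace_scale[OF subspace_reducible])
    moreover have "monom [x] \<approx> fscale p (Y j) + fscale q (E j)"
      using pq x by (simp add: eigenvalues_def dvar_basis gen_def)
    ultimately show ?case
      by (rule reducible_cong[rotated])
  next
    case (cons x w)
    obtain j b where x: "x = (j, b)" "j \<ge> 1" "b \<in> B"
      using cons.prems by (cases x) auto
    obtain p q where pq: "eigenvalues b p q"
      using eigenvalues_exist[OF B_in_T[OF x(3)]] by blast
    have "monom w \<in> reducible"
      using cons by simp
    then have "fscale p (Y j * monom w) + fscale q (E j * monom w) \<in> reducible"
      using x(2) by (intro FV.subspace_add[OF subspace_reducible] FV.subspace_scale[OF subspace_reducible]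
          Y_mult_reducible E_mult_reducible)
    moreover have "gen x * monom w \<approx> (fscale p (Y j) + fscale q (E j)) * monom w"
      using pq x cons.prems by (intro cong_mult_right) (simp_all add: eigenvalues_def dvar_basis)
    ultimately show ?case
      unfolding monom_Cons by (elim reducible_cong[rotated]) (simp add: distrib_right flip: fscale_mult_left)
  qed
qed

lemma ev_normal_monomial:
  "ev s (normal_monomial (e, M)) =
    (case e of None \<Rightarrow> celem (\<Prod>i\<in>#M. calg_diag (s i)) 0
     | Some j \<Rightarrow> celem 0 (calg_off (s j) * (\<Prod>i\<in>#M. calg_diag (s i))))"
proof -
  have "ev s (prod_list (map Y xs)) = celem (prod_list (map (\<lambda>i. calg_diag (s i)) xs)) 0" for xs
    by (induction xs) (simp_all add: ev_one ev_mult ev_Y one_celem)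
  moreover have "prod_list (map (\<lambda>i. calg_diag (s i)) (sorted_list_of_multiset M)) = (\<Prod>i\<in>#M. calg_diag (s i))"
    by (simp flip: prod_mset_prod_list)
  ultimately show ?thesis
    by (cases e) (simp_all add: normal_monomial_def ev_mult ev_E)
qed

lemma module_hom_calg_parts:
  "module_hom cscale (*) (calg_diag :: 'a calg \<Rightarrow> 'a)" "module_hom cscale (*) (calg_off :: 'a calg \<Rightarrow> 'a)"
proof -
  have "calg_diag (a + b) = calg_diag a + calg_diag b" "calg_off (a + b) = calg_off a + calg_off b"
    "calg_diag (cscale c a) = c * calg_diag a" "calg_off (cscale c a) = c * calg_off a" for a b :: "'a calg" and c
    by (cases a rule: celem_cases; cases b rule: celem_cases; simp)+
  then show "module_hom cscale (*) (calg_diag :: 'a calg \<Rightarrow> 'a)" "module_hom cscale (*) (calg_off :: 'a calg \<Rightarrow> 'a)"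
    by (unfold_locales; simp add: algebra_simps)+
qed

text \<open>
  The entries of the value of a normal form at \<open>celem (\<alpha> j) (\<beta> j)\<close> are \<open>\<Sum> c\<^sub>M \<alpha>\<^sup>M\<close> and
  \<open>\<Sum> d\<^sub>j\<^sub>,\<^sub>M \<beta>\<^sub>j \<alpha>\<^sup>M\<close>; letting \<open>\<beta>\<close> run through the unit vectors separates the indices \<open>j\<close>.
\<close>

lemma normal_form_identity_zero:
  assumes zero: "\<And>s. ev s (lin_ext fscale normal_monomial c) = 0"
  shows "c = 0"
proof (rule poly_mapping_eqI)
  fix k :: "nat option \<times> nat multiset"
  obtain e M where k: "k = (e, M)" by (cases k)
  let ?K = "Poly_Mapping.keys c"
  define A where "A = {M. (e, M) \<in> ?K}"
  have fin: "finite A"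
    unfolding A_def by (rule finite_subset[of _ "snd ` ?K"]) force+
  have "(\<Sum>M\<in>A. Poly_Mapping.lookup c (e, M) * (\<Prod>i\<in>#M. \<alpha> i)) = 0" for \<alpha>
  proof -
    define s where "s i = celem (\<alpha> i) (if e = Some i then 1 else 0)" for i
    define part :: "'a calg \<Rightarrow> 'a" where "part = (case e of None \<Rightarrow> calg_diag | Some j \<Rightarrow> calg_off)"
    interpret part: module_hom cscale "(*)" part
      by (cases e) (simp_all add: part_def module_hom_calg_parts)
    have "part (ev s (lin_ext fscale normal_monomial c))
        = (\<Sum>k\<in>?K. Poly_Mapping.lookup c k * part (ev s (normal_monomial k)))"
      unfolding lin_ext_hom[OF module_hom_ev] by (simp add: lin_ext_def part.sum part.scale)
    also have "\<dots> = (\<Sum>k\<in>?K. if fst k = e then Poly_Mapping.lookup c k * (\<Prod>i\<in>#snd k. \<alpha> i) else 0)"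
      by (rule sum.cong)
        (auto simp: part_def s_def ev_normal_monomial zero_celem split: option.splits)
    also have "\<dots> = (\<Sum>k\<in>Pair e ` A. Poly_Mapping.lookup c k * (\<Prod>i\<in>#snd k. \<alpha> i))"
      by (rule sum.mono_neutral_cong_right) (auto simp: A_def)
    also have "\<dots> = (\<Sum>M\<in>A. Poly_Mapping.lookup c (e, M) * (\<Prod>i\<in>#M. \<alpha> i))"
      by (simp add: sum.reindex inj_on_def)
    finally show ?thesis
      by (cases e) (simp_all add: zero part_def zero_celem)
  qed
  then have "\<forall>M\<in>A. Poly_Mapping.lookup c (e, M) = 0"
    by (rule monomial_functions_independent[OF fin])
  then show "Poly_Mapping.lookup c k = Poly_Mapping.lookup 0 k"
    by (cases "k \<in> ?K") (auto simp: A_def k in_keys_iff)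
qed

theorem identities_eq_generated: "Id_C = J"
proof (rule subset_antisym[OF subsetI J_in_identities])
  fix f assume f: "f \<in> Id_C"
  then have "f \<in> reducible"
    by (simp add: diff_identities_def diff_polys_reducible)
  then obtain c where c: "f \<approx> lin_ext fscale normal_monomial c"
    by (auto simp: reducible_def)
  have "ev s (lin_ext fscale normal_monomial c) = 0" for s
  proof -
    have "ev s (f - lin_ext fscale normal_monomial c) = 0" "ev s f = 0"
      using c J_in_identities f by (auto simp: cong_J_def diff_identities_def)
    then show ?thesis
      by (simp add: module_hom.diff[OF module_hom_ev])
  qed
  then have "c = 0"
    by (rule normal_form_identity_zero)
  then show "f \<in> J"
    using c by (simp add: cong_J_def FV.lin_ext_zero)
qed


section \<open>Multilinear polynomials\<close>

lemma dvar_prod_in_span: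
  assumes "distinct xs" "\<And>i. i \<in> set xs \<Longrightarrow> h i \<in> T"
  shows "prod_list (map (\<lambda>i. dvar L_eps B i (h i)) xs)
    \<in> FV.span {monom (map (\<lambda>i. (i, b i)) xs) | b. \<forall>i\<in>set xs. b i \<in> B}"
  using assms
proof (induction xs)
  case Nil
  show ?case
    by (rule FV.span_base) (simp add: monom_Nil)
next
  case (Cons x xs)
  let ?G = "{monom (map (\<lambda>i. (i, b i)) xs) | b. \<forall>i\<in>set xs. b i \<in> B}"
  let ?G' = "{monom (map (\<lambda>i. (i, b i)) (x # xs)) | b. \<forall>i\<in>set (x # xs). b i \<in> B}"
  have step: "gen (x, b') * f \<in> FV.span ?G'" if b': "b' \<in> B" and f: "f \<in> FV.span ?G" for b' f
    using f
  proof (induction rule: FV.span_induct)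
    case base
    show ?case
      by (rule FV.subspaceI)
        (simp_all only: mem_Collect_eq mult_zero_right distrib_left fscale_mult_right[symmetric]
          FV.span_zero FV.span_add FV.span_scale)
  next
    case (step f)
    then obtain b where b: "f = monom (map (\<lambda>i. (i, b i)) xs)" "\<forall>i\<in>set xs. b i \<in> B"
      by blast
    have "map (\<lambda>i. (i, (b(x := b')) i)) (x # xs) = (x, b') # map (\<lambda>i. (i, b i)) xs"
      using Cons.prems(1) by auto
    then have "gen (x, b') * f = monom (map (\<lambda>i. (i, (b(x := b')) i)) (x # xs))"
      by (simp only: b(1) monom_Cons)
    then show ?case
      using b(2) b' by (intro FV.span_base CollectI exI[of _ "b(x := b')"]) auto
  qed
  obtain A where A: "finite A" "A \<subseteq> B" "h x - (\<Sum>b\<in>A. fscale (coord (h x) b) b) \<in> env_ideal L_eps"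
    and dvar_h: "\<And>j. dvar L_eps B j (h x) = (\<Sum>b\<in>A. fscale (coord (h x) b) (gen (j, b)))"
    by (rule basis_expansion[OF Cons.prems(2)[of x]], simp, rule that)
  have IH: "prod_list (map (\<lambda>i. dvar L_eps B i (h i)) xs) \<in> FV.span ?G"
    using Cons by simp
  have expand: "prod_list (map (\<lambda>i. dvar L_eps B i (h i)) (x # xs))
      = (\<Sum>b\<in>A. fscale (coord (h x) b) (gen (x, b) * prod_list (map (\<lambda>i. dvar L_eps B i (h i)) xs)))"
    by (simp add: dvar_h sum_distrib_right fscale_mult_left)
  show ?case
    unfolding expand by (intro FV.span_sum FV.span_scale step[OF subsetD[OF A(2)]] IH)
qed

lemma dvar_prod_multilin:
  assumes "\<And>i. h i \<in> T"
  shows "prod_list (map (\<lambda>i. dvar L_eps B i (h i)) [1..<n + 1]) \<in> multilin B n"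
proof -
  have subset: "{monom (map (\<lambda>i. (i, b i)) [1..<n + 1]) | b. \<forall>i\<in>set [1..<n + 1]. b i \<in> B}
      \<subseteq> {monom (map (\<lambda>i. (\<sigma> i, h i)) [1..<n + 1]) | \<sigma> h. \<sigma> permutes {1..n} \<and> (\<forall>i\<in>{1..n}. h i \<in> B)}"
  proof safe
    fix b assume "\<forall>i\<in>set [1..<n + 1]. b i \<in> B"
    then show "\<exists>\<sigma> h. monom (map (\<lambda>i. (i, b i)) [1..<n + 1]) = monom (map (\<lambda>i. (\<sigma> i, h i)) [1..<n + 1])
        \<and> \<sigma> permutes {1..n} \<and> (\<forall>i\<in>{1..n}. h i \<in> B)"
      by (intro exI[of _ id] exI[of _ b]) (auto simp: permutes_id)
  qed
  show ?thesis
    unfolding multilin_def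
    by (rule subsetD[OF FV.span_mono[OF subset] dvar_prod_in_span]) (simp_all add: assms)
qed

lemma multilin_in_diff_polys:
  assumes "n \<ge> 1"
  shows "multilin B n \<subseteq> diff_polys B"
  unfolding multilin_def
proof (rule FV.span_minimal[OF _ subspace_diff_polys], safe)
  fix \<sigma> :: "nat \<Rightarrow> nat" and h :: "nat \<Rightarrow> _"
  assume "\<sigma> permutes {1..n}" "\<forall>i\<in>{1..n}. h i \<in> B"
  then show "monom (map (\<lambda>i. (\<sigma> i, h i)) [1..<n + 1]) \<in> diff_polys B"
    using assms permutes_in_image[of \<sigma> "{1..n}"] by (fastforce simp: diff_polys_def monom_def)
qed

lemma prod_list_interval: "prod_list (map f [1..<n + 1]) = (\<Prod>i\<in>{1..n}. f i :: 'b::comm_monoid_mult)"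
  using prod.distinct_set_conv_list[OF distinct_upt, of f 1 "Suc n"]
  by (simp only: set_upt atLeastLessThanSuc_atLeastAtMost Suc_eq_plus1[symmetric])

text \<open>
  In a multilinear monomial the letter with index \<open>i\<close> takes a value \<open>celem (p \<alpha>\<^sub>i) (q \<beta>\<^sub>i)\<close>, and in
  the product at most one second component is selected.  So modulo the identities a multilinear
  polynomial is given by the \<open>n + 1\<close> numbers \<open>a, d 1, \<dots>, d n\<close>.
\<close>

lemma ev_multilin:
  assumes "x \<in> multilin B n"
  shows "\<exists>a d. \<forall>\<alpha> \<beta>. ev (\<lambda>i. celem (\<alpha> i) (\<beta> i)) x =
    celem (a * (\<Prod>i=1..n. \<alpha> i)) (\<Sum>k=1..n. d k * \<beta> k * (\<Prod>i\<in>{1..n} - {k}. \<alpha> i))"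
  using assms unfolding multilin_def
proof (induction rule: FV.span_induct)
  case base
  show ?case
  proof (rule FV.subspaceI, unfold mem_Collect_eq)
    show "\<exists>a d. \<forall>\<alpha> \<beta>. ev (\<lambda>i. celem (\<alpha> i) (\<beta> i)) 0 =
        celem (a * (\<Prod>i=1..n. \<alpha> i)) (\<Sum>k=1..n. d k * \<beta> k * (\<Prod>i\<in>{1..n} - {k}. \<alpha> i))"
      by (rule exI[of _ 0], rule exI[of _ "\<lambda>_. 0"]) (simp add: module_hom.zero[OF module_hom_ev] zero_celem)
    fix x y c
    assume "\<exists>a d. \<forall>\<alpha> \<beta>. ev (\<lambda>i. celem (\<alpha> i) (\<beta> i)) x =
        celem (a * (\<Prod>i=1..n. \<alpha> i)) (\<Sum>k=1..n. d k * \<beta> k * (\<Prod>i\<in>{1..n} - {k}. \<alpha> i))"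
    then obtain a d where x: "\<And>\<alpha> \<beta>. ev (\<lambda>i. celem (\<alpha> i) (\<beta> i)) x =
        celem (a * (\<Prod>i=1..n. \<alpha> i)) (\<Sum>k=1..n. d k * \<beta> k * (\<Prod>i\<in>{1..n} - {k}. \<alpha> i))"
      by blast
    show "\<exists>a d. \<forall>\<alpha> \<beta>. ev (\<lambda>i. celem (\<alpha> i) (\<beta> i)) (fscale c x) =
        celem (a * (\<Prod>i=1..n. \<alpha> i)) (\<Sum>k=1..n. d k * \<beta> k * (\<Prod>i\<in>{1..n} - {k}. \<alpha> i))"
      by (rule exI[of _ "c * a"], rule exI[of _ "\<lambda>k. c * d k"])
        (simp add: module_hom.scale[OF module_hom_ev] x sum_distrib_left mult.assoc)
    assume "\<exists>a d. \<forall>\<alpha> \<beta>. ev (\<lambda>i. celem (\<alpha> i) (\<beta> i)) y =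
        celem (a * (\<Prod>i=1..n. \<alpha> i)) (\<Sum>k=1..n. d k * \<beta> k * (\<Prod>i\<in>{1..n} - {k}. \<alpha> i))"
    then obtain a' d' where y: "\<And>\<alpha> \<beta>. ev (\<lambda>i. celem (\<alpha> i) (\<beta> i)) y =
        celem (a' * (\<Prod>i=1..n. \<alpha> i)) (\<Sum>k=1..n. d' k * \<beta> k * (\<Prod>i\<in>{1..n} - {k}. \<alpha> i))"
      by blast
    show "\<exists>a d. \<forall>\<alpha> \<beta>. ev (\<lambda>i. celem (\<alpha> i) (\<beta> i)) (x + y) =
        celem (a * (\<Prod>i=1..n. \<alpha> i)) (\<Sum>k=1..n. d k * \<beta> k * (\<Prod>i\<in>{1..n} - {k}. \<alpha> i))"
      by (rule exI[of _ "a + a'"], rule exI[of _ "\<lambda>k. d k + d' k"])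
        (simp add: module_hom.add[OF module_hom_ev] x y sum.distrib distrib_right)
  qed
next
  case (step x)
  then obtain \<sigma> h where x: "x = monom (map (\<lambda>i. (\<sigma> i, h i)) [1..<n + 1])"
    and \<sigma>: "\<sigma> permutes {1..n}" and h: "\<forall>i\<in>{1..n}. h i \<in> B"
    by blast
  have "\<forall>b\<in>B. \<exists>p q. eigenvalues b p q"
    using B_in_T eigenvalues_exist by blast
  then obtain P Q where PQ: "\<And>b. b \<in> B \<Longrightarrow> eigenvalues b (P b) (Q b)"
    by metis
  let ?g = "\<lambda>i. h (inv \<sigma> i)"
  have "ev (\<lambda>i. celem (\<alpha> i) (\<beta> i)) x = celem ((\<Prod>i=1..n. P (?g i)) * (\<Prod>i=1..n. \<alpha> i))
      (\<Sum>k=1..n. (Q (?g k) * (\<Prod>i\<in>{1..n} - {k}. P (?g i))) * \<beta> k * (\<Prod>i\<in>{1..n} - {k}. \<alpha> i))" for \<alpha> \<beta>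
  proof -
    let ?s = "\<lambda>i. celem (\<alpha> i) (\<beta> i)"
    have "ev ?s x = prod_list (map (\<lambda>i. uact (h i) (?s (\<sigma> i))) [1..<n + 1])"
      by (simp add: x dsubst_def A.lin_ext_monom comp_def)
    also have "\<dots> = (\<Prod>i=1..n. uact (h i) (?s (\<sigma> i)))"
      by (rule prod_list_interval)
    also have "\<dots> = (\<Prod>i=1..n. celem (P (h i) * \<alpha> (\<sigma> i)) (Q (h i) * \<beta> (\<sigma> i)))"
      using h PQ by (intro prod.cong) (auto simp: eigenvalues_def)
    also have "\<dots> = (\<Prod>i=1..n. celem (P (?g i) * \<alpha> i) (Q (?g i) * \<beta> i))"
      by (subst prod.permute[OF \<sigma>]) (simp add: comp_def permutes_inverses(2)[OF \<sigma>])
    also have "\<dots> = celem (\<Prod>i=1..n. P (?g i) * \<alpha> i)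
        (\<Sum>k=1..n. Q (?g k) * \<beta> k * (\<Prod>i\<in>{1..n} - {k}. P (?g i) * \<alpha> i))"
      by (rule celem_prod) simp
    finally show ?thesis
      by (simp add: prod.distrib mult_ac)
  qed
  then show ?case
    by (intro exI[of _ "\<Prod>i=1..n. P (?g i)"] exI[of _ "\<lambda>k. Q (?g k) * (\<Prod>i\<in>{1..n} - {k}. P (?g i))"]) simp
qed

text \<open>
  For \<open>k = 0\<close>, which is not the index of a variable, this is \<open>Y\<^sub>1 \<cdots> Y\<^sub>n\<close>; otherwise the factor
  \<open>Y\<^sub>k\<close> is replaced by \<open>E\<^sub>k\<close>.
\<close>

definition basis_poly :: "nat \<Rightarrow> nat \<Rightarrow> ('a, 'a calg \<Rightarrow> 'a calg) dpoly" where
  "basis_poly n k = prod_list (map (\<lambda>i. dvar L_eps B i (if i = k then gen eps else 1 - gen eps)) [1..<n + 1])"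

lemma ev_basis_poly:
  "ev (\<lambda>i. celem (\<alpha> i) (\<beta> i)) (basis_poly n k) =
    (if k \<in> {1..n} then celem 0 (\<beta> k * (\<Prod>i\<in>{1..n} - {k}. \<alpha> i)) else celem (\<Prod>i=1..n. \<alpha> i) 0)"
proof -
  let ?s = "\<lambda>i. celem (\<alpha> i) (\<beta> i)"
  have "ev ?s (prod_list fs) = prod_list (map (ev ?s) fs)" for fs
    by (induction fs) (simp_all add: ev_one ev_mult)
  then have "ev ?s (basis_poly n k)
      = prod_list (map (\<lambda>i. ev ?s (dvar L_eps B i (if i = k then gen eps else 1 - gen eps))) [1..<n + 1])"
    by (simp add: basis_poly_def comp_def)
  also have "\<dots> = (\<Prod>i=1..n. ev ?s (dvar L_eps B i (if i = k then gen eps else 1 - gen eps)))"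
    by (rule prod_list_interval)
  also have "\<dots> = (\<Prod>i=1..n. if i = k then celem 0 (\<beta> i) else celem (\<alpha> i) 0)"
    by (rule prod.cong) (simp_all add: ev_dvar exponents_in_T)
  finally have ev: "ev ?s (basis_poly n k) = \<dots>" .
  have Y_part: "(\<Prod>i\<in>A. celem (\<alpha> i) 0) = celem (\<Prod>i\<in>A. \<alpha> i) 0" if "finite A" for A
    using celem_prod[OF that, of \<alpha> "\<lambda>_. 0"] by simp
  show ?thesis
  proof (cases "k \<in> {1..n}")
    case True
    then have "(\<Prod>i=1..n. if i = k then celem 0 (\<beta> i) else celem (\<alpha> i) 0)
        = celem 0 (\<beta> k) * (\<Prod>i\<in>{1..n} - {k}. celem (\<alpha> i) 0)"
      by (subst prod.remove[of _ k]) auto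
    then show ?thesis
      using True by (simp add: ev Y_part)
  next
    case False
    then have "(\<Prod>i=1..n. if i = k then celem 0 (\<beta> i) else celem (\<alpha> i) 0) = (\<Prod>i=1..n. celem (\<alpha> i) 0)"
      by (intro prod.cong) auto
    then show ?thesis
      using False by (simp only: ev Y_part finite_atLeastAtMost if_False)
  qed
qed

text \<open>
  At \<open>point 0\<close> all variables are \<open>1\<close> and at \<open>point k\<close> the \<open>k\<close>-th one is replaced by \<open>e\<^sub>1\<^sub>2\<close>.
  In \<open>ev_multilin\<close> these points extract \<open>a\<close> from the first component and \<open>d k\<close> from the second.
\<close>

definition point :: "nat \<Rightarrow> nat \<Rightarrow> 'a calg" where
  "point k i = celem (if i = k then 0 else 1) (if i = k then 1 else 0)"

definition functional_at :: "nat \<Rightarrow> ('a, 'a calg \<Rightarrow> 'a calg) dpoly \<Rightarrow> 'a" where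
  "functional_at k f = (if k = 0 then calg_diag else calg_off) (ev (point k) f)"

lemma module_hom_functional_at: "module_hom fscale (*) (functional_at k)"
  using module_hom_compose[OF module_hom_ev module_hom_calg_parts(1), of "point k"]
    module_hom_compose[OF module_hom_ev module_hom_calg_parts(2), of "point k"]
  by (cases "k = 0") (simp_all add: functional_at_def[abs_def] comp_def)

text \<open>
  Permuting the variables of a polynomial permutes the coordinates of the points of evaluation, so the
  case \<open>\<sigma> = id\<close> is the duality of the functionals with \<open>basis_poly\<close>, and the general case gives the
  matrix of \<open>\<sigma>\<close>, which is that of the permutation of \<open>{0..n}\<close>.
\<close>

lemma ev_point_comp_basis_poly:
  assumes \<sigma>: "\<sigma> permutes {1..n}" and "k \<in> {0..n}" "l \<in> {0..n}"
  shows "(if k = 0 then calg_diag else calg_off) (ev (\<lambda>i. point k (\<sigma> i)) (basis_poly n l))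
    = of_bool (\<sigma> l = k)"
proof -
  have \<sigma>_0: "\<sigma> 0 = 0"
    using \<sigma> by (auto simp: permutes_def)
  have \<sigma>_mem: "\<sigma> i \<in> {1..n} \<longleftrightarrow> i \<in> {1..n}" for i
    by (rule permutes_in_image[OF \<sigma>])
  have inj: "\<sigma> i = \<sigma> j \<longleftrightarrow> i = j" for i j
    using permutes_inj[OF \<sigma>] by (auto dest: injD)
  show ?thesis
  proof (cases "l = 0")
    case True
    have "(\<Prod>i=1..n. if \<sigma> i = k then 0 else 1 :: 'a) = 1" if "k = 0"
      using that \<sigma>_mem by (intro prod.neutral) (metis atLeastAtMost_iff not_one_le_zero)
    then show ?thesis
      unfolding point_def ev_basis_poly using True \<sigma>_0 by auto
  next
    case False
    then have l: "l \<in> {1..n}"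
      using assms(3) by auto
    have "(\<Prod>i\<in>{1..n} - {l}. if \<sigma> i = k then 0 else 1 :: 'a) = 1" if "\<sigma> l = k"
      using that inj by (intro prod.neutral) auto
    moreover have "\<sigma> l \<noteq> 0"
      using \<sigma>_mem[of l] l by auto
    ultimately show ?thesis
      unfolding point_def ev_basis_poly using l by auto
  qed
qed

lemma functional_at_basis_poly:
  "k \<in> {0..n} \<Longrightarrow> l \<in> {0..n} \<Longrightarrow> functional_at k (basis_poly n l) = of_bool (k = l)"
  using ev_point_comp_basis_poly[OF permutes_id, of k n l] by (auto simp: functional_at_def)

lemma functional_at_separating:
  assumes x: "x \<in> multilin B n" and zero: "\<And>k. k \<in> {0..n} \<Longrightarrow> functional_at k x = 0"
  shows "ev s x = 0"
proof -
  obtain a d where ev_x: "\<And>\<alpha> \<beta>. ev (\<lambda>i. celem (\<alpha> i) (\<beta> i)) x =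
      celem (a * (\<Prod>i=1..n. \<alpha> i)) (\<Sum>k=1..n. d k * \<beta> k * (\<Prod>i\<in>{1..n} - {k}. \<alpha> i))"
    using ev_multilin[OF x] by blast
  have "(\<Prod>i=1..n. if i = 0 then 0 else 1 :: 'a) = 1"
    by (intro prod.neutral) auto
  then have a: "a = 0"
    using zero[of 0] by (simp add: functional_at_def point_def[abs_def] ev_x)
  have d: "d k = 0" if k: "k \<in> {1..n}" for k
  proof -
    have "(\<Sum>l=1..n. d l * (if l = k then 1 else 0) * (\<Prod>i\<in>{1..n} - {l}. if i = k then 0 else 1)) = (\<Sum>l=1..n. if l = k then d k else 0)"
      by (rule sum.cong) (auto intro!: prod.neutral)
    then show ?thesis
      using zero[of k] k by (simp add: functional_at_def point_def[abs_def] ev_x split: if_splits)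
  qed
  have "s = (\<lambda>i. celem (calg_diag (s i)) (calg_off (s i)))"
    by (simp add: celem_eta)
  then have "ev s x = ev (\<lambda>i. celem (calg_diag (s i)) (calg_off (s i))) x"
    by (rule arg_cong)
  also have "\<dots> = 0"
    by (simp add: ev_x a d zero_celem)
  finally show ?thesis .
qed

lemma dual_bases_multilin:
  assumes "n \<ge> 1"
  shows "dual_bases_mod fscale (multilin B n) (multilin B n \<inter> Id_C) {0..n} (basis_poly n) functional_at"
proof (rule dual_bases_mod.intro[OF FV.quot_space_axioms], unfold_locales)
  show V: "FV.subspace (multilin B n)"
    unfolding multilin_def by (rule FV.subspace_span)
  have "FV.subspace Id_C"
    using TL_ideal_diff_identities by (simp add: TL_ideal_def)
  then show "FV.subspace (multilin B n \<inter> Id_C)"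
    by (rule FV.subspace_inter[OF V])
  show "basis_poly n k \<in> multilin B n" for k
    unfolding basis_poly_def by (rule dvar_prod_multilin) (simp add: exponents_in_T)
  show "functional_at k x = 0" if "x \<in> multilin B n \<inter> Id_C" for k x
    using that by (simp add: functional_at_def diff_identities_def zero_celem)
  show "x \<in> multilin B n \<inter> Id_C" if "x \<in> multilin B n" "\<And>k. k \<in> {0..n} \<Longrightarrow> functional_at k x = 0" for x
    using functional_at_separating[OF that] that(1) multilin_in_diff_polys[OF assms]
    by (auto simp: diff_identities_def)
qed (simp_all add: functional_at_basis_poly module_hom.add[OF module_hom_functional_at]
    module_hom.scale[OF module_hom_functional_at] algebra_simps)

lemma codimension:
  assumes "n \<ge> 1"
  shows "diff_codim B cscale (\<lambda>d. d) n = n + 1"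
proof -
  have "(of_nat (diff_codim B cscale (\<lambda>d. d) n) :: 'a) = of_nat (n + 1)"
    using dual_bases_mod.of_nat_quot_dim[OF dual_bases_multilin[OF assms]] by (simp add: diff_codim_def)
  then show ?thesis
    by (simp only: of_nat_eq_iff)
qed

lemma module_hom_dpoly_perm: "module_hom fscale fscale (dpoly_perm \<sigma>)"
  unfolding dpoly_perm_def by (rule FV.module_hom_lin_ext)

lemma ev_dpoly_perm: "ev s (dpoly_perm \<sigma> f) = ev (\<lambda>i. s (\<sigma> i)) f"
proof (rule A.module_hom_eqI)
  show "module_hom fscale cscale (\<lambda>f. ev s (dpoly_perm \<sigma> f))"
    using module_hom_compose[OF module_hom_dpoly_perm module_hom_ev] by (simp add: comp_def)
  show "ev s (dpoly_perm \<sigma> (monom w)) = ev (\<lambda>i. s (\<sigma> i)) (monom w)" for w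
    by (simp add: dpoly_perm_def dsubst_def FV.lin_ext_monom A.lin_ext_monom comp_def case_prod_unfold)
qed (rule module_hom_ev)

lemma dpoly_perm_multilin:
  assumes \<sigma>: "\<sigma> permutes {1..n}"
  shows "dpoly_perm \<sigma> ` multilin B n \<subseteq> multilin B n"
proof -
  interpret P: module_hom fscale fscale "dpoly_perm \<sigma> :: _ \<Rightarrow> ('a, 'a calg \<Rightarrow> 'a calg) dpoly"
    by (rule module_hom_dpoly_perm)
  show ?thesis
    unfolding multilin_def P.span_image[symmetric]
  proof (rule FV.span_mono, safe)
    fix \<tau> :: "nat \<Rightarrow> nat" and h :: "nat \<Rightarrow> ('a calg \<Rightarrow> 'a calg) list \<Rightarrow>\<^sub>0 'a"
    assume "\<tau> permutes {1..n}" "\<forall>i\<in>{1..n}. h i \<in> B"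
    then show "\<exists>\<sigma>' h'. dpoly_perm \<sigma> (monom (map (\<lambda>i. (\<tau> i, h i)) [1..<n + 1]))
        = monom (map (\<lambda>i. (\<sigma>' i, h' i)) [1..<n + 1]) \<and> \<sigma>' permutes {1..n} \<and> (\<forall>i\<in>{1..n}. h' i \<in> B)"
      using permutes_compose[OF _ \<sigma>, of \<tau>]
      by (intro exI[of _ "\<sigma> \<circ> \<tau>"] exI[of _ h]) (simp add: dpoly_perm_def FV.lin_ext_monom comp_def)
  qed
qed

text \<open>
  The index \<open>0\<close> is always fixed and contributes the summand \<open>1\<close>.
\<close>

lemma cocharacter:
  assumes n: "n \<ge> 1" and \<sigma>: "\<sigma> permutes {1..n}"
  shows "diff_cochar B cscale (\<lambda>d. d) n \<sigma> = 1 + of_nat (card {k \<in> {1..n}. \<sigma> k = k})"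
proof -
  have stable: "dpoly_perm \<sigma> ` (multilin B n \<inter> Id_C) \<subseteq> multilin B n \<inter> Id_C"
    using dpoly_perm_multilin[OF \<sigma>] multilin_in_diff_polys[OF n]
    by (auto simp: diff_identities_def ev_dpoly_perm image_subset_iff)
  have "diff_cochar B cscale (\<lambda>d. d) n \<sigma> = (\<Sum>k=0..n. functional_at k (dpoly_perm \<sigma> (basis_poly n k)))"
    unfolding diff_cochar_def
    by (rule dual_bases_mod.quot_trace_eq[OF dual_bases_multilin[OF n] module_hom_dpoly_perm
          dpoly_perm_multilin[OF \<sigma>] stable])
  also have "\<dots> = (\<Sum>k=0..n. of_bool (\<sigma> k = k))"
    using ev_point_comp_basis_poly[OF \<sigma>] by (intro sum.cong) (simp_all add: functional_at_def ev_dpoly_perm)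
  also have "\<dots> = of_bool (\<sigma> 0 = 0) + (\<Sum>k=1..n. of_bool (\<sigma> k = k))"
    using sum.atLeast_Suc_atMost[of 0 n "\<lambda>k. of_bool (\<sigma> k = k) :: 'a"] by (simp add: One_nat_def)
  also have "\<sigma> 0 = 0"
    using \<sigma> by (auto simp: permutes_def)
  finally show ?thesis
    by (simp add: of_bool_def sum.If_cases Int_def)
qed

end


theorem theorem2:
  fixes B :: "(('a::field_char_0 calg \<Rightarrow> 'a calg) list \<Rightarrow>\<^sub>0 'a) set"
  assumes "env_basis L_eps B"
  shows "diff_identities B cscale (\<lambda>d. d) =
      TL_generated L_eps B
        {dvar L_eps B 1 1 * dvar L_eps B 2 1 - dvar L_eps B 2 1 * dvar L_eps B 1 1,
         dvar L_eps B 1 (gen eps) * dvar L_eps B 2 (gen eps),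
         dvar L_eps B 1 (gen eps * gen eps) - dvar L_eps B 1 (gen eps)} \<and>
    (\<forall>n\<ge>1. diff_codim B cscale (\<lambda>d. d) n = n + 1) \<and>
    (\<forall>n\<ge>1. \<forall>\<sigma>. \<sigma> permutes {1..n} \<longrightarrow>
      diff_cochar B cscale (\<lambda>d. d) n \<sigma> =
        2 * irr_char [n] \<sigma> + (if n = 1 then 0 else irr_char [n - 1, 1] \<sigma>))"
proof -
  interpret calg_identities B
    by (rule calg_identities.intro[OF assms])
  have "diff_cochar B cscale (\<lambda>d. d) n \<sigma> =
      2 * irr_char [n] \<sigma> + (if n = 1 then 0 else irr_char [n - 1, 1] \<sigma>)"
    if n: "n \<ge> 1" and \<sigma>: "\<sigma> permutes {1..n}" for n \<sigma>
  proof (cases "n = 1")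
    case True
    have "\<sigma> 1 = 1"
      using permutes_in_image[OF \<sigma>, of 1] by (simp add: True)
    then have "{k \<in> {1..n}. \<sigma> k = k} = {1}"
      by (auto simp: True)
    then have "diff_cochar B cscale (\<lambda>d. d) n \<sigma> = 2"
      by (simp add: cocharacter[OF n \<sigma>])
    then show ?thesis
      by (simp add: irr_char_row[OF \<sigma>] True[symmetric])
  next
    case False
    then show ?thesis
      using n by (simp add: cocharacter[OF n \<sigma>] irr_char_row[OF \<sigma>] irr_char_hook[OF _ \<sigma>])
  qed
  then show ?thesis
    using identities_eq_generated[unfolded relations_def] codimension by blast
qed

end
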